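(* Let $\mathfrak V=\langle\langle\mathfrak E,\tau\rangle,\pi,X,\{\nu_j:j\in J\}\rangle$ be a bundle of $\Omega$-spaces, $Y$ a locally compact space, $\mu$ a Radon measure on $Y$, let $\mathfrak Z=\langle\langle\mathfrak T,\gamma\rangle,\zeta,X,\mathfrak K\rangle$ be such that $\langle\mathfrak V;\mathfrak Z\rangle$ is $\mu$-related, and let $x\in X$ be a point whose filter of neighbourhoods admits a countable basis. Then $$\mathsf I_\mu\bigl([\Gamma^x_\diamond(\zeta)]_{ui}\bigr)\subseteq\Gamma_\diamond^x(\pi),$$ where $\mathsf I_\mu(H)(z)=\int H(z)(s)\,d\mu(s)$ for $z\in X$.
   Context: Vector spaces are over $\mathbb C$; Hlcs means Hausdorff locally convex space. Bundles. A bundle of $\Omega$-spaces $\langle\langle\mathfrak E,\tau\rangle,\pi,X,\mathfrak N\rangle$ (Gierz) consists of topological spaces $\langle\mathfrak E,\tau\rangle$ and $X$, a continuous open surjection $\pi:\mathfrak E\to X$, a vector space structure on each stalk $\mathfrak E_x=\pi^{-1}(x)$ such that addition $\{(a,b):\pi(a)=\pi(b)\}\to\mathfrak E$ and scalar multiplication are continuous, and a set $\mathfrak N=\{\nu_j:j\in J\}$ of functions $\mathfrak E\to[0,\infty[$ whose restrictions to each $\mathfrak E_x$ form a directed family of seminorms generating the (Hausdorff) topology induced by $\tau$ on $\mathfrak E_x$. For $U\subseteq X$, $\prod^b_{x\in U}\mathfrak E_x$ is the set of $\sigma\in\prod_{x\in U}\mathfrak E_x$ with $\sup_{x\in U}\nu_j(\sigma(x))<\infty$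 for all $j$; $\Gamma_U(\pi)$ (resp. $\Gamma_U^x(\pi)$) is the set of those continuous (resp. continuous at $x\in U$); $U$ is omitted if $U=X$. The tubes $\{\beta:\pi(\beta)\in U,\nu_j(\beta-\sigma(\pi(\beta)))<\varepsilon\}$ ($U$ open, $\sigma\in\Gamma_U(\pi)$, $\varepsilon>0$, $j\in J$) form a base of $\tau$. $\Gamma_\diamond^x(\pi)=\{H\in\Gamma^x(\pi):\exists F\in\Gamma(\pi),\ H(x)=F(x)\}$, and similarly for $\zeta$. $\mathfrak L_1(Y,E,\mu)$ ($E$ a Hlcs) is the space of scalarly essentially $\mu$-integrable maps $Y\to E$ whose (weak) integral belongs to $E$ (Bourbaki); $Meas(Y,E,\mu)$ is the space of $\mu$-measurable maps; $\int^\bullet$ is the essential upper integral. For $H\in\prod_x\mathfrak L_1(Y,\mathfrak E_x,\mu)$, $\mathsf I_\mu(H)(x)=\int H(x)(s)\,d\mu(s)\in\mathfrak E_x$. $\langle\mathfrak V;\mathfrak Z\rangle$ is $\mu$-related if: $\mathfrak Z$ is a bundle of $\Omega$-spaces; for all $x$, $\mathfrak T_x\subseteq Meas(Y,\mathfrak E_x,\mu)\cap\mathfrak L_1(Y,\mathfrak E_x,\mu)$ with directed family of seminorms $f\mapsto\sup_{(s,j)\in O}\nu_j(f(s))$, $O$ ranging over the finite subsets of $Y\times J$; $\Gamma(\zeta)\subset[\prod^b_x\mathfrak T_x]_{ui}$; and $\mathsf I_\mu(\Gamma(\zeta))\subseteq\Gamma(\pi)$. Here for $\mathcal A\subseteq\prod^b_x\mathfrak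 T_x$, $[\mathcal A]_{ui}=\{H\in\mathcal A:\int^\bullet_Y\sup_{x\in X}\nu_j(H(x)(s))\,d|\mu|(s)<\infty\ \forall j\in J\}$. *)

theory Defs
  imports "HOL-Analysis.Analysis"
begin

section \<open>Complex vector spaces on a carrier set\<close>

definition cvector_space_on ::
  "'e set \<Rightarrow> ('e \<Rightarrow> 'e \<Rightarrow> 'e) \<Rightarrow> (complex \<Rightarrow> 'e \<Rightarrow> 'e) \<Rightarrow> bool" where
  "cvector_space_on S add sc \<longleftrightarrow>
     (\<forall>a\<in>S. \<forall>b\<in>S. add a b \<in> S) \<and>
     (\<forall>a\<in>S. \<forall>b\<in>S. \<forall>c\<in>S. add (add a b) c = add a (add b c)) \<and>
     (\<forall>a\<in>S. \<forall>b\<in>S. add a b = add b a) \<and>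
     (\<exists>z\<in>S. (\<forall>a\<in>S. add z a = a) \<and> (\<forall>a\<in>S. \<exists>b\<in>S. add a b = z)) \<and>
     (\<forall>r. \<forall>a\<in>S. sc r a \<in> S) \<and>
     (\<forall>r. \<forall>a\<in>S. \<forall>b\<in>S. sc r (add a b) = add (sc r a) (sc r b)) \<and>
     (\<forall>r t. \<forall>a\<in>S. sc (r + t) a = add (sc r a) (sc t a)) \<and>
     (\<forall>r t. \<forall>a\<in>S. sc (r * t) a = sc r (sc t a)) \<and>
     (\<forall>a\<in>S. sc 1 a = a)"

definition seminorm_on ::
  "'e set \<Rightarrow> ('e \<Rightarrow> 'e \<Rightarrow> 'e) \<Rightarrow> (complex \<Rightarrow> 'e \<Rightarrow> 'e) \<Rightarrow> ('e \<Rightarrow> real) \<Rightarrow> bool" where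
  "seminorm_on S add sc p \<longleftrightarrow>
     (\<forall>a\<in>S. 0 \<le> p a) \<and>
     (\<forall>a\<in>S. \<forall>b\<in>S. p (add a b) \<le> p a + p b) \<and>
     (\<forall>r. \<forall>a\<in>S. p (sc r a) = cmod r * p a)"

definition top_dual ::
  "'e topology \<Rightarrow> ('e \<Rightarrow> 'e \<Rightarrow> 'e) \<Rightarrow> (complex \<Rightarrow> 'e \<Rightarrow> 'e) \<Rightarrow> ('e \<Rightarrow> complex) set" where
  "top_dual T add sc =
     {\<phi>. continuous_map T euclidean \<phi> \<and>
         (\<forall>a\<in>topspace T. \<forall>b\<in>topspace T. \<phi> (add a b) = \<phi> a + \<phi> b) \<and>
         (\<forall>r. \<forall>a\<in>topspace T. \<phi> (sc r a) = r * \<phi> a)}"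

section \<open>Bundles of \<open>\<Omega>\<close>-spaces\<close>

text \<open>The fibrewise operations are given by functions on the whole type; only their values on
  arguments lying in a common stalk matter.\<close>

record ('x, 'e, 'j) obundle =
  tot_top :: "'e topology"
  base_top :: "'x topology"
  bproj :: "'e \<Rightarrow> 'x"
  badd :: "'e \<Rightarrow> 'e \<Rightarrow> 'e"
  bscale :: "complex \<Rightarrow> 'e \<Rightarrow> 'e"
  bindex :: "'j set"
  bnu :: "'j \<Rightarrow> 'e \<Rightarrow> real"

definition stalk :: "('x, 'e, 'j) obundle \<Rightarrow> 'x \<Rightarrow> 'e set" where
  "stalk B x = {e \<in> topspace (tot_top B). bproj B e = x}"

definition stalk_top :: "('x, 'e, 'j) obundle \<Rightarrow> 'x \<Rightarrow> 'e topology" where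
  "stalk_top B x = subtopology (tot_top B) (stalk B x)"

definition bdiff :: "('x, 'e, 'j) obundle \<Rightarrow> 'e \<Rightarrow> 'e \<Rightarrow> 'e" where
  "bdiff B a b = badd B a (bscale B (-1) b)"

text \<open>\<open>\<Prod>\<^sup>b\<^sub>x\<^sub>\<in>\<^sub>U \<EE>\<^sub>x\<close>; sections over \<open>U\<close> are extensional functions.\<close>

definition bounded_sections :: "('x, 'e, 'j) obundle \<Rightarrow> 'x set \<Rightarrow> ('x \<Rightarrow> 'e) set" where
  "bounded_sections B U =
     {\<sigma> \<in> (\<Pi>\<^sub>E x\<in>U. stalk B x). \<forall>j\<in>bindex B. bdd_above ((\<lambda>x. bnu B j (\<sigma> x)) ` U)}"

definition Gamma_on :: "('x, 'e, 'j) obundle \<Rightarrow> 'x set \<Rightarrow> ('x \<Rightarrow> 'e) set" where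
  "Gamma_on B U =
     {\<sigma> \<in> bounded_sections B U. continuous_map (subtopology (base_top B) U) (tot_top B) \<sigma>}"

definition Gamma_at_on :: "('x, 'e, 'j) obundle \<Rightarrow> 'x set \<Rightarrow> 'x \<Rightarrow> ('x \<Rightarrow> 'e) set" where
  "Gamma_at_on B U x =
     {\<sigma> \<in> bounded_sections B U. topcontinuous_at (subtopology (base_top B) U) (tot_top B) \<sigma> x}"

abbreviation Gamma :: "('x, 'e, 'j) obundle \<Rightarrow> ('x \<Rightarrow> 'e) set" where
  "Gamma B \<equiv> Gamma_on B (topspace (base_top B))"

abbreviation Gamma_at :: "('x, 'e, 'j) obundle \<Rightarrow> 'x \<Rightarrow> ('x \<Rightarrow> 'e) set" where
  "Gamma_at B x \<equiv> Gamma_at_on B (topspace (base_top B)) x"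

definition Gamma_diamond :: "('x, 'e, 'j) obundle \<Rightarrow> 'x \<Rightarrow> ('x \<Rightarrow> 'e) set" where
  "Gamma_diamond B x = {H \<in> Gamma_at B x. \<exists>F\<in>Gamma B. H x = F x}"

definition tube :: "('x, 'e, 'j) obundle \<Rightarrow> 'x set \<Rightarrow> ('x \<Rightarrow> 'e) \<Rightarrow> 'j \<Rightarrow> real \<Rightarrow> 'e set" where
  "tube B U \<sigma> j \<epsilon> =
     {b \<in> topspace (tot_top B). bproj B b \<in> U \<and> bnu B j (bdiff B b (\<sigma> (bproj B b))) < \<epsilon>}"

definition tubes :: "('x, 'e, 'j) obundle \<Rightarrow> 'e set set" where
  "tubes B =
     {tube B U \<sigma> j \<epsilon> | U \<sigma> j \<epsilon>. openin (base_top B) U \<and> \<sigma> \<in> Gamma_on B U \<and> j \<in> bindex B \<and> 0 < \<epsilon>}"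

definition omega_bundle :: "('x, 'e, 'j) obundle \<Rightarrow> bool" where
  "omega_bundle B \<longleftrightarrow>
     continuous_map (tot_top B) (base_top B) (bproj B) \<and>
     open_map (tot_top B) (base_top B) (bproj B) \<and>
     bproj B ` topspace (tot_top B) = topspace (base_top B) \<and>
     (\<forall>x\<in>topspace (base_top B). cvector_space_on (stalk B x) (badd B) (bscale B)) \<and>
     continuous_map
       (subtopology (prod_topology (tot_top B) (tot_top B)) {(a, b). bproj B a = bproj B b})
       (tot_top B) (\<lambda>(a, b). badd B a b) \<and>
     continuous_map (prod_topology euclidean (tot_top B)) (tot_top B) (\<lambda>(r, a). bscale B r a) \<and>
     (\<forall>x\<in>topspace (base_top B).
        (\<forall>j\<in>bindex B. seminorm_on (stalk B x) (badd B) (bscale B) (bnu B j)) \<and>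
        (\<forall>i\<in>bindex B. \<forall>j\<in>bindex B. \<exists>k\<in>bindex B. \<forall>a\<in>stalk B x.
            bnu B i a \<le> bnu B k a \<and> bnu B j a \<le> bnu B k a) \<and>
        stalk_top B x =
          topology_generated_by
            {{b \<in> stalk B x. bnu B j (bdiff B b a) < \<epsilon>} | a j \<epsilon>.
               a \<in> stalk B x \<and> j \<in> bindex B \<and> 0 < \<epsilon>} \<and>
        Hausdorff_space (stalk_top B x)) \<and>
     openin (tot_top B) = arbitrary union_of (\<lambda>S. S \<in> tubes B)"

section \<open>Radon measures and essential integration in the sense of Bourbaki\<close>

text \<open>The space \<open>\<K>(Y)\<close> of continuous functions with compact support. A compact set is contained
  in \<^term>\<open>topspace Y\<close>, so its elements vanish outside \<^term>\<open>topspace Y\<close>.\<close>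

definition Kspace :: "'y topology \<Rightarrow> ('y \<Rightarrow> complex) set" where
  "Kspace Y =
     {f. continuous_map Y euclidean f \<and> (\<exists>K. compactin Y K \<and> (\<forall>y. y \<notin> K \<longrightarrow> f y = 0))}"

text \<open>A (complex) Radon measure: a linear form on \<open>\<K>(Y)\<close> which is continuous for the sup-norm on
  the functions supported by any given compact set.\<close>

definition radon_measure :: "'y topology \<Rightarrow> (('y \<Rightarrow> complex) \<Rightarrow> complex) \<Rightarrow> bool" where
  "radon_measure Y \<mu> \<longleftrightarrow>
     (\<forall>f\<in>Kspace Y. \<forall>g\<in>Kspace Y. \<mu> (\<lambda>y. f y + g y) = \<mu> f + \<mu> g) \<and>
     (\<forall>c. \<forall>f\<in>Kspace Y. \<mu> (\<lambda>y. c * f y) = c * \<mu> f) \<and>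
     (\<forall>K. compactin Y K \<longrightarrow>
        (\<exists>M. \<forall>f\<in>Kspace Y. (\<forall>y. y \<notin> K \<longrightarrow> f y = 0) \<longrightarrow>
           (\<forall>b. (\<forall>y. cmod (f y) \<le> b) \<longrightarrow> cmod (\<mu> f) \<le> M * b)))"

definition Kpos :: "'y topology \<Rightarrow> ('y \<Rightarrow> real) set" where
  "Kpos Y = {h. (\<lambda>y. complex_of_real (h y)) \<in> Kspace Y \<and> (\<forall>y. 0 \<le> h y)}"

definition abs_measure :: "'y topology \<Rightarrow> (('y \<Rightarrow> complex) \<Rightarrow> complex) \<Rightarrow> ('y \<Rightarrow> real) \<Rightarrow> ennreal" where
  "abs_measure Y \<mu> h = (SUP g\<in>{g \<in> Kspace Y. \<forall>y. cmod (g y) \<le> h y}. ennreal (cmod (\<mu> g)))"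

definition lsc_on :: "'y topology \<Rightarrow> ('y \<Rightarrow> ennreal) \<Rightarrow> bool" where
  "lsc_on Y g \<longleftrightarrow> (\<forall>a. openin Y {y \<in> topspace Y. a < g y})"

definition upper_integral_lsc ::
  "'y topology \<Rightarrow> (('y \<Rightarrow> complex) \<Rightarrow> complex) \<Rightarrow> ('y \<Rightarrow> ennreal) \<Rightarrow> ennreal" where
  "upper_integral_lsc Y \<mu> g =
     (SUP h\<in>{h \<in> Kpos Y. \<forall>y\<in>topspace Y. ennreal (h y) \<le> g y}. abs_measure Y \<mu> h)"

definition upper_integral ::
  "'y topology \<Rightarrow> (('y \<Rightarrow> complex) \<Rightarrow> complex) \<Rightarrow> ('y \<Rightarrow> ennreal) \<Rightarrow> ennreal" where
  "upper_integral Y \<mu> f =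
     (INF g\<in>{g. lsc_on Y g \<and> (\<forall>y\<in>topspace Y. f y \<le> g y)}. upper_integral_lsc Y \<mu> g)"

definition ess_upper_integral ::
  "'y topology \<Rightarrow> (('y \<Rightarrow> complex) \<Rightarrow> complex) \<Rightarrow> ('y \<Rightarrow> ennreal) \<Rightarrow> ennreal" where
  "ess_upper_integral Y \<mu> f =
     (SUP K\<in>{K. compactin Y K}. upper_integral Y \<mu> (\<lambda>y. f y * indicator K y))"

text \<open>Essentially integrable functions form the closure of \<open>\<K>(Y)\<close> for the seminorm
  \<open>f \<mapsto> \<integral>\<^sup>\<bullet> |f| d|\<mu>|\<close>, and the integral is the extension of \<open>\<mu>\<close> by continuity.\<close>

definition ess_integrable ::
  "'y topology \<Rightarrow> (('y \<Rightarrow> complex) \<Rightarrow> complex) \<Rightarrow> ('y \<Rightarrow> complex) \<Rightarrow> bool" where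
  "ess_integrable Y \<mu> f \<longleftrightarrow>
     (\<forall>\<epsilon>>0. \<exists>g\<in>Kspace Y. ess_upper_integral Y \<mu> (\<lambda>y. ennreal (cmod (f y - g y))) < ennreal \<epsilon>)"

definition ess_integral ::
  "'y topology \<Rightarrow> (('y \<Rightarrow> complex) \<Rightarrow> complex) \<Rightarrow> ('y \<Rightarrow> complex) \<Rightarrow> complex" where
  "ess_integral Y \<mu> f =
     (THE I. \<forall>\<epsilon>>0. \<exists>g\<in>Kspace Y.
        ess_upper_integral Y \<mu> (\<lambda>y. ennreal (cmod (f y - g y))) < ennreal \<epsilon> \<and> cmod (I - \<mu> g) < \<epsilon>)"

text \<open>\<open>\<mu>\<close>-measurable maps into a topological space: every compact set is, up to a negligible set,
  partitioned into a sequence of compact sets on each of which the map is continuous.\<close>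

definition Meas ::
  "'y topology \<Rightarrow> (('y \<Rightarrow> complex) \<Rightarrow> complex) \<Rightarrow> 'e topology \<Rightarrow> ('y \<Rightarrow> 'e) set" where
  "Meas Y \<mu> T =
     {f \<in> topspace Y \<rightarrow>\<^sub>E topspace T.
        \<forall>K. compactin Y K \<longrightarrow>
          (\<exists>N C. N \<subseteq> K \<and> upper_integral Y \<mu> (indicator N) = 0 \<and>
             (\<forall>n::nat. compactin Y (C n)) \<and> disjoint_family C \<and> K - N = (\<Union>n. C n) \<and>
             (\<forall>n. continuous_map (subtopology Y (C n)) T f))}"

definition is_weak_integral ::
  "'y topology \<Rightarrow> (('y \<Rightarrow> complex) \<Rightarrow> complex) \<Rightarrow> 'e topology \<Rightarrow> ('e \<Rightarrow> 'e \<Rightarrow> 'e) \<Rightarrow>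
     (complex \<Rightarrow> 'e \<Rightarrow> 'e) \<Rightarrow> ('y \<Rightarrow> 'e) \<Rightarrow> 'e \<Rightarrow> bool" where
  "is_weak_integral Y \<mu> T add sc f e \<longleftrightarrow>
     e \<in> topspace T \<and> (\<forall>\<phi>\<in>top_dual T add sc. \<phi> e = ess_integral Y \<mu> (\<lambda>s. \<phi> (f s)))"

definition weak_integral ::
  "'y topology \<Rightarrow> (('y \<Rightarrow> complex) \<Rightarrow> complex) \<Rightarrow> 'e topology \<Rightarrow> ('e \<Rightarrow> 'e \<Rightarrow> 'e) \<Rightarrow>
     (complex \<Rightarrow> 'e \<Rightarrow> 'e) \<Rightarrow> ('y \<Rightarrow> 'e) \<Rightarrow> 'e" where
  "weak_integral Y \<mu> T add sc f = (THE e. is_weak_integral Y \<mu> T add sc f e)"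

definition L1 ::
  "'y topology \<Rightarrow> (('y \<Rightarrow> complex) \<Rightarrow> complex) \<Rightarrow> 'e topology \<Rightarrow> ('e \<Rightarrow> 'e \<Rightarrow> 'e) \<Rightarrow>
     (complex \<Rightarrow> 'e \<Rightarrow> 'e) \<Rightarrow> ('y \<Rightarrow> 'e) set" where
  "L1 Y \<mu> T add sc =
     {f \<in> topspace Y \<rightarrow>\<^sub>E topspace T.
        (\<forall>\<phi>\<in>top_dual T add sc. ess_integrable Y \<mu> (\<lambda>s. \<phi> (f s))) \<and>
        (\<exists>e. is_weak_integral Y \<mu> T add sc f e)}"

section \<open>\<open>\<mu>\<close>-related bundles\<close>

definition I_mu ::
  "('x, 'e, 'j) obundle \<Rightarrow> 'y topology \<Rightarrow> (('y \<Rightarrow> complex) \<Rightarrow> complex) \<Rightarrow> ('x \<Rightarrow> 'y \<Rightarrow> 'e) \<Rightarrow> 'x \<Rightarrow> 'e" where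
  "I_mu V Y \<mu> H =
     (\<lambda>z\<in>topspace (base_top V). weak_integral Y \<mu> (stalk_top V z) (badd V) (bscale V) (H z))"

definition ui ::
  "('x, 'e, 'j) obundle \<Rightarrow> 'y topology \<Rightarrow> (('y \<Rightarrow> complex) \<Rightarrow> complex) \<Rightarrow>
     ('x \<Rightarrow> 'y \<Rightarrow> 'e) set \<Rightarrow> ('x \<Rightarrow> 'y \<Rightarrow> 'e) set" where
  "ui V Y \<mu> A =
     {H \<in> A. \<forall>j\<in>bindex V.
        ess_upper_integral Y \<mu> (\<lambda>s. SUP z\<in>topspace (base_top V). ennreal (bnu V j (H z s))) < \<infinity>}"

text \<open>The points of the total space of \<open>Z\<close> are (extensional) maps from \<open>Y\<close> into stalks of \<open>V\<close>, with
  pointwise operations. Its seminorms are indexed by the finite subsets \<open>Q\<close> of \<open>Y \<times> J\<close>; inserting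
  \<open>0\<close> makes the supremum over the empty set equal to \<open>0\<close>.\<close>

definition mu_related ::
  "'y topology \<Rightarrow> (('y \<Rightarrow> complex) \<Rightarrow> complex) \<Rightarrow> ('x, 'e, 'j) obundle \<Rightarrow>
     ('x, 'y \<Rightarrow> 'e, ('y \<times> 'j) set) obundle \<Rightarrow> bool" where
  "mu_related Y \<mu> V Z \<longleftrightarrow>
     omega_bundle Z \<and>
     base_top Z = base_top V \<and>
     (\<forall>x\<in>topspace (base_top V).
        stalk Z x \<subseteq> Meas Y \<mu> (stalk_top V x) \<inter> L1 Y \<mu> (stalk_top V x) (badd V) (bscale V) \<and>
        (\<forall>f\<in>stalk Z x. \<forall>g\<in>stalk Z x. badd Z f g = (\<lambda>s\<in>topspace Y. badd V (f s) (g s))) \<and>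
        (\<forall>r. \<forall>f\<in>stalk Z x. bscale Z r f = (\<lambda>s\<in>topspace Y. bscale V r (f s)))) \<and>
     bindex Z = {Q. finite Q \<and> Q \<subseteq> topspace Y \<times> bindex V} \<and>
     (\<forall>Q\<in>bindex Z. \<forall>f\<in>topspace (tot_top Z).
        bnu Z Q f = Max (insert 0 ((\<lambda>(s, j). bnu V j (f s)) ` Q))) \<and>
     Gamma Z \<subseteq> ui V Y \<mu> (bounded_sections Z (topspace (base_top V))) \<and>
     I_mu V Y \<mu> ` Gamma Z \<subseteq> Gamma V"

definition countable_nhds_basis_at :: "'x topology \<Rightarrow> 'x \<Rightarrow> bool" where
  "countable_nhds_basis_at X x \<longleftrightarrow>
     (\<exists>\<B>. countable \<B> \<and>
        (\<forall>V\<in>\<B>. V \<subseteq> topspace X \<and> (\<exists>W. openin X W \<and> x \<in> W \<and> W \<subseteq> V)) \<and>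
        (\<forall>U. openin X U \<and> x \<in> U \<longrightarrow> (\<exists>V\<in>\<B>. V \<subseteq> U)))"

end

theory Submission
  imports Defs
begin

text \<open>Let \<open>F\<close> be a continuous section of \<open>\<ZZ>\<close> with \<open>H x = F x\<close>. Since the integral of \<open>F\<close> is a continuous
  section, tubes reduce the claim to \<open>\<nu>\<^sub>j (\<integral> H z - \<integral> F z) \<rightarrow> 0\<close> as \<open>z \<rightarrow> x\<close>. By Hahn--Banach some functional
  dominated by \<open>\<nu>\<^sub>j\<close> attains this value, so it is at most \<open>\<integral>\<^sup>\<bullet> \<nu>\<^sub>j (H z s - F z s) d|\<mu>| s\<close>. The seminorms of
  \<open>\<ZZ>\<close> give pointwise convergence of the integrand to \<open>0\<close>, both families are dominated by functions with
  finite essential upper integral, and the countable basis of neighbourhoods allows one to argue with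
  sequences, so dominated convergence applies. The latter is obtained in Daniell's way: the essential
  upper integral is countably subadditive, and additive on the closure of the positive functions in
  \<open>\<K>(Y)\<close>, to which the integrands belong because they are measurable with finite essential upper
  integral.\<close>

section \<open>The Hahn--Banach theorem on carrier sets\<close>

text \<open>The measure is only a complex linear form on \<open>Kspace Y\<close>, so every estimate
  is drawn from \<open>abs_measure\<close> and the upper integrals built on it, without a
  sigma-algebra in between. Two obstacles shape the argument. An upper integral is subadditive but
  in general not additive, while dominated convergence needs additivity to control telescoping sums;
  this is why the integrands must be shown to lie in a cone on which additivity holds. The
  dominating functions are suprema over all points of the base, for which no measurability is
  available; they therefore enter only as upper bounds with finite essential upper integral. Values
  of a section at different points lie in different stalks, so \<open>H z\<close> cannot be compared
  with \<open>H x\<close> directly. The section \<open>F\<close> provides a vector to compare with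
  in each stalk, both before and after integration. A difference of two vector integrals is
  estimated by applying one functional to each of them, which reduces it to a difference of two
  scalar integrals.\<close>

locale complex_carrier_space =
  fixes S :: "'e set" and add :: "'e \<Rightarrow> 'e \<Rightarrow> 'e" and sc :: "complex \<Rightarrow> 'e \<Rightarrow> 'e"
  assumes cvector_space: "cvector_space_on S add sc"
begin

lemma add_closed [simp, intro]: "a \<in> S \<Longrightarrow> b \<in> S \<Longrightarrow> add a b \<in> S"
  and add_assoc: "a \<in> S \<Longrightarrow> b \<in> S \<Longrightarrow> c \<in> S \<Longrightarrow> add (add a b) c = add a (add b c)"
  and add_commute: "a \<in> S \<Longrightarrow> b \<in> S \<Longrightarrow> add a b = add b a"
  and scale_closed [simp, intro]: "a \<in> S \<Longrightarrow> sc r a \<in> S"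
  and scale_add_right: "a \<in> S \<Longrightarrow> b \<in> S \<Longrightarrow> sc r (add a b) = add (sc r a) (sc r b)"
  and scale_add_left: "a \<in> S \<Longrightarrow> sc (r + t) a = add (sc r a) (sc t a)"
  and scale_scale: "a \<in> S \<Longrightarrow> sc r (sc t a) = sc (r * t) a"
  and scale_one [simp]: "a \<in> S \<Longrightarrow> sc 1 a = a"
  using cvector_space unfolding cvector_space_on_def by (blast | metis)+

lemma add_left_commute:
  "a \<in> S \<Longrightarrow> b \<in> S \<Longrightarrow> c \<in> S \<Longrightarrow> add a (add b c) = add b (add a c)"
  by (metis add_assoc add_commute)

text \<open>The carrier has no named zero: \<open>cvector_space_on\<close> only asserts that one
  exists. The idempotent \<open>sc 0 b\<close> equals it for every \<open>b\<close> of the carrier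
  and is used as its name from here on.\<close>

lemma add_scale_zero [simp]:
  assumes "a \<in> S" "b \<in> S"
  shows "add a (sc 0 b) = a" and "add (sc 0 b) a = a"
proof -
  obtain z where z: "z \<in> S" "\<And>a. a \<in> S \<Longrightarrow> add z a = a" "\<And>a. a \<in> S \<Longrightarrow> \<exists>b\<in>S. add a b = z"
    using cvector_space unfolding cvector_space_on_def by (elim conjE bexE) metis
  have idem: "add (sc 0 b) (sc 0 b) = sc 0 b"
    using scale_add_left[of b 0 0] assms by simp
  obtain n where n: "n \<in> S" "add (sc 0 b) n = z"
    using z(3) assms by blast
  have "sc 0 b = add (sc 0 b) z"
    using z(1,2) assms by (metis add_commute scale_closed)
  also have "\<dots> = add (add (sc 0 b) (sc 0 b)) n"
    using n assms by (simp add: add_assoc)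
  finally have "sc 0 b = z" using idem n by simp
  then show "add a (sc 0 b) = a" "add (sc 0 b) a = a"
    using z assms by (metis add_commute)+
qed

lemma add_minus: "a \<in> S \<Longrightarrow> add a (sc (-1) a) = sc 0 a"
  using scale_add_left[of a 1 "-1"] by simp

abbreviation diff :: "'e \<Rightarrow> 'e \<Rightarrow> 'e" where
  "diff a b \<equiv> add a (sc (-1) b)"

lemma diff_add_cancel: "a \<in> S \<Longrightarrow> b \<in> S \<Longrightarrow> add (diff a b) b = a"
  by (simp add: add_assoc add_commute[of "sc (-1) b" b] add_minus)

lemma diff_chain: "a \<in> S \<Longrightarrow> b \<in> S \<Longrightarrow> c \<in> S \<Longrightarrow> add (diff a b) (diff b c) = diff a c"
  using add_assoc[of "diff a b" b "sc (-1) c"] by (simp add: diff_add_cancel)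

lemma scale_minus_diff: "a \<in> S \<Longrightarrow> b \<in> S \<Longrightarrow> sc (-1) (diff a b) = diff b a"
  using add_commute[of "sc (-1) a" b] by (simp add: scale_add_right scale_scale)

text \<open>Homogeneity is demanded as an inequality for positive factors only, the form that is
  easiest to check for infima. Equality follows in \<open>sublinear_scale\<close> by applying the
  inequality to the reciprocal factor.\<close>

definition sublinear :: "('e \<Rightarrow> real) \<Rightarrow> bool" where
  "sublinear q \<longleftrightarrow> (\<forall>a\<in>S. \<forall>b\<in>S. q (add a b) \<le> q a + q b) \<and>
     (\<forall>r>0. \<forall>a\<in>S. q (sc (complex_of_real r) a) \<le> r * q a)"

lemma sublinear_add: "sublinear q \<Longrightarrow> a \<in> S \<Longrightarrow> b \<in> S \<Longrightarrow> q (add a b) \<le> q a + q b"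
  by (simp add: sublinear_def)

text \<open>Subadditivity at zero gives a value that is at least 0, and the factor 1/2 gives one
  that is at most half of itself.\<close>

lemma sublinear_zero:
  assumes "sublinear q" "a \<in> S" shows "q (sc 0 a) = 0"
proof -
  have "q (sc 0 a) \<le> q (sc 0 a) + q (sc 0 a)"
    using sublinear_add[OF assms(1), of "sc 0 a" "sc 0 a"] assms by simp
  moreover have "q (sc (complex_of_real (1/2)) (sc 0 a)) \<le> 1/2 * q (sc 0 a)"
    using assms unfolding sublinear_def by (meson half_gt_zero_iff scale_closed zero_less_one)
  ultimately show ?thesis using assms by (simp add: scale_scale)
qed

lemma sublinear_scale:
  assumes q: "sublinear q" and a: "a \<in> S" and r: "0 \<le> r"
  shows "q (sc (complex_of_real r) a) = r * q a"
proof (cases "r = 0")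
  case True then show ?thesis using sublinear_zero[OF q a] by simp
next
  case False
  with r have r: "r > 0" by simp
  have 1: "q (sc (complex_of_real r) a) \<le> r * q a"
    using q a r by (simp add: sublinear_def)
  have "q (sc (complex_of_real (1/r)) (sc (complex_of_real r) a)) \<le> (1/r) * q (sc (complex_of_real r) a)"
    using q a r unfolding sublinear_def by (meson scale_closed zero_less_divide_1_iff)
  then have "q a \<le> (1/r) * q (sc (complex_of_real r) a)"
    using a r by (simp add: scale_scale flip: of_real_mult)
  with 1 r show ?thesis by (simp add: field_simps)
qed

text \<open>Subadditivity for b = -a + (a + b). Its role is to bound the terms of a descent from
  below by a number that does not depend on \<open>t\<close>.\<close>

lemma sublinear_lower: 
  assumes q: "sublinear q" and "a \<in> S" "b \<in> S"
  shows "q b - q (sc (-1) a) \<le> q (add a b)"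
proof -
  have "q (add (sc (-1) a) (add a b)) \<le> q (sc (-1) a) + q (add a b)"
    using assms by (intro sublinear_add) auto
  moreover have "add (sc (-1) a) (add a b) = b"
    using assms by (metis add_assoc add_commute add_minus add_scale_zero(2) scale_closed)
  ultimately show ?thesis by simp
qed

text \<open>The descent of \<open>q\<close> along \<open>a\<close> is a sublinear functional below \<open>q\<close>. It coincides with a minimal \<open>q\<close>,
  and the term \<open>t = 1\<close> of the infimum then shows that \<open>q\<close> is additive.\<close>

definition descent :: "('e \<Rightarrow> real) \<Rightarrow> 'e \<Rightarrow> 'e \<Rightarrow> real" where
  "descent q a b = (INF t\<in>{0..}. q (add b (sc (complex_of_real t) a)) - t * q a)"

lemma descent_bdd_below:
  assumes "sublinear q" "a \<in> S" "b \<in> S"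
  shows "bdd_below ((\<lambda>t. q (add b (sc (complex_of_real t) a)) - t * q a) ` {0..})"
proof (rule bdd_belowI2)
  fix t :: real assume "t \<in> {0..}"
  then show "- q (sc (-1) b) \<le> q (add b (sc (complex_of_real t) a)) - t * q a"
    using sublinear_lower[OF assms(1,3), of "sc (complex_of_real t) a"] sublinear_scale[OF assms(1,2), of t] assms
    by simp
qed

lemma descent_le:
  assumes "sublinear q" "a \<in> S" "b \<in> S" "0 \<le> t"
  shows "descent q a b \<le> q (add b (sc (complex_of_real t) a)) - t * q a"
  unfolding descent_def using assms by (intro cINF_lower descent_bdd_below) auto

lemma le_descent:
  assumes "\<And>t. 0 \<le> t \<Longrightarrow> c \<le> q (add b (sc (complex_of_real t) a)) - t * q a"
  shows "c \<le> descent q a b"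
  unfolding descent_def using assms by (intro cINF_greatest) auto

text \<open>The terms with parameters s for \<open>b\<close> and t for \<open>c\<close> add up to at
  least the term with parameter s + t for their sum; the two infima are then taken one after the
  other. Scaling by r matches parameter t with r * t.\<close>

lemma descent_sublinear:
  assumes q: "sublinear q" and a: "a \<in> S"
  shows "sublinear (descent q a)"
  unfolding sublinear_def
proof (intro conjI ballI allI impI)
  fix b c assume b: "b \<in> S" and c: "c \<in> S"
  have key: "descent q a (add b c) \<le>
      (q (add b (sc (complex_of_real s) a)) - s * q a) + (q (add c (sc (complex_of_real t) a)) - t * q a)"
    if "0 \<le> s" "0 \<le> t" for s t
  proof -
    let ?s = "sc (complex_of_real s) a" and ?t = "sc (complex_of_real t) a"
    have "descent q a (add b c) \<le> q (add (add b c) (sc (complex_of_real (s + t)) a)) - (s + t) * q a"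
      using that q a b c by (intro descent_le) auto
    also have "add (add b c) (sc (complex_of_real (s + t)) a) = add (add b ?s) (add c ?t)"
      using a b c by (simp add: scale_add_left add_assoc add_left_commute)
    finally show ?thesis
      using sublinear_add[OF q, of "add b ?s" "add c ?t"] a b c by (simp add: algebra_simps)
  qed
  have "descent q a (add b c) - (q (add c (sc (complex_of_real t) a)) - t * q a) \<le> descent q a b"
    if "0 \<le> t" for t
    using key[OF _ that] by (intro le_descent) (simp add: algebra_simps)
  then have "descent q a (add b c) - descent q a b \<le> descent q a c"
    by (intro le_descent) (simp add: algebra_simps)
  then show "descent q a (add b c) \<le> descent q a b + descent q a c" by simp
next
  fix r :: real and b assume r: "0 < r" and b: "b \<in> S"
  have "descent q a (sc (complex_of_real r) b) / r \<le> descent q a b"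
  proof (rule le_descent)
    fix t :: real assume t: "0 \<le> t"
    have "descent q a (sc (complex_of_real r) b) \<le>
        q (add (sc (complex_of_real r) b) (sc (complex_of_real (r * t)) a)) - (r * t) * q a"
      using r t q a b by (intro descent_le) auto
    also have "add (sc (complex_of_real r) b) (sc (complex_of_real (r * t)) a) =
        sc (complex_of_real r) (add b (sc (complex_of_real t) a))"
      using a b by (simp add: scale_add_right scale_scale)
    also have "q \<dots> = r * q (add b (sc (complex_of_real t) a))"
      using a b r q by (intro sublinear_scale) auto
    finally show "descent q a (sc (complex_of_real r) b) / r \<le> q (add b (sc (complex_of_real t) a)) - t * q a"
      using r by (simp add: field_simps)
  qed
  then show "descent q a (sc (complex_of_real r) b) \<le> r * descent q a b"
    using r by (simp add: field_simps)
qed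

lemma descent_le_self:
  assumes "sublinear q" "a \<in> S" "b \<in> S" shows "descent q a b \<le> q b"
  using descent_le[OF assms, of 0] assms by simp

lemma sublinear_cong: "sublinear q \<Longrightarrow> (\<And>a. a \<in> S \<Longrightarrow> q a = r a) \<Longrightarrow> sublinear r"
  by (auto simp: sublinear_def)

text \<open>Zorn's lemma for the reversed pointwise order. A chain has its pointwise infimum as
  bound, which is finite because 0 = q(a + (-a)) forces q(a) to be at least -p(-a) for every q below
  p.\<close>

lemma minimal_sublinear_exists:
  assumes p: "sublinear p"
  obtains q where "sublinear q" "\<And>a. a \<in> S \<Longrightarrow> q a \<le> p a"
    "\<And>r a. sublinear r \<Longrightarrow> (\<And>b. b \<in> S \<Longrightarrow> r b \<le> q b) \<Longrightarrow> a \<in> S \<Longrightarrow> r a = q a"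
proof -
  \<comment> \<open>Functionals are made extensional, since otherwise agreement on the carrier would
    not give equality and antisymmetry would fail.\<close>
  define A where "A = {q \<in> extensional S. sublinear q \<and> (\<forall>a\<in>S. q a \<le> p a)}"
  define P where "P q r \<longleftrightarrow> (\<forall>a\<in>S. r a \<le> q a)" for q r :: "'e \<Rightarrow> real"
  have po: "partial_order_on A (relation_of P A)"
    unfolding partial_order_on_def preorder_on_def
  proof (intro conjI)
    show "relation_of P A \<subseteq> A \<times> A" "refl_on A (relation_of P A)"
      by (auto simp: refl_on_def relation_of_def P_def)
    show "trans (relation_of P A)"
      unfolding trans_def relation_of_def P_def by (auto intro: order_trans)
    show "antisym (relation_of P A)"
      unfolding antisym_def relation_of_def P_def A_def
      by (auto intro!: extensionalityI[of _ S] intro: antisym[of "_ _ :: real"])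
  qed
  have lower: "- p (sc (-1) a) \<le> q a" if "q \<in> A" "a \<in> S" for q a
  proof -
    have "q (sc 0 a) \<le> q a + q (sc (-1) a)"
      using that sublinear_add[of q a "sc (-1) a"] by (auto simp: A_def add_minus)
    moreover have "q (sc 0 a) = 0" "q (sc (-1) a) \<le> p (sc (-1) a)"
      using that sublinear_zero by (auto simp: A_def)
    ultimately show ?thesis by simp
  qed
  have "\<exists>m\<in>A. \<forall>a\<in>A. P m a \<longrightarrow> a = m"
  proof (rule predicate_Zorn[OF po])
    fix C assume C: "C \<in> Chains (relation_of P A)"
    then have CA: "C \<subseteq> A" and chain: "\<And>q r. q \<in> C \<Longrightarrow> r \<in> C \<Longrightarrow> P q r \<or> P r q"
      by (auto simp: Chains_def relation_of_def)
    show "\<exists>u\<in>A. \<forall>a\<in>C. P a u"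
    proof (cases "C = {}")
      case True
      have "restrict p S \<in> A"
        unfolding A_def using sublinear_cong[OF p, of "restrict p S"] by auto
      with True show ?thesis by blast
    next
      case False
      define u where "u = (\<lambda>a\<in>S. INF q\<in>C. q a)"
      have bdd: "bdd_below ((\<lambda>q. q a) ` C)" if "a \<in> S" for a
        using lower[OF _ that] CA by (intro bdd_belowI2[of _ "- p (sc (-1) a)"]) auto
      have u_le: "u a \<le> q a" if "q \<in> C" "a \<in> S" for q a
        unfolding u_def using that cINF_lower[OF bdd[OF that(2)] that(1)] by simp
      have le_u: "c \<le> u a" if "a \<in> S" "\<And>q. q \<in> C \<Longrightarrow> c \<le> q a" for c a
        unfolding u_def using that False by (simp add: cINF_greatest)
      have "sublinear u"
        unfolding sublinear_def
      proof (intro conjI ballI allI impI)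
        fix a b assume ab: "a \<in> S" "b \<in> S"
        \<comment> \<open>Of two members of the chain one lies below the other, so a single
          sublinear functional lies below \<open>q\<close> at \<open>a\<close> and below
          \<open>r\<close> at \<open>b\<close>.\<close>
        have key: "u (add a b) \<le> q a + r b" if qr: "q \<in> C" "r \<in> C" for q r
        proof -
          obtain s where s: "s \<in> C" "s a \<le> q a" "s b \<le> r b"
            using chain[OF qr] qr ab unfolding P_def by blast
          have "u (add a b) \<le> s (add a b)" using s ab by (intro u_le) auto
          also have "\<dots> \<le> s a + s b" using s CA ab by (intro sublinear_add) (auto simp: A_def)
          finally show ?thesis using s by simp
        qed
        have "u (add a b) - r b \<le> u a" if "r \<in> C" for r
          using key[OF _ that] ab by (intro le_u) (auto simp: algebra_simps)
        then have "u (add a b) - u a \<le> u b"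
          using ab by (intro le_u) (auto simp: algebra_simps)
        then show "u (add a b) \<le> u a + u b" by simp
      next
        fix r :: real and a assume r: "0 < r" and a: "a \<in> S"
        have "u (sc (complex_of_real r) a) / r \<le> u a"
        proof (rule le_u[OF a])
          fix q assume q: "q \<in> C"
          have "u (sc (complex_of_real r) a) \<le> q (sc (complex_of_real r) a)" using q a by (intro u_le) auto
          also have "\<dots> = r * q a" using q CA a r by (intro sublinear_scale) (auto simp: A_def)
          finally show "u (sc (complex_of_real r) a) / r \<le> q a" using r by (simp add: field_simps)
        qed
        then show "u (sc (complex_of_real r) a) \<le> r * u a" using r by (simp add: field_simps)
      qed
      moreover have "\<forall>a\<in>S. u a \<le> p a"
      proof
        fix a assume a: "a \<in> S"
        obtain q where q: "q \<in> C" using False by blast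
        then have "q a \<le> p a" using CA a by (auto simp: A_def)
        then show "u a \<le> p a" using u_le[OF q a] by simp
      qed
      ultimately have "u \<in> A" by (auto simp: A_def u_def)
      moreover have "\<forall>q\<in>C. P q u" using u_le by (auto simp: P_def)
      ultimately show ?thesis by blast
    qed
  qed
  then obtain q where q: "q \<in> A" and min: "\<And>r. r \<in> A \<Longrightarrow> P q r \<Longrightarrow> r = q" by blast
  show thesis
  proof (rule that[of q])
    fix r a assume r: "sublinear r" "\<And>b. b \<in> S \<Longrightarrow> r b \<le> q b" "a \<in> S"
    have "restrict r S \<in> A"
      using r q sublinear_cong[OF r(1), of "restrict r S"] unfolding A_def by (auto intro: order_trans)
    moreover have "P q (restrict r S)" using r by (auto simp: P_def)
    ultimately have "restrict r S = q" by (rule min)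
    with r show "r a = q a" by auto
  qed (use q in \<open>auto simp: A_def\<close>)
qed

text \<open>The minimal functional is sought below \<open>descent p a0\<close> instead of
  \<open>p\<close>. The term t = 1 of that descent at -a0 gives q(-a0) \<le> -p(a0), and oddness of
  q turns this into the missing inequality p(a0) \<le> q(a0).\<close>

lemma real_Hahn_Banach:
  assumes p: "sublinear p" and a0: "a0 \<in> S"
  obtains f where "\<And>a b. a \<in> S \<Longrightarrow> b \<in> S \<Longrightarrow> f (add a b) = f a + f b"
    "\<And>r a. a \<in> S \<Longrightarrow> f (sc (complex_of_real r) a) = r * f a"
    "\<And>a. a \<in> S \<Longrightarrow> f a \<le> p a" "f a0 = p a0"
proof -
  obtain q where q: "sublinear q" and q_le: "\<And>a. a \<in> S \<Longrightarrow> q a \<le> descent p a0 a"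
    and min: "\<And>r a. sublinear r \<Longrightarrow> (\<And>b. b \<in> S \<Longrightarrow> r b \<le> q b) \<Longrightarrow> a \<in> S \<Longrightarrow> r a = q a"
    using minimal_sublinear_exists[OF descent_sublinear[OF p a0]] by blast
  have add: "q (add a b) = q a + q b" if "a \<in> S" "b \<in> S" for a b
  proof -
    have "q a = descent q b a"
      using min[OF descent_sublinear[OF q that(2)] descent_le_self[OF q that(2)] that(1)] by simp
    also have "\<dots> \<le> q (add a b) - q b"
      using descent_le[OF q that(2,1), of 1] that by simp
    finally show ?thesis using sublinear_add[OF q that] by simp
  qed
  have neg: "q (sc (-1) a) = - q a" if "a \<in> S" for a
    using add[of a "sc (-1) a"] that sublinear_zero[OF q that] by (simp add: add_minus)
  have scale: "q (sc (complex_of_real r) a) = r * q a" if "a \<in> S" for r a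
  proof (cases "0 \<le> r")
    case True then show ?thesis using sublinear_scale[OF q that] by simp
  next
    case False
    have "q (sc (complex_of_real (- r)) (sc (-1) a)) = - r * q (sc (-1) a)"
      using False that by (intro sublinear_scale[OF q]) auto
    then show ?thesis using that neg by (simp add: scale_scale)
  qed
  have le: "q a \<le> p a" if "a \<in> S" for a
    using q_le[OF that] descent_le_self[OF p a0 that] by simp
  have "q (sc (-1) a0) \<le> p (add (sc (-1) a0) (sc (complex_of_real 1) a0)) - 1 * p a0"
    using a0 by (intro order_trans[OF q_le descent_le] p) auto
  also have "add (sc (-1) a0) (sc (complex_of_real 1) a0) = sc 0 a0"
    using a0 add_minus by (simp add: add_commute)
  finally have "p a0 \<le> q a0" using neg[OF a0] sublinear_zero[OF p a0] by simp
  with le[OF a0] have "q a0 = p a0" by simp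
  with add scale le show thesis using that[of q] by blast
qed

section \<open>The passage from real to complex linear forms\<close>

lemma seminorm_sublinear: "seminorm_on S add sc p \<Longrightarrow> sublinear p"
  by (simp add: sublinear_def seminorm_on_def)

text \<open>A complex form is recovered from its real part f as a \<mapsto> f(a) - \<i> f(\<i> a).
  At a0 the real part already has the size p(a0), which the modulus may not exceed, so the imaginary
  part vanishes.\<close>

theorem complex_Hahn_Banach:
  assumes p: "seminorm_on S add sc p" and a0: "a0 \<in> S"
  obtains \<phi> :: "'e \<Rightarrow> complex" where "\<And>a b. a \<in> S \<Longrightarrow> b \<in> S \<Longrightarrow> \<phi> (add a b) = \<phi> a + \<phi> b"
    "\<And>r a. a \<in> S \<Longrightarrow> \<phi> (sc r a) = r * \<phi> a"
    "\<And>a. a \<in> S \<Longrightarrow> cmod (\<phi> a) \<le> p a" "\<phi> a0 = complex_of_real (p a0)"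
proof -
  obtain f where add: "\<And>a b. a \<in> S \<Longrightarrow> b \<in> S \<Longrightarrow> f (add a b) = f a + f b"
    and scale: "\<And>r a. a \<in> S \<Longrightarrow> f (sc (complex_of_real r) a) = r * f a"
    and le: "\<And>a. a \<in> S \<Longrightarrow> f a \<le> p a" and eq: "f a0 = p a0"
    using real_Hahn_Banach[OF seminorm_sublinear[OF p] a0] by blast
  define \<phi> where "\<phi> a = Complex (f a) (- f (sc \<i> a))" for a
  have phi_add: "\<phi> (add a b) = \<phi> a + \<phi> b" if "a \<in> S" "b \<in> S" for a b
    using that by (simp add: \<phi>_def add scale_add_right complex_eq_iff)
  have f_scale: "f (sc r a) = Re r * f a + Im r * f (sc \<i> a)" if "a \<in> S" for r a
  proof -
    have "sc r a = add (sc (complex_of_real (Re r)) a) (sc (complex_of_real (Im r)) (sc \<i> a))"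
      using that complex_eq[of r] by (simp add: scale_scale mult.commute flip: scale_add_left)
    then show ?thesis using that by (simp only: add scale scale_closed)
  qed
  have phi_scale: "\<phi> (sc r a) = r * \<phi> a" if "a \<in> S" for r a
    using that f_scale[OF that, of r] f_scale[OF that, of "\<i> * r"]
    by (simp add: \<phi>_def scale_scale complex_eq_iff algebra_simps)
  have bound: "cmod (\<phi> a) \<le> p a" if a: "a \<in> S" for a
  proof (cases "\<phi> a = 0")
    case True then show ?thesis using p a by (simp add: seminorm_on_def)
  next
    case False
    \<comment> \<open>The phase that rotates \<phi>(a) onto the positive real axis, where the bound
      on the real part applies; the seminorm does not see it.\<close>
    define w where "w = cnj (\<phi> a) / complex_of_real (cmod (\<phi> a))"
    have w: "cmod w = 1" using False by (simp add: w_def norm_divide)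
    have "w * \<phi> a = complex_of_real ((cmod (\<phi> a))\<^sup>2) / complex_of_real (cmod (\<phi> a))"
      unfolding complex_norm_square by (simp add: w_def)
    then have "\<phi> (sc w a) = complex_of_real (cmod (\<phi> a))"
      using phi_scale[OF a, of w] False by (simp add: power2_eq_square)
    then have "cmod (\<phi> a) = f (sc w a)" by (simp add: \<phi>_def complex_eq_iff)
    also have "\<dots> \<le> p (sc w a)" using a by (intro le) auto
    also have "\<dots> = p a" using p a w by (simp add: seminorm_on_def)
    finally show ?thesis .
  qed
  have "Re (\<phi> a0) = p a0" by (simp add: \<phi>_def eq)
  moreover have "(Re (\<phi> a0))\<^sup>2 + (Im (\<phi> a0))\<^sup>2 \<le> (p a0)\<^sup>2"
    using power_mono[OF bound[OF a0], of 2] by (simp add: cmod_power2)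
  ultimately have "\<phi> a0 = complex_of_real (p a0)" by (simp add: complex_eq_iff)
  with phi_add phi_scale bound show thesis using that[of \<phi>] by blast
qed

end

section \<open>The total variation of a Radon measure\<close>

lemma Kpos_iff:
  "h \<in> Kpos Y \<longleftrightarrow> continuous_map Y euclideanreal h \<and>
     (\<exists>K. compactin Y K \<and> (\<forall>y. y \<notin> K \<longrightarrow> h y = 0)) \<and> (\<forall>y. 0 \<le> h y)"
proof -
  have "continuous_map Y euclidean (\<lambda>y. complex_of_real (h y)) \<longleftrightarrow> continuous_map Y euclideanreal h"
  proof
    assume "continuous_map Y euclidean (\<lambda>y. complex_of_real (h y))"
    then have "continuous_map Y euclideanreal (Re \<circ> (\<lambda>y. complex_of_real (h y)))"
      by (rule continuous_map_compose) (simp add: continuous_on_Re)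
    then show "continuous_map Y euclideanreal h" by (simp add: comp_def)
  next
    assume "continuous_map Y euclideanreal h"
    then have "continuous_map Y euclidean (complex_of_real \<circ> h)"
      by (rule continuous_map_compose) (simp add: continuous_on_of_real)
    then show "continuous_map Y euclidean (\<lambda>y. complex_of_real (h y))" by (simp add: comp_def)
  qed
  then show ?thesis by (auto simp: Kpos_def Kspace_def)
qed

lemma KposI:
  "continuous_map Y euclideanreal h \<Longrightarrow> compactin Y K \<Longrightarrow> (\<And>y. y \<notin> K \<Longrightarrow> h y = 0) \<Longrightarrow>
    (\<And>y. 0 \<le> h y) \<Longrightarrow> h \<in> Kpos Y"
  unfolding Kpos_iff by blast

lemma Kpos_cont: "h \<in> Kpos Y \<Longrightarrow> continuous_map Y euclideanreal h"
  and Kpos_nonneg: "h \<in> Kpos Y \<Longrightarrow> 0 \<le> h y"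
  unfolding Kpos_iff by auto

lemma Kpos_support:
  assumes "h \<in> Kpos Y"
  obtains K where "compactin Y K" "\<And>y. y \<notin> K \<Longrightarrow> h y = 0"
  using assms unfolding Kpos_iff by blast

lemma Kpos_outside: "h \<in> Kpos Y \<Longrightarrow> y \<notin> topspace Y \<Longrightarrow> h y = 0"
  unfolding Kpos_iff using compactin_subset_topspace by blast

lemma Kpos_combine:
  fixes \<Phi> :: "real \<Rightarrow> real \<Rightarrow> real"
  assumes "k \<in> Kpos Y" "l \<in> Kpos Y"
    and "continuous_map Y euclideanreal (\<lambda>y. \<Phi> (k y) (l y))"
    and "\<Phi> 0 0 = 0" "\<And>a b. 0 \<le> a \<Longrightarrow> 0 \<le> b \<Longrightarrow> 0 \<le> \<Phi> a b"
  shows "(\<lambda>y. \<Phi> (k y) (l y)) \<in> Kpos Y"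
proof -
  obtain K L where "compactin Y K" "\<And>y. y \<notin> K \<Longrightarrow> k y = 0" "compactin Y L" "\<And>y. y \<notin> L \<Longrightarrow> l y = 0"
    using assms Kpos_support by metis
  then show ?thesis
    using assms Kpos_nonneg[OF assms(1)] Kpos_nonneg[OF assms(2)]
    by (intro KposI[where K = "K \<union> L"]) (auto intro: compactin_Un)
qed

lemma Kpos_zero: "(\<lambda>y. 0) \<in> Kpos Y"
  by (rule KposI[where K = "{}"]) auto

lemma Kpos_add: "k \<in> Kpos Y \<Longrightarrow> l \<in> Kpos Y \<Longrightarrow> (\<lambda>y. k y + l y) \<in> Kpos Y"
  by (rule Kpos_combine) (auto intro: continuous_map_add Kpos_cont)

lemma Kpos_max: "k \<in> Kpos Y \<Longrightarrow> l \<in> Kpos Y \<Longrightarrow> (\<lambda>y. max (k y) (l y)) \<in> Kpos Y"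
  by (rule Kpos_combine) (auto intro: continuous_map_real_max Kpos_cont)

lemma Kpos_diff: "k \<in> Kpos Y \<Longrightarrow> l \<in> Kpos Y \<Longrightarrow> (\<lambda>y. max 0 (k y - l y)) \<in> Kpos Y"
  by (rule Kpos_combine) (auto intro!: continuous_map_real_max continuous_map_diff intro: Kpos_cont)

lemma Kpos_scale: "0 \<le> c \<Longrightarrow> k \<in> Kpos Y \<Longrightarrow> (\<lambda>y. c * k y) \<in> Kpos Y"
  by (rule Kpos_combine[where \<Phi> = "\<lambda>a b. c * a"]) (auto intro: continuous_map_real_mult_left Kpos_cont)

lemma Kpos_sum: "(\<And>i. k i \<in> Kpos Y) \<Longrightarrow> (\<lambda>y. \<Sum>i<(n::nat). k i y) \<in> Kpos Y"
  by (induction n) (auto intro: Kpos_zero Kpos_add)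

lemma Kspace_support:
  assumes "g \<in> Kspace Y"
  obtains K where "compactin Y K" "\<And>y. y \<notin> K \<Longrightarrow> g y = 0"
  using assms unfolding Kspace_def by blast

lemma continuous_map_complex_mult:
  "continuous_map X euclidean f \<Longrightarrow> continuous_map X euclidean g \<Longrightarrow>
    continuous_map X euclidean (\<lambda>x. f x * g x :: complex)"
  by (simp add: continuous_map_atin tendsto_mult)

lemma continuous_map_complex_of_real:
  "continuous_map X euclideanreal f \<Longrightarrow> continuous_map X euclidean (\<lambda>x. complex_of_real (f x))"
  by (simp add: continuous_map_atin tendsto_of_real)

lemma Kspace_mult:
  assumes "continuous_map Y euclidean f" "g \<in> Kspace Y"
  shows "(\<lambda>y. f y * g y) \<in> Kspace Y"
proof -
  obtain K where "compactin Y K" "\<And>y. y \<notin> K \<Longrightarrow> g y = 0"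
    using assms Kspace_support by blast
  then show ?thesis
    using assms unfolding Kspace_def by (auto intro!: continuous_map_complex_mult)
qed

lemma Kspace_scale: "g \<in> Kspace Y \<Longrightarrow> (\<lambda>y. c * g y) \<in> Kspace Y"
  by (rule Kspace_mult) auto

lemma Kspace_add:
  assumes "f \<in> Kspace Y" "g \<in> Kspace Y"
  shows "(\<lambda>y. f y + g y) \<in> Kspace Y"
proof -
  obtain K L where "compactin Y K" "\<And>y. y \<notin> K \<Longrightarrow> f y = 0" "compactin Y L" "\<And>y. y \<notin> L \<Longrightarrow> g y = 0"
    using assms Kspace_support by metis
  then show ?thesis
    using assms unfolding Kspace_def
    by (auto intro!: continuous_map_add exI[of _ "K \<union> L"] compactin_Un)
qed

lemma Kspace_diff: "f \<in> Kspace Y \<Longrightarrow> g \<in> Kspace Y \<Longrightarrow> (\<lambda>y. f y - g y) \<in> Kspace Y"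
  using Kspace_add[of f Y "\<lambda>y. (-1) * g y"] Kspace_scale[of g Y "-1"] by simp

lemma Kspace_norm: "g \<in> Kspace Y \<Longrightarrow> (\<lambda>y. cmod (g y)) \<in> Kpos Y"
  unfolding Kpos_iff Kspace_def by (auto intro: continuous_map_norm)

text \<open>A strict lower bound for a sum of extended values is distributed over the summands as
  real numbers. The alternative \<open>a i = 0\<close> is needed because a summand may vanish and
  then has nothing strictly below it.\<close>

lemma finite_sum_approx:
  fixes g :: "nat \<Rightarrow> ennreal"
  assumes "ennreal c < (\<Sum>i<n. g i)"
  shows "\<exists>a. (\<forall>i. 0 \<le> a i \<and> (a i = 0 \<or> ennreal (a i) < g i)) \<and> c < (\<Sum>i<n. a i)"
  using assms
proof (induction n arbitrary: c)
  case 0 then show ?case by simp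
next
  case (Suc n)
  show ?case
  proof (cases "ennreal c < (\<Sum>i<n. g i)")
    case True
    then obtain a where a: "\<And>i. 0 \<le> a i \<and> (a i = 0 \<or> ennreal (a i) < g i)" "c < (\<Sum>i<n. a i)"
      using Suc.IH by blast
    then have "c < (\<Sum>i<Suc n. a i)" using a(1)[of n] a(2) by (simp, linarith)
    then show ?thesis using a(1) by blast
  next
    case False
    then have le: "(\<Sum>i<n. g i) \<le> ennreal c" by simp
    then obtain r where r: "0 \<le> r" "(\<Sum>i<n. g i) = ennreal r"
      by (cases "\<Sum>i<n. g i") (auto simp: top_unique)
    show ?thesis
    proof (cases "c < 0")
      case True then show ?thesis by (intro exI[of _ "\<lambda>_. 0"]) simp
    next
      case c: False
      have rc: "r \<le> c" using le r c by simp
      have "ennreal (c - r) < g n"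
      proof (rule ccontr)
        assume "\<not> ennreal (c - r) < g n"
        then have "(\<Sum>i<n. g i) + g n \<le> ennreal r + ennreal (c - r)"
          using r by (intro add_mono) auto
        also have "\<dots> = ennreal c" using r rc by (simp flip: ennreal_plus)
        finally show False using Suc.prems by simp
      qed
      \<comment> \<open>With e strictly between c - r and the last summand, the first n summands
        still exceed c - e, which the induction hypothesis handles.\<close>
      then obtain e' where e': "ennreal (c - r) < e'" "e' < g n" using dense by blast
      then obtain e where e: "e' = ennreal e" "0 \<le> e" by (cases e') auto
      have ce: "c - r < e" using e' e rc by (simp add: ennreal_less_iff)
      show ?thesis
      proof (cases "c - e < 0")
        case True
        then show ?thesis using e e'
          by (intro exI[of _ "\<lambda>i. if i = n then e else 0"]) (auto simp: sum.delta)
      next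
        case False
        have "ennreal (c - e) < (\<Sum>i<n. g i)"
          using ce False r by (simp add: ennreal_less_iff)
        then obtain a where a: "\<And>i. 0 \<le> a i \<and> (a i = 0 \<or> ennreal (a i) < g i)" "c - e < (\<Sum>i<n. a i)"
          using Suc.IH by blast
        have "(\<Sum>i<n. (a(n := e)) i) = (\<Sum>i<n. a i)" by (intro sum.cong) auto
        then show ?thesis using a e e'
          by (intro exI[of _ "a(n := e)"]) auto
      qed
    qed
  qed
qed

locale radon_space =
  fixes Y :: "'y topology" and \<mu> :: "('y \<Rightarrow> complex) \<Rightarrow> complex"
  assumes locally_compact: "locally_compact_space Y"
    and Hausdorff: "Hausdorff_space Y"
    and radon: "radon_measure Y \<mu>"
begin

lemma mu_add: "f \<in> Kspace Y \<Longrightarrow> g \<in> Kspace Y \<Longrightarrow> \<mu> (\<lambda>y. f y + g y) = \<mu> f + \<mu> g"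
  and mu_scale: "f \<in> Kspace Y \<Longrightarrow> \<mu> (\<lambda>y. c * f y) = c * \<mu> f"
  using radon unfolding radon_measure_def by blast+

lemma mu_bound:
  assumes "compactin Y K"
  obtains M where "\<And>f b. f \<in> Kspace Y \<Longrightarrow> (\<And>y. y \<notin> K \<Longrightarrow> f y = 0) \<Longrightarrow> (\<And>y. cmod (f y) \<le> b) \<Longrightarrow> cmod (\<mu> f) \<le> M * b"
  using radon assms unfolding radon_measure_def by metis

lemma mu_diff: "f \<in> Kspace Y \<Longrightarrow> g \<in> Kspace Y \<Longrightarrow> \<mu> (\<lambda>y. f y - g y) = \<mu> f - \<mu> g"
  using mu_add[of f "\<lambda>y. (-1) * g y"] mu_scale[of g "-1"] Kspace_scale[of g Y "-1"] by simp

abbreviation A :: "('y \<Rightarrow> real) \<Rightarrow> ennreal" where "A \<equiv> abs_measure Y \<mu>"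

lemma abs_measure_ge: "g \<in> Kspace Y \<Longrightarrow> (\<And>y. cmod (g y) \<le> h y) \<Longrightarrow> ennreal (cmod (\<mu> g)) \<le> A h"
  unfolding abs_measure_def by (intro SUP_upper) auto

lemma abs_measure_leI:
  "(\<And>g. g \<in> Kspace Y \<Longrightarrow> (\<And>y. cmod (g y) \<le> h y) \<Longrightarrow> ennreal (cmod (\<mu> g)) \<le> c) \<Longrightarrow> A h \<le> c"
  unfolding abs_measure_def by (intro SUP_least) auto

lemma abs_measure_mono: "(\<And>y. h y \<le> h' y) \<Longrightarrow> A h \<le> A h'"
  by (intro abs_measure_leI abs_measure_ge) (auto intro: order_trans)

lemma abs_measure_finite:
  assumes "h \<in> Kpos Y" shows "A h < \<infinity>"
proof -
  obtain K where K: "compactin Y K" "\<And>y. y \<notin> K \<Longrightarrow> h y = 0" using assms Kpos_support by blast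
  obtain M where M: "\<And>f b. f \<in> Kspace Y \<Longrightarrow> (\<And>y. y \<notin> K \<Longrightarrow> f y = 0) \<Longrightarrow> (\<And>y. cmod (f y) \<le> b) \<Longrightarrow> cmod (\<mu> f) \<le> M * b"
    using mu_bound[OF K(1)] by blast
  have "compact (h ` K)"
    using image_compactin[OF K(1) Kpos_cont[OF assms]] by simp
  then obtain b where b: "\<And>y. y \<in> K \<Longrightarrow> \<bar>h y\<bar> \<le> b"
    by (meson bounded_real compact_imp_bounded image_eqI)
  have hb: "h y \<le> max b 0" for y
    by (cases "y \<in> K") (use b K in \<open>force+\<close>)
  have "A h \<le> ennreal (M * max b 0)"
  proof (rule abs_measure_leI)
    fix g assume g: "g \<in> Kspace Y" "\<And>y. cmod (g y) \<le> h y"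
    have "cmod (\<mu> g) \<le> M * max b 0"
    proof (rule M[OF g(1)])
      show "g y = 0" if "y \<notin> K" for y using g(2)[of y] K(2)[OF that] by simp
      show "cmod (g y) \<le> max b 0" for y using g(2)[of y] hb[of y] by linarith
    qed
    then show "ennreal (cmod (\<mu> g)) \<le> ennreal (M * max b 0)" by (rule ennreal_leI)
  qed
  then show ?thesis by (simp add: le_less_trans)
qed

text \<open>A function dominated by h1 + h2 is split in the proportions h1 : h2 : \<delta>. The
  constant \<delta> keeps the denominator positive and hence the quotients continuous; the third
  piece has the support of \<open>g\<close> and is at most \<delta>, so its measure is
  small.\<close>

lemma abs_measure_add_le:
  assumes "h1 \<in> Kpos Y" "h2 \<in> Kpos Y"
  shows "A (\<lambda>y. h1 y + h2 y) \<le> A h1 + A h2"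
proof (rule abs_measure_leI)
  fix g assume g: "g \<in> Kspace Y" and gh: "\<And>y. cmod (g y) \<le> h1 y + h2 y"
  obtain K where K: "compactin Y K" "\<And>y. y \<notin> K \<Longrightarrow> g y = 0" using g Kspace_support by blast
  obtain M where M: "\<And>f b. f \<in> Kspace Y \<Longrightarrow> (\<And>y. y \<notin> K \<Longrightarrow> f y = 0) \<Longrightarrow> (\<And>y. cmod (f y) \<le> b) \<Longrightarrow> cmod (\<mu> f) \<le> M * b"
    using mu_bound[OF K(1)] by blast
  \<comment> \<open>The constant \<open>M\<close> may be zero or negative, so it is enlarged before
    dividing by it.\<close>
  define M' where "M' = max M 1"
  show "ennreal (cmod (\<mu> g)) \<le> A h1 + A h2"
  proof (rule ennreal_le_epsilon)
    fix \<epsilon> :: real assume \<epsilon>: "0 < \<epsilon>"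
    define \<delta> where "\<delta> = \<epsilon> / M'"
    have \<delta>: "0 < \<delta>" "M' * \<delta> = \<epsilon>" using \<epsilon> by (auto simp: \<delta>_def M'_def)
    define D where "D y = h1 y + h2 y + \<delta>" for y
    have D: "0 < D y" for y
      using \<delta> Kpos_nonneg[OF assms(1), of y] Kpos_nonneg[OF assms(2), of y] by (simp add: D_def)
    have D_cont: "continuous_map Y euclideanreal D"
      unfolding D_def using assms by (intro continuous_map_add) (auto intro: Kpos_cont)
    have frac: "(\<lambda>y. complex_of_real (h y / D y) * g y) \<in> Kspace Y"
      if "continuous_map Y euclideanreal h" for h
      using D that D_cont g
      by (intro Kspace_mult continuous_map_complex_of_real continuous_map_real_divide) (auto simp: less_le)
    define g1 where "g1 = (\<lambda>y. complex_of_real (h1 y / D y) * g y)"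
    define g2 where "g2 = (\<lambda>y. complex_of_real (h2 y / D y) * g y)"
    define g3 where "g3 = (\<lambda>y. complex_of_real (\<delta> / D y) * g y)"
    have K1: "g1 \<in> Kspace Y" and K2: "g2 \<in> Kspace Y" and K3: "g3 \<in> Kspace Y"
      unfolding g1_def g2_def g3_def using frac[OF Kpos_cont[OF assms(1)]] frac[OF Kpos_cont[OF assms(2)]] frac[of "\<lambda>_. \<delta>"]
      by simp_all
    have bound: "cmod (complex_of_real (c / D y) * g y) \<le> c" if "0 \<le> c" for c y
    proof -
      have "cmod (complex_of_real (c / D y) * g y) = c * (cmod (g y) / D y)"
        using that D[of y] by (simp add: norm_mult norm_divide)
      also have "\<dots> \<le> c * 1"
        using that D[of y] gh[of y] \<delta> by (intro mult_left_mono) (auto simp: D_def)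
      finally show ?thesis by simp
    qed
    have "g = (\<lambda>y. (g1 y + g2 y) + g3 y)"
    proof
      fix y
      have "h1 y / D y + h2 y / D y + \<delta> / D y = 1"
        using D[of y] by (simp add: D_def flip: add_divide_distrib)
      then have "complex_of_real (h1 y / D y) + complex_of_real (h2 y / D y) + complex_of_real (\<delta> / D y) = 1"
        by (metis of_real_1 of_real_add)
      then show "g y = (g1 y + g2 y) + g3 y"
        unfolding g1_def g2_def g3_def by (metis distrib_right mult_1)
    qed
    then have "\<mu> g = \<mu> g1 + \<mu> g2 + \<mu> g3"
      using mu_add[OF Kspace_add[OF K1 K2] K3] mu_add[OF K1 K2] by simp
    then have "cmod (\<mu> g) \<le> cmod (\<mu> g1) + cmod (\<mu> g2) + cmod (\<mu> g3)"
      by (metis norm_triangle_ineq norm_triangle_le add_right_mono)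
    moreover have "cmod (\<mu> g3) \<le> \<epsilon>"
    proof -
      have "cmod (\<mu> g3) \<le> M * \<delta>"
        using K3 K(2) bound \<delta> by (intro M) (auto simp: g3_def)
      also have "\<dots> \<le> M' * \<delta>" using \<delta> by (intro mult_right_mono) (auto simp: M'_def)
      finally show ?thesis using \<delta> by simp
    qed
    ultimately have "ennreal (cmod (\<mu> g)) \<le> ennreal (cmod (\<mu> g1)) + ennreal (cmod (\<mu> g2)) + ennreal \<epsilon>"
      using \<epsilon> by (simp add: ennreal_leI flip: ennreal_plus)
    also have "\<dots> \<le> A h1 + A h2 + ennreal \<epsilon>"
      using K1 K2 bound Kpos_nonneg[OF assms(1)] Kpos_nonneg[OF assms(2)]
      by (intro add_mono abs_measure_ge) (auto simp: g1_def g2_def)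
    finally show "ennreal (cmod (\<mu> g)) \<le> A h1 + A h2 + ennreal \<epsilon>" .
  qed
qed

text \<open>Unit factors rotate \<mu>(g1) and \<mu>(g2) onto the positive axis, so that the values
  add without cancellation while the moduli stay dominated by h1 and h2.\<close>

lemma abs_measure_add_ge:
  assumes "h1 \<in> Kpos Y" "h2 \<in> Kpos Y"
  shows "A h1 + A h2 \<le> A (\<lambda>y. h1 y + h2 y)"
proof -
  have "ennreal (cmod (\<mu> g1)) + ennreal (cmod (\<mu> g2)) \<le> A (\<lambda>y. h1 y + h2 y)"
    if g1: "g1 \<in> Kspace Y" "\<And>y. cmod (g1 y) \<le> h1 y" and g2: "g2 \<in> Kspace Y" "\<And>y. cmod (g2 y) \<le> h2 y"
    for g1 g2
  proof -
    have phase: "\<exists>w. cmod w = 1 \<and> w * z = complex_of_real (cmod z)" for z :: complex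
    proof (cases "z = 0")
      case True then show ?thesis by (intro exI[of _ 1]) simp
    next
      case False
      then show ?thesis
        by (intro exI[of _ "complex_of_real (cmod z) / z"]) (simp add: norm_divide)
    qed
    obtain w1 where w1: "cmod w1 = 1" "w1 * \<mu> g1 = complex_of_real (cmod (\<mu> g1))" using phase by blast
    obtain w2 where w2: "cmod w2 = 1" "w2 * \<mu> g2 = complex_of_real (cmod (\<mu> g2))" using phase by blast
    let ?g = "\<lambda>y. w1 * g1 y + w2 * g2 y"
    have "\<mu> ?g = complex_of_real (cmod (\<mu> g1) + cmod (\<mu> g2))"
      using mu_add[OF Kspace_scale[OF g1(1)] Kspace_scale[OF g2(1)]] mu_scale g1(1) g2(1) w1 w2 by simp
    moreover have "cmod (?g y) \<le> h1 y + h2 y" for y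
      using g1(2)[of y] g2(2)[of y] w1 w2 norm_triangle_ineq[of "w1 * g1 y" "w2 * g2 y"]
      by (simp add: norm_mult)
    then have "ennreal (cmod (\<mu> ?g)) \<le> A (\<lambda>y. h1 y + h2 y)"
      by (intro abs_measure_ge Kspace_add Kspace_scale g1 g2)
    ultimately have "ennreal (cmod (complex_of_real (cmod (\<mu> g1) + cmod (\<mu> g2)))) \<le> A (\<lambda>y. h1 y + h2 y)"
      by simp
    then show ?thesis unfolding norm_of_real by simp
  qed
  then have *: "(SUP g1\<in>{g \<in> Kspace Y. \<forall>y. cmod (g y) \<le> h1 y}. SUP g2\<in>{g \<in> Kspace Y. \<forall>y. cmod (g y) \<le> h2 y}.
      ennreal (cmod (\<mu> g1)) + ennreal (cmod (\<mu> g2))) \<le> A (\<lambda>y. h1 y + h2 y)"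
    by (intro SUP_least) auto
  have ne: "{g \<in> Kspace Y. \<forall>y. cmod (g y) \<le> h y} \<noteq> {}" if "h \<in> Kpos Y" for h
    using Kpos_nonneg[OF that] Kpos_zero[of Y] by (auto simp: Kpos_def intro!: exI[of _ "\<lambda>_. 0"])
  show ?thesis
    using * unfolding abs_measure_def[of Y \<mu> h1] abs_measure_def[of Y \<mu> h2]
    by (simp add: ennreal_SUP_add_right[OF ne[OF assms(2)], symmetric] ennreal_SUP_add_left[OF ne[OF assms(1)]])
qed

end

section \<open>Countable subadditivity of the upper integrals\<close>

context radon_space begin

lemma abs_measure_zero: "A (\<lambda>y. 0) = 0"
proof -
  have "\<mu> (\<lambda>y. 0) = 0" using mu_scale[of "\<lambda>y. 0" 0] Kpos_zero[of Y] by (simp add: Kpos_def)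
  have "A (\<lambda>y. 0) \<le> 0"
  proof (rule abs_measure_leI)
    fix g :: "'y \<Rightarrow> complex" assume "\<And>y. cmod (g y) \<le> 0"
    then have "g = (\<lambda>y. 0)" by auto
    then show "ennreal (cmod (\<mu> g)) \<le> 0" using \<open>\<mu> (\<lambda>y. 0) = 0\<close> by simp
  qed
  then show ?thesis by simp
qed

lemma abs_measure_sum_le:
  "(\<And>i. k i \<in> Kpos Y) \<Longrightarrow> A (\<lambda>y. \<Sum>i<(n::nat). k i y) \<le> (\<Sum>i<n. A (k i))"
proof (induction n)
  case 0 then show ?case by (simp add: abs_measure_zero)
next
  case (Suc n)
  have "A (\<lambda>y. (\<Sum>i<n. k i y) + k n y) \<le> A (\<lambda>y. \<Sum>i<n. k i y) + A (k n)"
    using Suc.prems by (intro abs_measure_add_le Kpos_sum)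
  also have "\<dots> \<le> (\<Sum>i<n. A (k i)) + A (k n)" by (intro add_right_mono Suc.IH Suc.prems)
  finally show ?case by simp
qed

lemma abs_measure_scale_le:
  assumes "0 < c" shows "A (\<lambda>y. c * h y) \<le> ennreal c * A h"
proof (rule abs_measure_leI)
  fix g assume g: "g \<in> Kspace Y" "\<And>y. cmod (g y) \<le> c * h y"
  let ?g = "\<lambda>y. complex_of_real (1 / c) * g y"
  have "ennreal (cmod (\<mu> ?g)) \<le> A h"
    using g assms by (intro abs_measure_ge Kspace_scale) (auto simp: norm_divide field_simps)
  moreover have "cmod (\<mu> g) = c * cmod (\<mu> ?g)"
    unfolding mu_scale[OF g(1)] using assms by (simp add: norm_divide norm_mult)
  ultimately show "ennreal (cmod (\<mu> g)) \<le> ennreal c * A h"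
    using assms by (simp add: ennreal_mult mult_left_mono)
qed

text \<open>Dini's argument, the source of both countable subadditivity and outer approximation.\<close>

lemma directed_dominates:
  fixes h :: "'y \<Rightarrow> real"
  assumes C: "compactin Y C" and h: "continuous_map (subtopology Y C) euclideanreal h"
    and D: "D \<subseteq> Kpos Y" "D \<noteq> {}"
    and directed: "\<And>k l. k \<in> D \<Longrightarrow> l \<in> D \<Longrightarrow> \<exists>m\<in>D. \<forall>y. k y \<le> m y \<and> l y \<le> m y"
    and pt: "\<And>y. y \<in> C \<Longrightarrow> \<exists>k\<in>D. h y < k y + \<delta>"
  shows "\<exists>k\<in>D. \<forall>y\<in>C. h y < k y + \<delta>"
proof -
  \<comment> \<open>These sets are open relative to \<open>C\<close> only, because \<open>h\<close>
    is merely continuous on \<open>C\<close>. Compactness leaves finitely many of them, and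
    directedness replaces the corresponding functions by one.\<close>
  define O' where "O' k = {y \<in> topspace (subtopology Y C). k y + \<delta> - h y \<in> {0<..}}" for k
  have "openin (subtopology Y C) (O' k)" if "k \<in> D" for k
  proof -
    have "continuous_map (subtopology Y C) euclideanreal (\<lambda>y. k y + \<delta> - h y)"
      using that D Kpos_cont[of k Y]
      by (intro continuous_map_diff continuous_map_add h continuous_map_from_subtopology) auto
    then show ?thesis
      unfolding O'_def by (rule openin_continuous_map_preimage) auto
  qed
  moreover have "C \<subseteq> \<Union>(O' ` D)"
  proof
    fix y assume y: "y \<in> C"
    then obtain k where "k \<in> D" "h y < k y + \<delta>" using pt by blast
    then show "y \<in> \<Union>(O' ` D)" using y compactin_subset_topspace[OF C] by (auto simp: O'_def)
  qed
  ultimately obtain \<F> where F: "finite \<F>" "\<F> \<subseteq> O' ` D" "C \<subseteq> \<Union>\<F>"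
    using compactinD[of "subtopology Y C" C "O' ` D"] C by auto
  then obtain D0 where D0: "finite D0" "D0 \<subseteq> D" "\<F> = O' ` D0"
    by (metis finite_subset_image)
  have "\<exists>m\<in>D. \<forall>k\<in>D0. \<forall>y. k y \<le> m y" using D0(1,2)
  proof (induction D0)
    case empty then show ?case using D by auto
  next
    case (insert k D0)
    then obtain m where m: "m \<in> D" "\<forall>k\<in>D0. \<forall>y. k y \<le> m y" by auto
    obtain n where n: "n \<in> D" "\<forall>y. k y \<le> n y \<and> m y \<le> n y" using directed m insert.prems by blast
    then show ?case using m by (intro bexI[of _ n]) (auto intro: order_trans)
  qed
  then obtain m where m: "m \<in> D" "\<And>k y. k \<in> D0 \<Longrightarrow> k y \<le> m y" by blast
  have "h y < m y + \<delta>" if y: "y \<in> C" for y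
  proof -
    obtain k where k: "k \<in> D0" "y \<in> O' k" using F(3) D0(3) y by blast
    then show ?thesis using m(2)[OF k(1), of y] by (auto simp: O'_def)
  qed
  with m show ?thesis by blast
qed

text \<open>Complete regularity separates \<open>y\<close> from the complement of U \<inter> W,
  where W is a neighbourhood of \<open>y\<close> contained in a compact set; that compact set
  carries the support.\<close>

lemma bump_function:
  assumes U: "openin Y U" and y: "y \<in> U"
  obtains u where "u \<in> Kpos Y" "u y = 1" "\<And>z. u z \<le> 1" "\<And>z. z \<notin> U \<Longrightarrow> u z = 0"
proof -
  have yY: "y \<in> topspace Y" using assms openin_subset by blast
  obtain W K where W: "openin Y W" "compactin Y K" "y \<in> W" "W \<subseteq> K"
    using locally_compact yY unfolding locally_compact_space_def by blast
  have "completely_regular_space Y"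
    using locally_compact_regular_imp_completely_regular_space locally_compact Hausdorff by blast
  moreover have "closedin Y (topspace Y - (U \<inter> W))" using U W by blast
  ultimately obtain f where f: "continuous_map Y (top_of_set {0..1}) f" "f y = (0::real)"
      "f ` (topspace Y - (U \<inter> W)) \<subseteq> {1}"
    unfolding completely_regular_space_def using yY y W(3) by blast
  have f01: "f z \<in> {0..1}" if "z \<in> topspace Y" for z
    using f(1) that by (auto simp: continuous_map_in_subtopology)
  \<comment> \<open>Members of \<open>Kpos Y\<close> vanish at every point outside a compact set,
    including the points of the type outside the space.\<close>
  define u where "u z = (if z \<in> topspace Y then 1 - f z else 0)" for z
  have "continuous_map Y euclideanreal (\<lambda>z. 1 - f z)"
    using f(1) by (intro continuous_map_diff) (auto simp: continuous_map_in_subtopology)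
  then have cont: "continuous_map Y euclideanreal u"
    by (rule continuous_map_eq) (auto simp: u_def)
  have zero: "u z = 0" if "z \<notin> U \<inter> W" for z using f(3) that by (auto simp: u_def)
  show thesis
  proof (rule that)
    show "u \<in> Kpos Y"
    proof (rule KposI[OF cont W(2)])
      show "u z = 0" if "z \<notin> K" for z using zero W(4) that by blast
      show "0 \<le> u z" for z using f01[of z] by (auto simp: u_def)
    qed
    show "u y = 1" using yY f by (simp add: u_def)
    show "u z \<le> 1" for z using f01[of z] by (auto simp: u_def)
    show "z \<notin> U \<Longrightarrow> u z = 0" for z using zero by blast
  qed
qed

text \<open>Dini's argument for the constant function 1 with slack 0, the directed family being all
  of \<open>Kpos Y\<close>. Doubled bumps exceed 1 strictly at their centres.\<close>

lemma cutoff_function: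
  assumes "compactin Y C"
  obtains u where "u \<in> Kpos Y" "\<And>y. y \<in> C \<Longrightarrow> 1 \<le> u y"
proof -
  have "\<exists>k\<in>Kpos Y. \<forall>y\<in>C. 1 < k y + (0::real)"
  proof (rule directed_dominates[OF assms])
    show "\<exists>m\<in>Kpos Y. \<forall>y. k y \<le> m y \<and> l y \<le> m y" if "k \<in> Kpos Y" "l \<in> Kpos Y" for k l
      using Kpos_max[OF that] by (intro bexI[of _ "\<lambda>y. max (k y) (l y)"]) auto
    show "\<exists>k\<in>Kpos Y. 1 < k y + 0" if "y \<in> C" for y
    proof -
      have "y \<in> topspace Y" using that compactin_subset_topspace[OF assms] by blast
      then obtain u where "u \<in> Kpos Y" "u y = 1" using bump_function[OF openin_topspace] by metis
      then show ?thesis using Kpos_scale[of 2 u Y] by (intro bexI[of _ "\<lambda>y. 2 * u y"]) auto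
    qed
  qed (use Kpos_zero in auto)
  then show thesis using that by force
qed

section \<open>Lower semicontinuous functions and their upper integral\<close>

lemma Kpos_lsc:
  assumes "h \<in> Kpos Y" shows "lsc_on Y (\<lambda>y. ennreal (h y))"
  unfolding lsc_on_def
proof
  fix a :: ennreal
  show "openin Y {y \<in> topspace Y. a < ennreal (h y)}"
  proof (cases a)
    case (real r)
    have "openin Y {y \<in> topspace Y. h y \<in> {r<..}}"
      using Kpos_cont[OF assms] by (rule openin_continuous_map_preimage) auto
    then show ?thesis using real by (simp add: ennreal_less_iff)
  qed simp
qed

text \<open>A bump of height \<open>a\<close> that lives in the open set where \<open>g\<close>
  exceeds \<open>a\<close>. Allowing a = 0 covers points where \<open>g\<close> vanishes.\<close>

lemma lsc_approx:
  assumes "lsc_on Y g" "y \<in> topspace Y" "0 \<le> a" "a = 0 \<or> ennreal a < g y"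
  obtains k where "k \<in> Kpos Y" "k y = a" "\<And>z. z \<in> topspace Y \<Longrightarrow> ennreal (k z) \<le> g z"
proof (cases "a = 0")
  case True then show thesis using that[of "\<lambda>_. 0"] Kpos_zero by auto
next
  case False
  then have y: "y \<in> {z \<in> topspace Y. ennreal a < g z}" using assms by auto
  have "openin Y {z \<in> topspace Y. ennreal a < g z}" using assms by (simp add: lsc_on_def)
  from bump_function[OF this y]
  obtain u where u: "u \<in> Kpos Y" "u y = 1" "\<And>z. u z \<le> 1"
      "\<And>z. z \<notin> {z \<in> topspace Y. ennreal a < g z} \<Longrightarrow> u z = 0" by blast
  show thesis
  proof (rule that[of "\<lambda>z. a * u z"])
    show "(\<lambda>z. a * u z) \<in> Kpos Y" using u assms by (intro Kpos_scale)
    show "a * u y = a" using u by simp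
    fix z assume z: "z \<in> topspace Y"
    show "ennreal (a * u z) \<le> g z"
    proof (cases "ennreal a < g z")
      case True
      have "a * u z \<le> a" using u(3)[of z] assms by (simp add: mult_left_le)
      then have "ennreal (a * u z) \<le> ennreal a" by (rule ennreal_leI)
      then show ?thesis using True by simp
    next
      case False then show ?thesis using u(4)[of z] by simp
    qed
  qed
qed

lemma lsc_suminf_approx:
  assumes g: "\<And>i::nat. lsc_on Y (g i)" and y: "y \<in> topspace Y" and c: "ennreal c < (\<Sum>i. g i y)"
  shows "\<exists>n k. (\<forall>i. k i \<in> Kpos Y \<and> (\<forall>z\<in>topspace Y. ennreal (k i z) \<le> g i z)) \<and> c < (\<Sum>i<n. k i y)"
proof -
  obtain n where "ennreal c < (\<Sum>i<n. g i y)"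
    using c unfolding suminf_eq_SUP by (auto simp: less_SUP_iff)
  then obtain a where a: "\<And>i. 0 \<le> a i \<and> (a i = 0 \<or> ennreal (a i) < g i y)" "c < (\<Sum>i<n. a i)"
    using finite_sum_approx[of c "\<lambda>i. g i y"] by blast
  have "\<exists>k. k \<in> Kpos Y \<and> k y = a i \<and> (\<forall>z\<in>topspace Y. ennreal (k z) \<le> g i z)" for i
  proof -
    have "0 \<le> a i" "a i = 0 \<or> ennreal (a i) < g i y" using a(1)[of i] by auto
    from lsc_approx[OF g y this] show ?thesis by metis
  qed
  then obtain k where "\<And>i. k i \<in> Kpos Y \<and> k i y = a i \<and> (\<forall>z\<in>topspace Y. ennreal (k i z) \<le> g i z)"
    by metis
  then show ?thesis using a(2) by (intro exI[of _ n] exI[of _ k]) simp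
qed

lemma sum_le_suminf_ennreal:
  assumes "\<And>i. 0 \<le> k i" "\<And>i. ennreal (k i) \<le> g i"
  shows "ennreal (\<Sum>i<(n::nat). k i) \<le> (\<Sum>i. g i)"
proof -
  have "ennreal (\<Sum>i<n. k i) = (\<Sum>i<n. ennreal (k i))" using assms by simp
  also have "\<dots> \<le> (\<Sum>i<n. g i)" using assms by (intro sum_mono)
  also have "\<dots> \<le> (\<Sum>i. g i)" by (intro sum_le_suminf) auto
  finally show ?thesis .
qed

text \<open>A point where the series exceeds a level already has a finite sum of functions of
  \<open>Kpos Y\<close>, dominated term by term, that exceeds it there; by continuity this persists
  nearby.\<close>

lemma lsc_suminf:
  assumes g: "\<And>i::nat. lsc_on Y (g i)" shows "lsc_on Y (\<lambda>y. \<Sum>i. g i y)"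
  unfolding lsc_on_def
proof
  fix a :: ennreal
  show "openin Y {y \<in> topspace Y. a < (\<Sum>i. g i y)}"
  proof (subst openin_subopen, intro ballI)
    fix y assume "y \<in> {y \<in> topspace Y. a < (\<Sum>i. g i y)}"
    then have y: "y \<in> topspace Y" "a < (\<Sum>i. g i y)" by auto
    then obtain c where c: "a = ennreal c" "0 \<le> c" by (cases a) auto
    have "ennreal c < (\<Sum>i. g i y)" using y(2) c by simp
    from lsc_suminf_approx[where g = g, OF g y(1) this]
    obtain n k where ok: "\<forall>i. k i \<in> Kpos Y \<and> (\<forall>z\<in>topspace Y. ennreal (k i z) \<le> g i z)"
        and lt: "c < (\<Sum>i<n. k i y)" by (elim exE conjE)
    have k: "k i \<in> Kpos Y" "z \<in> topspace Y \<Longrightarrow> ennreal (k i z) \<le> g i z" for i z using ok by auto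
    let ?k = "\<lambda>z. \<Sum>i<n. k i z"
    have "openin Y {z \<in> topspace Y. a < ennreal (?k z)}"
      using Kpos_lsc[OF Kpos_sum[of k Y n, OF k(1)]] unfolding lsc_on_def by simp
    moreover have "ennreal (?k z) \<le> (\<Sum>i. g i z)" if "z \<in> topspace Y" for z
      using k that Kpos_nonneg[OF k(1)] by (intro sum_le_suminf_ennreal) auto
    moreover have "a < ennreal (?k y)" using c lt by (simp add: ennreal_less_iff)
    ultimately show "\<exists>T. openin Y T \<and> y \<in> T \<and> T \<subseteq> {y \<in> topspace Y. a < (\<Sum>i. g i y)}"
      using y by (intro exI[of _ "{z \<in> topspace Y. a < ennreal (?k z)}"]) (auto intro: less_le_trans)
  qed
qed

abbreviation U :: "('y \<Rightarrow> ennreal) \<Rightarrow> ennreal" where "U \<equiv> upper_integral_lsc Y \<mu>"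
abbreviation N :: "('y \<Rightarrow> ennreal) \<Rightarrow> ennreal" where "N \<equiv> upper_integral Y \<mu>"
abbreviation E :: "('y \<Rightarrow> ennreal) \<Rightarrow> ennreal" where "E \<equiv> ess_upper_integral Y \<mu>"

lemma upper_integral_lsc_ge:
  "h \<in> Kpos Y \<Longrightarrow> (\<And>y. y \<in> topspace Y \<Longrightarrow> ennreal (h y) \<le> g y) \<Longrightarrow> A h \<le> U g"
  unfolding upper_integral_lsc_def by (intro SUP_upper) auto

text \<open>Any \<open>h\<close> of \<open>Kpos Y\<close> below the series is, up to \<delta> on its
  support, dominated by one finite sum of functions k_i \<le> g_i. Replacing the error \<delta> by
  \<delta> u with a cutoff \<open>u\<close> makes it a function of \<open>Kpos Y\<close> of small
  measure.\<close>

lemma upper_integral_lsc_suminf: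
  assumes g: "\<And>i::nat. lsc_on Y (g i)"
  shows "U (\<lambda>y. \<Sum>i. g i y) \<le> (\<Sum>i. U (g i))"
  unfolding upper_integral_lsc_def[of _ _ "\<lambda>y. \<Sum>i. g i y"]
proof (rule SUP_least)
  fix h assume "h \<in> {h \<in> Kpos Y. \<forall>y\<in>topspace Y. ennreal (h y) \<le> (\<Sum>i. g i y)}"
  then have h: "h \<in> Kpos Y" and hg: "\<And>y. y \<in> topspace Y \<Longrightarrow> ennreal (h y) \<le> (\<Sum>i. g i y)" by auto
  obtain C where C: "compactin Y C" "\<And>y. y \<notin> C \<Longrightarrow> h y = 0" using h Kpos_support by blast
  obtain u where u: "u \<in> Kpos Y" "\<And>y. y \<in> C \<Longrightarrow> 1 \<le> u y" using cutoff_function[OF C(1)] by blast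
  obtain r where r: "A u = ennreal r" "0 \<le> r" using abs_measure_finite[OF u(1)] by (cases "A u") auto
  show "A h \<le> (\<Sum>i. U (g i))"
  proof (rule ennreal_le_epsilon)
    fix \<epsilon> :: real assume \<epsilon>: "0 < \<epsilon>"
    \<comment> \<open>This makes the error term \<delta> u contribute at most \<epsilon>; adding 1
      guards against r = 0.\<close>
    define \<delta> where "\<delta> = \<epsilon> / (r + 1)"
    have \<delta>: "0 < \<delta>" "\<delta> * r \<le> \<epsilon>" using \<epsilon> r by (auto simp: \<delta>_def field_simps)
    define ok where "ok k \<longleftrightarrow> (\<forall>i. k i \<in> Kpos Y \<and> (\<forall>z\<in>topspace Y. ennreal (k i z) \<le> g i z))" for k
    define D where "D = {(\<lambda>y. \<Sum>i<n. k i y) | n k. ok k}"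
    have DI: "(\<lambda>y. \<Sum>i<n. k i y) \<in> D" if "ok k" for n k using that unfolding D_def by blast
    have "\<exists>k\<in>D. \<forall>y\<in>C. h y < k y + \<delta>"
    proof (rule directed_dominates[OF C(1)])
      show "continuous_map (subtopology Y C) euclideanreal h"
        using Kpos_cont[OF h] by (rule continuous_map_from_subtopology)
      show "D \<subseteq> Kpos Y" unfolding D_def ok_def by (auto intro: Kpos_sum)
      show "D \<noteq> {}" unfolding D_def ok_def using Kpos_zero[of Y] by (auto intro!: exI[of _ "\<lambda>_ _. 0"])
    next
      fix p q assume "p \<in> D" "q \<in> D"
      then obtain n k m l where p: "p = (\<lambda>y. \<Sum>i<n. k i y)" "ok k" and q: "q = (\<lambda>y. \<Sum>i<m. l i y)" "ok l"
        unfolding D_def by blast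
      \<comment> \<open>Taking maxima term by term keeps each term below \<open>g i\<close>. The
        maximum of the two sums themselves need not be such a sum.\<close>
      define j where "j = (\<lambda>i y. max (k i y) (l i y))"
      have "ok j" unfolding ok_def
      proof (intro allI conjI ballI)
        show "j i \<in> Kpos Y" for i using p q Kpos_max[of "k i" Y "l i"] by (simp add: ok_def j_def)
        show "ennreal (j i z) \<le> g i z" if "z \<in> topspace Y" for i z
          using p q that by (auto simp: ok_def j_def max_def)
      qed
      have j0: "0 \<le> j i y" for i y using \<open>ok j\<close> Kpos_nonneg[of "j i" Y] by (simp add: ok_def)
      have "(\<lambda>y. \<Sum>i<max n m. j i y) \<in> D" using \<open>ok j\<close> unfolding D_def by blast
      moreover have "p y \<le> (\<Sum>i<max n m. j i y)" for y
      proof -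
        have "p y \<le> (\<Sum>i<n. j i y)" unfolding p j_def by (intro sum_mono) auto
        also have "\<dots> \<le> (\<Sum>i<max n m. j i y)"
          using j0 by (intro sum_mono2) auto
        finally show ?thesis .
      qed
      moreover have "q y \<le> (\<Sum>i<max n m. j i y)" for y
      proof -
        have "q y \<le> (\<Sum>i<m. j i y)" unfolding q j_def by (intro sum_mono) auto
        also have "\<dots> \<le> (\<Sum>i<max n m. j i y)"
          using j0 by (intro sum_mono2) auto
        finally show ?thesis .
      qed
      ultimately show "\<exists>m\<in>D. \<forall>y. p y \<le> m y \<and> q y \<le> m y"
        by (intro bexI[of _ "\<lambda>y. \<Sum>i<max n m. j i y"]) auto
    next
      fix y assume y: "y \<in> C"
      then have yY: "y \<in> topspace Y" using compactin_subset_topspace[OF C(1)] by blast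
      show "\<exists>k\<in>D. h y < k y + \<delta>"
      proof (cases "h y < \<delta>")
        case True
        have "ok (\<lambda>_ _. 0)" using Kpos_zero[of Y] by (simp add: ok_def)
        from DI[OF this, of 0] show ?thesis using True by (intro bexI) auto
      next
        case False
        have "ennreal (h y - \<delta>) < ennreal (h y)" using False \<delta> by (simp add: ennreal_less_iff)
        then have "ennreal (h y - \<delta>) < (\<Sum>i. g i y)" using hg[OF yY] by (rule less_le_trans)
        from lsc_suminf_approx[where g = g, OF g yY this]
        obtain n k where k: "ok k" "h y - \<delta> < (\<Sum>i<n. k i y)" unfolding ok_def by (elim exE conjE)
        from DI[OF k(1), of n] show ?thesis using k(2) by (intro bexI) auto
      qed
    qed
    then obtain n k where k: "ok k" "\<And>y. y \<in> C \<Longrightarrow> h y < (\<Sum>i<n. k i y) + \<delta>"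
      unfolding D_def by blast
    have kK: "k i \<in> Kpos Y" for i using k by (simp add: ok_def)
    have "h y \<le> (\<Sum>i<n. k i y) + \<delta> * u y" for y
    proof (cases "y \<in> C")
      case True
      have "\<delta> * 1 \<le> \<delta> * u y" using \<delta> u(2)[OF True] by (intro mult_left_mono) auto
      then show ?thesis using k(2)[OF True] by simp
    next
      case False
      then show ?thesis using C(2) \<delta> Kpos_nonneg[OF u(1), of y] Kpos_nonneg[OF kK]
        by (simp add: sum_nonneg)
    qed
    then have "A h \<le> A (\<lambda>y. (\<Sum>i<n. k i y) + \<delta> * u y)" by (rule abs_measure_mono)
    also have "\<dots> \<le> A (\<lambda>y. \<Sum>i<n. k i y) + A (\<lambda>y. \<delta> * u y)"
      using kK u \<delta> by (intro abs_measure_add_le Kpos_sum Kpos_scale) auto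
    also have "\<dots> \<le> (\<Sum>i<n. A (k i)) + ennreal \<delta> * A u"
      using kK \<delta> by (intro add_mono abs_measure_sum_le abs_measure_scale_le)
    also have "\<dots> \<le> (\<Sum>i. U (g i)) + ennreal \<epsilon>"
    proof (rule add_mono)
      have "(\<Sum>i<n. A (k i)) \<le> (\<Sum>i<n. U (g i))"
        using k(1) by (intro sum_mono upper_integral_lsc_ge) (auto simp: ok_def)
      also have "\<dots> \<le> (\<Sum>i. U (g i))" by (intro sum_le_suminf) auto
      finally show "(\<Sum>i<n. A (k i)) \<le> (\<Sum>i. U (g i))" .
      show "ennreal \<delta> * A u \<le> ennreal \<epsilon>"
        using \<delta> r by (simp add: ennreal_leI flip: ennreal_mult)
    qed
    finally show "A h \<le> (\<Sum>i. U (g i)) + ennreal \<epsilon>" .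
  qed
qed

section \<open>Upper and essential upper integrals of arbitrary functions\<close>

lemma upper_integral_le: "lsc_on Y g \<Longrightarrow> (\<And>y. y \<in> topspace Y \<Longrightarrow> f y \<le> g y) \<Longrightarrow> N f \<le> U g"
  unfolding upper_integral_def by (intro INF_lower) auto

lemma upper_integral_mono: "(\<And>y. y \<in> topspace Y \<Longrightarrow> f y \<le> g y) \<Longrightarrow> N f \<le> N g"
  unfolding upper_integral_def by (intro INF_superset_mono) (auto intro: order_trans)

lemma upper_integral_Kpos:
  assumes "h \<in> Kpos Y" shows "N (\<lambda>y. ennreal (h y)) = A h"
proof (rule antisym)
  have "U (\<lambda>y. ennreal (h y)) \<le> A h"
    unfolding upper_integral_lsc_def
  proof (rule SUP_least)
    fix k assume k: "k \<in> {k \<in> Kpos Y. \<forall>y\<in>topspace Y. ennreal (k y) \<le> ennreal (h y)}"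
    show "A k \<le> A h"
    proof (rule abs_measure_mono)
      show "k y \<le> h y" for y
        by (cases "y \<in> topspace Y") (use k assms Kpos_nonneg Kpos_outside in force)+
    qed
  qed
  then show "N (\<lambda>y. ennreal (h y)) \<le> A h"
    using upper_integral_le[OF Kpos_lsc[OF assms]] by (meson order_refl order_trans)
  show "A h \<le> N (\<lambda>y. ennreal (h y))"
    unfolding upper_integral_def using assms by (intro INF_greatest upper_integral_lsc_ge) auto
qed

lemma upper_integral_approx:
  assumes "N f < \<infinity>" "0 < \<epsilon>"
  obtains g where "lsc_on Y g" "\<And>y. y \<in> topspace Y \<Longrightarrow> f y \<le> g y" "U g < N f + ennreal \<epsilon>"
proof -
  have "N f < N f + ennreal \<epsilon>" using assms by (cases "N f") (auto simp: ennreal_less_iff simp flip: ennreal_plus)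
  then show thesis using that unfolding upper_integral_def by (auto simp: INF_less_iff)
qed

text \<open>Each term gets a lower semicontinuous majorant with excess \<epsilon>/2^(i+1); the
  excesses sum to \<epsilon>. If some term has infinite upper integral, the right-hand side is
  infinite.\<close>

lemma upper_integral_suminf: "N (\<lambda>y. \<Sum>i::nat. f i y) \<le> (\<Sum>i. N (f i))"
proof (cases "\<exists>i. N (f i) = \<infinity>")
  case True
  then have "(\<Sum>i. N (f i)) = \<infinity>"
    using ennreal_suminf_lessD[of "\<lambda>i. N (f i)" \<infinity>] by (metis infinity_ennreal_def less_irrefl top.not_eq_extremum)
  then show ?thesis by simp
next
  case False
  show ?thesis
  proof (rule ennreal_le_epsilon)
    fix \<epsilon> :: real assume \<epsilon>: "0 < \<epsilon>"
    have "\<exists>g. lsc_on Y g \<and> (\<forall>y\<in>topspace Y. f i y \<le> g y) \<and> U g \<le> N (f i) + ennreal (\<epsilon> * (1/2) ^ Suc i)" for i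
    proof -
      have "N (f i) < \<infinity>" using False by (simp add: less_top)
      moreover have "0 < \<epsilon> * (1/2) ^ Suc i" using \<epsilon> by simp
      ultimately show ?thesis using upper_integral_approx[of "f i" "\<epsilon> * (1/2) ^ Suc i"] less_imp_le by metis
    qed
    then obtain g where g: "\<And>i. lsc_on Y (g i)" "\<And>i y. y \<in> topspace Y \<Longrightarrow> f i y \<le> g i y"
        "\<And>i. U (g i) \<le> N (f i) + ennreal (\<epsilon> * (1/2) ^ Suc i)" by metis
    have "N (\<lambda>y. \<Sum>i. f i y) \<le> U (\<lambda>y. \<Sum>i. g i y)"
      by (intro upper_integral_le lsc_suminf g suminf_le) auto
    also have "\<dots> \<le> (\<Sum>i. U (g i))" by (intro upper_integral_lsc_suminf g)
    also have "\<dots> \<le> (\<Sum>i. N (f i) + ennreal (\<epsilon> * (1/2) ^ Suc i))" by (intro suminf_le g) auto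
    also have "\<dots> = (\<Sum>i. N (f i)) + (\<Sum>i. ennreal (\<epsilon> * (1/2) ^ Suc i))"
      by (intro suminf_add[symmetric]) auto
    also have "(\<Sum>i. ennreal (\<epsilon> * (1/2) ^ Suc i)) = ennreal \<epsilon>"
      using sums_mult[OF power_half_series, of \<epsilon>] \<epsilon> by (intro suminf_ennreal_eq) auto
    finally show "N (\<lambda>y. \<Sum>i. f i y) \<le> (\<Sum>i. N (f i)) + ennreal \<epsilon>" .
  qed
qed

lemma ess_upper_ge: "compactin Y K \<Longrightarrow> N (\<lambda>y. f y * indicator K y) \<le> E f"
  unfolding ess_upper_integral_def by (intro SUP_upper) auto

lemma ess_upper_leI: "(\<And>K. compactin Y K \<Longrightarrow> N (\<lambda>y. f y * indicator K y) \<le> c) \<Longrightarrow> E f \<le> c"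
  unfolding ess_upper_integral_def by (intro SUP_least) auto

lemma ess_upper_mono: "(\<And>y. y \<in> topspace Y \<Longrightarrow> f y \<le> g y) \<Longrightarrow> E f \<le> E g"
  by (rule ess_upper_leI, rule order_trans[OF upper_integral_mono ess_upper_ge]) (auto intro: mult_right_mono)

lemma ess_upper_le_upper: "E f \<le> N f"
  by (intro ess_upper_leI upper_integral_mono) (auto simp: indicator_def)

lemma ess_upper_suminf: "E (\<lambda>y. \<Sum>i::nat. f i y) \<le> (\<Sum>i. E (f i))"
proof (rule ess_upper_leI)
  fix K assume K: "compactin Y K"
  have "N (\<lambda>y. (\<Sum>i. f i y) * indicator K y) = N (\<lambda>y. \<Sum>i. f i y * indicator K y)" by simp
  also have "\<dots> \<le> (\<Sum>i. N (\<lambda>y. f i y * indicator K y))" by (rule upper_integral_suminf)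
  also have "\<dots> \<le> (\<Sum>i. E (f i))" using K by (intro suminf_le ess_upper_ge) auto
  finally show "N (\<lambda>y. (\<Sum>i. f i y) * indicator K y) \<le> (\<Sum>i. E (f i))" .
qed

lemma ess_upper_Kpos:
  assumes "h \<in> Kpos Y" shows "E (\<lambda>y. ennreal (h y)) = A h"
proof (rule antisym)
  show "E (\<lambda>y. ennreal (h y)) \<le> A h"
    using ess_upper_le_upper upper_integral_Kpos[OF assms] by metis
  obtain K where K: "compactin Y K" "\<And>y. y \<notin> K \<Longrightarrow> h y = 0" using assms Kpos_support by blast
  have "N (\<lambda>y. ennreal (h y)) \<le> N (\<lambda>y. ennreal (h y) * indicator K y)"
    using K(2) by (intro upper_integral_mono) (auto simp: indicator_def)
  also have "\<dots> \<le> E (\<lambda>y. ennreal (h y))" by (rule ess_upper_ge[OF K(1)])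
  finally show "A h \<le> E (\<lambda>y. ennreal (h y))" using upper_integral_Kpos[OF assms] by simp
qed

lemma ess_upper_zero: "E (\<lambda>y. 0) = 0"
  using ess_upper_Kpos[OF Kpos_zero] abs_measure_zero by simp

text \<open>The two functions are padded with zeros to a sequence, which makes this a case of
  countable subadditivity.\<close>

lemma ess_upper_add: "E (\<lambda>y. f y + g y) \<le> E f + E g"
proof -
  define F where "F i = (if i = 0 then f else if i = 1 then g else (\<lambda>y. 0))" for i :: nat
  have two: "(\<Sum>i. s i) = s 0 + s 1" if "\<And>i. i \<notin> {0, 1} \<Longrightarrow> s i = 0" for s :: "nat \<Rightarrow> ennreal"
    using suminf_finite[of "{0, 1::nat}" s] that by simp
  have "(\<lambda>y. f y + g y) = (\<lambda>y. \<Sum>i. F i y)" by (rule ext, subst two) (auto simp: F_def)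
  moreover have "(\<Sum>i. E (F i)) = E f + E g" by (subst two) (auto simp: F_def ess_upper_zero)
  ultimately show ?thesis using ess_upper_suminf[of F] by simp
qed

end

section \<open>Dominated convergence for the essential upper integral\<close>

text \<open>Bounded partial sums make all terms finite, so the tail can be computed for a convergent
  series of reals.\<close>

lemma small_tail_suminf:
  fixes e :: "nat \<Rightarrow> ennreal"
  assumes "\<And>m. (\<Sum>i<m. e i) \<le> B" "B < \<infinity>" "0 < \<epsilon>"
  shows "\<exists>n. (\<Sum>i. e (i + n)) < ennreal \<epsilon>"
proof -
  have "e i < \<infinity>" for i
  proof -
    have "e i \<le> (\<Sum>i<Suc i. e i)" by simp
    then show ?thesis using assms(1)[of "Suc i"] assms(2) by (meson le_less_trans)
  qed
  then have e: "e i = ennreal (enn2real (e i))" for i by (simp add: less_top)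
  define r where "r i = enn2real (e i)" for i
  have r: "e i = ennreal (r i)" "0 \<le> r i" for i using e by (auto simp: r_def)
  have sum: "(\<Sum>i<m. r i) \<le> enn2real B" for m
    using assms(1)[of m] assms(2) r by (cases B) (auto simp: sum_nonneg)
  then have "summable r" using r by (intro summableI_nonneg_bounded)
  then obtain n where "norm (\<Sum>i. r (i + n)) < \<epsilon>" using suminf_exist_split[OF assms(3)] by blast
  moreover have "(\<Sum>i. e (i + n)) = ennreal (\<Sum>i. r (i + n))"
    using r \<open>summable r\<close> by (simp add: suminf_ennreal2 summable_ignore_initial_segment)
  ultimately show ?thesis using assms(3) by (auto intro!: exI[of _ n] ennreal_lessI)
qed

context radon_space begin

text \<open>The coercion to \<open>ennreal\<close> sends negative reals to 0, so \<open>R f\<close>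
  only sees the positive part of \<open>f\<close>.\<close>

abbreviation R :: "('y \<Rightarrow> real) \<Rightarrow> ennreal" where "R f \<equiv> E (\<lambda>y. ennreal (f y))"

lemma R_le_add:
  assumes "\<And>y. y \<in> topspace Y \<Longrightarrow> 0 \<le> g y" "\<And>y. y \<in> topspace Y \<Longrightarrow> 0 \<le> h y"
    "\<And>y. y \<in> topspace Y \<Longrightarrow> f y \<le> g y + h y"
  shows "R f \<le> R g + R h"
proof -
  have "R f \<le> E (\<lambda>y. ennreal (g y) + ennreal (h y))"
    using assms by (intro ess_upper_mono) (simp add: ennreal_leI flip: ennreal_plus)
  also have "\<dots> \<le> R g + R h" by (rule ess_upper_add)
  finally show ?thesis .
qed

lemma R_mono: "(\<And>y. y \<in> topspace Y \<Longrightarrow> f y \<le> g y) \<Longrightarrow> R f \<le> R g"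
  by (intro ess_upper_mono ennreal_leI)

text \<open>The positive cone of the integrable functions, described as a closure and not by
  measurability: additivity of the total variation on \<open>Kpos Y\<close> then carries over by
  approximation.\<close>

definition L1pos :: "('y \<Rightarrow> real) set" where
  "L1pos = {f. (\<forall>y\<in>topspace Y. 0 \<le> f y) \<and> (\<forall>\<epsilon>>0. \<exists>k\<in>Kpos Y. R (\<lambda>y. \<bar>f y - k y\<bar>) < ennreal \<epsilon>)}"

lemma L1pos_nonneg: "f \<in> L1pos \<Longrightarrow> y \<in> topspace Y \<Longrightarrow> 0 \<le> f y"
  by (simp add: L1pos_def)

lemma L1pos_approx:
  assumes "f \<in> L1pos" "0 < \<epsilon>"
  obtains k where "k \<in> Kpos Y" "R (\<lambda>y. \<bar>f y - k y\<bar>) < ennreal \<epsilon>"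
  using assms unfolding L1pos_def by blast

lemma L1posI:
  assumes "\<And>y. y \<in> topspace Y \<Longrightarrow> 0 \<le> f y"
    "\<And>\<epsilon>. 0 < \<epsilon> \<Longrightarrow> \<exists>k\<in>Kpos Y. R (\<lambda>y. \<bar>f y - k y\<bar>) < ennreal \<epsilon>"
  shows "f \<in> L1pos"
  using assms unfolding L1pos_def by blast

lemma L1pos_cong:
  assumes "f \<in> L1pos" "\<And>y. y \<in> topspace Y \<Longrightarrow> f y = g y"
  shows "g \<in> L1pos"
proof (rule L1posI)
  show "0 \<le> g y" if "y \<in> topspace Y" for y using that assms L1pos_nonneg by metis
  fix \<epsilon> :: real assume "0 < \<epsilon>"
  with assms(1) obtain k where k: "k \<in> Kpos Y" "R (\<lambda>y. \<bar>f y - k y\<bar>) < ennreal \<epsilon>" by (rule L1pos_approx)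
  have "R (\<lambda>y. \<bar>g y - k y\<bar>) \<le> R (\<lambda>y. \<bar>f y - k y\<bar>)" using assms(2) by (intro R_mono) simp
  with k show "\<exists>k\<in>Kpos Y. R (\<lambda>y. \<bar>g y - k y\<bar>) < ennreal \<epsilon>" by (meson le_less_trans)
qed

lemma Kpos_L1pos: "k \<in> Kpos Y \<Longrightarrow> k \<in> L1pos"
  by (rule L1posI) (auto simp: Kpos_nonneg ess_upper_zero intro!: bexI[of _ k])

lemma L1pos_closed:
  assumes "\<And>y. y \<in> topspace Y \<Longrightarrow> 0 \<le> f y"
    and "\<And>\<epsilon>. 0 < \<epsilon> \<Longrightarrow> \<exists>g\<in>L1pos. R (\<lambda>y. \<bar>f y - g y\<bar>) < ennreal \<epsilon>"
  shows "f \<in> L1pos"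
proof (rule L1posI[OF assms(1)])
  fix \<epsilon> :: real assume \<epsilon>: "0 < \<epsilon>"
  obtain g where g: "g \<in> L1pos" "R (\<lambda>y. \<bar>f y - g y\<bar>) < ennreal (\<epsilon>/2)"
    using assms(2)[of "\<epsilon>/2"] \<epsilon> by auto
  obtain k where k: "k \<in> Kpos Y" "R (\<lambda>y. \<bar>g y - k y\<bar>) < ennreal (\<epsilon>/2)"
    using L1pos_approx[OF g(1), of "\<epsilon>/2"] \<epsilon> by auto
  have "R (\<lambda>y. \<bar>f y - k y\<bar>) \<le> R (\<lambda>y. \<bar>f y - g y\<bar>) + R (\<lambda>y. \<bar>g y - k y\<bar>)"
    by (intro R_le_add) auto
  also have "\<dots> < ennreal (\<epsilon>/2) + ennreal (\<epsilon>/2)" using g k by (intro add_strict_mono)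
  also have "\<dots> = ennreal \<epsilon>" using \<epsilon> by (simp flip: ennreal_plus)
  finally show "\<exists>k\<in>Kpos Y. R (\<lambda>y. \<bar>f y - k y\<bar>) < ennreal \<epsilon>" using k by blast
qed

lemma L1pos_finite:
  assumes "f \<in> L1pos" shows "R f < \<infinity>"
proof -
  obtain k where k: "k \<in> Kpos Y" "R (\<lambda>y. \<bar>f y - k y\<bar>) < ennreal 1"
    using L1pos_approx[OF assms, of 1] by auto
  have "R f \<le> R k + R (\<lambda>y. \<bar>f y - k y\<bar>)"
    using Kpos_nonneg[OF k(1)] by (intro R_le_add) auto
  also have "\<dots> < \<infinity>"
    using k abs_measure_finite[OF k(1)] unfolding ess_upper_Kpos[OF k(1)]
    by (auto simp: ennreal_add_eq_top less_top intro: less_trans)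
  finally show ?thesis .
qed

text \<open>The Lipschitz condition bounds the error of the combined approximants by the sum of the
  two errors. The instances are sum, maximum and truncated difference.\<close>

lemma L1pos_combine:
  assumes f: "f \<in> L1pos" and g: "g \<in> L1pos"
    and lip: "\<And>a b c d. \<bar>\<Phi> a b - \<Phi> c d\<bar> \<le> \<bar>a - c\<bar> + \<bar>b - d\<bar>"
    and K: "\<And>k l. k \<in> Kpos Y \<Longrightarrow> l \<in> Kpos Y \<Longrightarrow> (\<lambda>y. \<Phi> (k y) (l y)) \<in> Kpos Y"
    and nonneg: "\<And>a b. 0 \<le> a \<Longrightarrow> 0 \<le> b \<Longrightarrow> 0 \<le> \<Phi> a b"
  shows "(\<lambda>y. \<Phi> (f y) (g y)) \<in> L1pos"
proof (rule L1posI)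
  show "0 \<le> \<Phi> (f y) (g y)" if "y \<in> topspace Y" for y
    using that f g by (intro nonneg L1pos_nonneg)
  fix \<epsilon> :: real assume \<epsilon>: "0 < \<epsilon>"
  obtain k where k: "k \<in> Kpos Y" "R (\<lambda>y. \<bar>f y - k y\<bar>) < ennreal (\<epsilon>/2)"
    using L1pos_approx[OF f, of "\<epsilon>/2"] \<epsilon> by auto
  obtain l where l: "l \<in> Kpos Y" "R (\<lambda>y. \<bar>g y - l y\<bar>) < ennreal (\<epsilon>/2)"
    using L1pos_approx[OF g, of "\<epsilon>/2"] \<epsilon> by auto
  have "R (\<lambda>y. \<bar>\<Phi> (f y) (g y) - \<Phi> (k y) (l y)\<bar>) \<le> R (\<lambda>y. \<bar>f y - k y\<bar>) + R (\<lambda>y. \<bar>g y - l y\<bar>)"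
    using lip by (intro R_le_add) auto
  also have "\<dots> < ennreal (\<epsilon>/2) + ennreal (\<epsilon>/2)" using l k by (intro add_strict_mono)
  also have "\<dots> = ennreal \<epsilon>" using \<epsilon> by (simp flip: ennreal_plus)
  finally show "\<exists>m\<in>Kpos Y. R (\<lambda>y. \<bar>\<Phi> (f y) (g y) - m y\<bar>) < ennreal \<epsilon>" 
    by (rule bexI[OF _ K[OF k(1) l(1)]])
qed

lemma L1pos_add: "f \<in> L1pos \<Longrightarrow> g \<in> L1pos \<Longrightarrow> (\<lambda>y. f y + g y) \<in> L1pos"
  by (rule L1pos_combine) (auto intro: Kpos_add)

lemma L1pos_max: "f \<in> L1pos \<Longrightarrow> g \<in> L1pos \<Longrightarrow> (\<lambda>y. max (f y) (g y)) \<in> L1pos"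
  by (rule L1pos_combine) (auto intro: Kpos_max)

lemma L1pos_diff:
  assumes "f \<in> L1pos" "g \<in> L1pos" "\<And>y. y \<in> topspace Y \<Longrightarrow> g y \<le> f y"
  shows "(\<lambda>y. f y - g y) \<in> L1pos"
proof (rule L1pos_cong)
  show "(\<lambda>y. max 0 (f y - g y)) \<in> L1pos"
    using assms(1,2) by (rule L1pos_combine) (auto intro: Kpos_diff)
qed (use assms(3) in auto)

text \<open>Only superadditivity is specific to this cone; it comes from
  \<open>abs_measure_add_ge\<close> for approximants in \<open>Kpos Y\<close>.\<close>

lemma L1pos_additive:
  assumes f: "f \<in> L1pos" and g: "g \<in> L1pos"
  shows "R (\<lambda>y. f y + g y) = R f + R g"
proof (rule antisym)
  show "R (\<lambda>y. f y + g y) \<le> R f + R g" using L1pos_nonneg f g by (intro R_le_add) auto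
  show "R f + R g \<le> R (\<lambda>y. f y + g y)"
  proof (rule ennreal_le_epsilon)
    fix \<epsilon> :: real assume \<epsilon>: "0 < \<epsilon>"
    \<comment> \<open>Two errors arise in passing from \<open>f\<close>, \<open>g\<close> to
      \<open>k\<close>, \<open>l\<close>, and two more in returning to the sum.\<close>
    define d where "d = \<epsilon>/4"
    have d: "0 < d" "ennreal \<epsilon> = ennreal d + ennreal d + (ennreal d + ennreal d)"
      using \<epsilon> by (auto simp: d_def simp flip: ennreal_plus)
    obtain k where k: "k \<in> Kpos Y" "R (\<lambda>y. \<bar>f y - k y\<bar>) < ennreal d" using L1pos_approx[OF f d(1)] by blast
    obtain l where l: "l \<in> Kpos Y" "R (\<lambda>y. \<bar>g y - l y\<bar>) < ennreal d" using L1pos_approx[OF g d(1)] by blast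
    have k0: "0 \<le> k y" and l0: "0 \<le> l y" for y using Kpos_nonneg[OF k(1)] Kpos_nonneg[OF l(1)] by auto
    have "R k + R l = A k + A l" using k l by (simp add: ess_upper_Kpos)
    also have "\<dots> \<le> A (\<lambda>y. k y + l y)" using k l by (intro abs_measure_add_ge)
    also have "\<dots> = R (\<lambda>y. k y + l y)" using ess_upper_Kpos[OF Kpos_add[OF k(1) l(1)]] by simp
    also have "\<dots> \<le> R (\<lambda>y. f y + g y) + R (\<lambda>y. \<bar>f y - k y\<bar> + \<bar>g y - l y\<bar>)"
      using L1pos_nonneg[OF f] L1pos_nonneg[OF g] by (intro R_le_add) auto
    also have "\<dots> \<le> R (\<lambda>y. f y + g y) + (R (\<lambda>y. \<bar>f y - k y\<bar>) + R (\<lambda>y. \<bar>g y - l y\<bar>))"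
      by (intro add_left_mono R_le_add) auto
    also have "\<dots> \<le> R (\<lambda>y. f y + g y) + (ennreal d + ennreal d)"
      using k l by (intro add_left_mono add_mono less_imp_le)
    finally have kl: "R k + R l \<le> R (\<lambda>y. f y + g y) + (ennreal d + ennreal d)" .
    have "R f + R g \<le> (R k + R (\<lambda>y. \<bar>f y - k y\<bar>)) + (R l + R (\<lambda>y. \<bar>g y - l y\<bar>))"
      using k0 l0 by (intro add_mono R_le_add) auto
    also have "\<dots> \<le> (R k + ennreal d) + (R l + ennreal d)"
      using k l by (intro add_mono order_refl less_imp_le)
    also have "\<dots> = (R k + R l) + (ennreal d + ennreal d)" by (simp add: ac_simps)
    also have "\<dots> \<le> R (\<lambda>y. f y + g y) + (ennreal d + ennreal d) + (ennreal d + ennreal d)"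
      using kl by (rule add_right_mono)
    finally show "R f + R g \<le> R (\<lambda>y. f y + g y) + ennreal \<epsilon>"
      unfolding d(2) by (simp add: ac_simps)
  qed
qed

lemma L1pos_sum: "(\<And>i. d i \<in> L1pos) \<Longrightarrow> (\<lambda>y. \<Sum>i<(m::nat). d i y) \<in> L1pos \<and> R (\<lambda>y. \<Sum>i<m. d i y) = (\<Sum>i<m. R (d i))"
proof (induction m)
  case 0 then show ?case by (simp add: Kpos_L1pos[OF Kpos_zero] ess_upper_zero)
next
  case (Suc m)
  then show ?case using L1pos_add[of "\<lambda>y. \<Sum>i<m. d i y" "d m"] L1pos_additive[of "\<lambda>y. \<Sum>i<m. d i y" "d m"] by simp
qed

text \<open>Additivity bounds the partial sums of the integrals by \<open>E G\<close>, so the series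
  of integrals converges; countable subadditivity then transfers its small tail to the integral of
  the tail. The bound \<open>G\<close> enters through monotonicity alone.\<close>

lemma L1pos_small_tail:
  assumes "\<And>i. d i \<in> L1pos" "\<And>m y. y \<in> topspace Y \<Longrightarrow> ennreal (\<Sum>i<m. d i y) \<le> G y" "E G < \<infinity>" "0 < \<epsilon>"
  shows "\<exists>n. E (\<lambda>y. \<Sum>i. ennreal (d (i + n) y)) < ennreal \<epsilon>"
proof -
  have "(\<Sum>i<m. R (d i)) \<le> E G" for m
  proof -
    have "(\<Sum>i<m. R (d i)) = R (\<lambda>y. \<Sum>i<m. d i y)" using L1pos_sum[of d m, OF assms(1)] by simp
    also have "\<dots> \<le> E G" using assms(2) by (intro ess_upper_mono)
    finally show ?thesis .
  qed
  then obtain n where "(\<Sum>i. R (d (i + n))) < ennreal \<epsilon>" using small_tail_suminf assms(3,4) by blast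
  then show ?thesis using ess_upper_suminf[of "\<lambda>i y. ennreal (d (i + n) y)"] le_less_trans by blast
qed

text \<open>The difference g - f n is the tail of the series of increments, whose partial sums stay
  below \<open>g\<close>; hence \<open>f n\<close> approximates \<open>g\<close> in the
  seminorm.\<close>

lemma L1pos_monotone_limit:
  assumes f: "\<And>n. f n \<in> L1pos" and mono: "\<And>n y. y \<in> topspace Y \<Longrightarrow> f n y \<le> f (Suc n) y"
    and lim: "\<And>y. y \<in> topspace Y \<Longrightarrow> (\<lambda>n. f n y) \<longlonglongrightarrow> g y" and fin: "R g < \<infinity>"
  shows "g \<in> L1pos"
proof -
  have le: "f n y \<le> g y" if y: "y \<in> topspace Y" for n y
    using incseq_le[OF _ lim[OF y], of n] mono[OF y] by (simp add: incseq_SucI)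
  define d where "d n = (\<lambda>y. f (Suc n) y - f n y)" for n
  have d: "d n \<in> L1pos" for n unfolding d_def by (intro L1pos_diff f mono)
  show ?thesis
  proof (rule L1pos_closed)
    show "0 \<le> g y" if "y \<in> topspace Y" for y using le[OF that, of 0] L1pos_nonneg[OF f that, of 0] by simp
    fix \<epsilon> :: real assume \<epsilon>: "0 < \<epsilon>"
    have "ennreal (\<Sum>i<m. d i y) \<le> ennreal (g y)" if y: "y \<in> topspace Y" for m y
    proof -
      have "(\<Sum>i<m. d i y) = f m y - f 0 y" unfolding d_def by (rule sum_lessThan_telescope)
      then show ?thesis using le[OF y, of m] L1pos_nonneg[OF f y, of 0] by (intro ennreal_leI) simp
    qed
    from L1pos_small_tail[OF d this fin \<epsilon>]
    obtain n where n: "E (\<lambda>y. \<Sum>i. ennreal (d (i + n) y)) < ennreal \<epsilon>" by blast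
    have "ennreal \<bar>g y - f n y\<bar> \<le> (\<Sum>i. ennreal (d (i + n) y))" if y: "y \<in> topspace Y" for y
    proof -
      have "(\<lambda>i. f (i + n) y) \<longlonglongrightarrow> g y" using lim[OF y] by (rule LIMSEQ_ignore_initial_segment)
      then have "(\<lambda>i. d (i + n) y) sums (g y - f n y)"
        using telescope_sums[of "\<lambda>i. f (i + n) y"] by (simp add: d_def)
      then have "(\<Sum>i. ennreal (d (i + n) y)) = ennreal (g y - f n y)"
        using L1pos_nonneg[OF d y] by (intro suminf_ennreal_eq)
      then show ?thesis using le[OF y, of n] by simp
    qed
    then have "R (\<lambda>y. \<bar>g y - f n y\<bar>) \<le> E (\<lambda>y. \<Sum>i. ennreal (d (i + n) y))" by (rule ess_upper_mono)
    with n f show "\<exists>h\<in>L1pos. R (\<lambda>y. \<bar>g y - h y\<bar>) < ennreal \<epsilon>" by (meson le_less_trans)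
  qed
qed

text \<open>Here \<open>f n\<close> itself is the tail of the series of decrements, and
  \<open>f 0\<close> bounds the partial sums.\<close>

lemma L1pos_decreasing_to_zero:
  assumes f: "\<And>n. f n \<in> L1pos" and dec: "\<And>n y. y \<in> topspace Y \<Longrightarrow> f (Suc n) y \<le> f n y"
    and lim: "\<And>y. y \<in> topspace Y \<Longrightarrow> (\<lambda>n. f n y) \<longlonglongrightarrow> 0" and \<epsilon>: "0 < \<epsilon>"
  shows "\<exists>n. R (f n) < ennreal \<epsilon>"
proof -
  define d where "d n = (\<lambda>y. f n y - f (Suc n) y)" for n
  have d: "d n \<in> L1pos" for n unfolding d_def by (intro L1pos_diff f dec)
  have "ennreal (\<Sum>i<m. d i y) \<le> ennreal (f 0 y)" if y: "y \<in> topspace Y" for m y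
  proof -
    have "(\<Sum>i<m. d i y) = f 0 y - f m y" unfolding d_def by (rule sum_lessThan_telescope')
    then show ?thesis using L1pos_nonneg[OF f y, of m] by (intro ennreal_leI) simp
  qed
  from L1pos_small_tail[OF d this L1pos_finite[OF f] \<epsilon>]
  obtain n where n: "E (\<lambda>y. \<Sum>i. ennreal (d (i + n) y)) < ennreal \<epsilon>" by blast
  have "ennreal (f n y) \<le> (\<Sum>i. ennreal (d (i + n) y))" if y: "y \<in> topspace Y" for y
  proof -
    have "(\<lambda>i. f (i + n) y) \<longlonglongrightarrow> 0" using lim[OF y] by (rule LIMSEQ_ignore_initial_segment)
    then have "(\<lambda>i. d (i + n) y) sums (f n y - 0)"
      using telescope_sums'[of "\<lambda>i. f (i + n) y" 0] by (simp add: d_def)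
    then have "(\<Sum>i. ennreal (d (i + n) y)) = ennreal (f n y - 0)"
      using L1pos_nonneg[OF d y] by (intro suminf_ennreal_eq)
    then show ?thesis by simp
  qed
  then have "R (f n) \<le> E (\<lambda>y. \<Sum>i. ennreal (d (i + n) y))" by (rule ess_upper_mono)
  with n show ?thesis by (meson le_less_trans)
qed

text \<open>The tail suprema decrease to 0 and dominate the sequence. Each of them lies in the cone
  as the increasing limit of finite maxima, and \<open>G\<close> serves to keep its integral
  finite.\<close>

theorem L1pos_dominated_null_sequence:
  assumes f: "\<And>n. f n \<in> L1pos" and lim: "\<And>y. y \<in> topspace Y \<Longrightarrow> (\<lambda>n. f n y) \<longlonglongrightarrow> 0"
    and dom: "\<And>n y. y \<in> topspace Y \<Longrightarrow> ennreal (f n y) \<le> G y" and fin: "E G < \<infinity>" and \<epsilon>: "0 < \<epsilon>"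
  shows "\<exists>n. R (f n) < ennreal \<epsilon>"
proof -
  define F where "F n y = (SUP k. f (n + k) y)" for n y
  have bdd: "bdd_above (range (\<lambda>k. f (n + k) y))" if "y \<in> topspace Y" for n y
  proof -
    have "Bseq (\<lambda>k. f k y)" using lim[OF that] by (intro convergent_imp_Bseq) (auto simp: convergent_def)
    then obtain B where "\<And>k. norm (f k y) \<le> B" by (auto simp: Bseq_def)
    then show ?thesis by (intro bdd_aboveI2[of _ _ B]) (auto simp: abs_le_iff)
  qed
  have le_F: "f (n + k) y \<le> F n y" if "y \<in> topspace Y" for n k y
    unfolding F_def using bdd[OF that] by (intro cSUP_upper) auto
  have F_le: "F n y \<le> c" if "\<And>k. f (n + k) y \<le> c" for n y c
    unfolding F_def using that by (intro cSUP_least) auto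
  have F_G: "ennreal (F n y) \<le> G y" if y: "y \<in> topspace Y" for n y
  proof (cases "G y")
    case (real r)
    have "F n y \<le> r" using dom[OF y] real by (intro F_le) simp
    then show ?thesis using real by (simp add: ennreal_leI)
  qed simp
  define M where "M n m y = Max ((\<lambda>k. f (n + k) y) ` {..m})" for n m y
  have M_Suc: "M n (Suc m) y = max (f (n + Suc m) y) (M n m y)" for n m y
    unfolding M_def by (simp add: atMost_Suc)
  have M_L1pos: "M n m \<in> L1pos" for n m
  proof (induction m)
    case 0
    have "M n 0 = f n" by (auto simp: M_def)
    then show ?case using f by simp
  next
    case (Suc m)
    have "M n (Suc m) = (\<lambda>y. max (f (n + Suc m) y) (M n m y))" using M_Suc by auto
    then show ?case using L1pos_max[OF f Suc] by simp
  qed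
  have F_L1pos: "F n \<in> L1pos" for n
  proof (rule L1pos_monotone_limit[OF M_L1pos])
    show "M n m y \<le> M n (Suc m) y" for m y by (simp add: M_Suc)
    show "R (F n) < \<infinity>"
      using ess_upper_mono[OF F_G] fin by (meson le_less_trans)
    fix y assume y: "y \<in> topspace Y"
    have M_le: "M n m y \<le> F n y" for m unfolding M_def using le_F[OF y] by auto
    have le_M: "f (n + k) y \<le> M n k y" for k unfolding M_def by (intro Max_ge) auto
    have "(\<lambda>m. M n m y) \<longlonglongrightarrow> (SUP m. M n m y)"
      using M_le by (intro LIMSEQ_incseq_SUP incseq_SucI bdd_aboveI2[of _ _ "F n y"]) (auto simp: M_Suc)
    moreover have "(SUP m. M n m y) = F n y"
    proof (rule antisym)
      show "(SUP m. M n m y) \<le> F n y" using M_le by (intro cSUP_least) auto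
      have "bdd_above (range (\<lambda>m. M n m y))" using M_le by (intro bdd_aboveI2[of _ _ "F n y"])
      then have "M n k y \<le> (SUP m. M n m y)" for k by (intro cSUP_upper) auto
      then show "F n y \<le> (SUP m. M n m y)" using le_M by (intro F_le) (meson order_trans)
    qed
    ultimately show "(\<lambda>m. M n m y) \<longlonglongrightarrow> F n y" by simp
  qed
  have "\<exists>n. R (F n) < ennreal \<epsilon>"
  proof (rule L1pos_decreasing_to_zero[OF F_L1pos _ _ \<epsilon>])
    fix n y assume y: "y \<in> topspace Y"
    show "F (Suc n) y \<le> F n y" using le_F[OF y, of n "Suc _"] by (intro F_le) simp
  next
    fix y assume y: "y \<in> topspace Y"
    show "(\<lambda>n. F n y) \<longlonglongrightarrow> 0"
    proof (rule LIMSEQ_I)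
      fix r :: real assume "0 < r"
      \<comment> \<open>Half of \<open>r\<close> is taken because a supremum of numbers below a
        bound may equal that bound.\<close>
      then obtain n0 where n0: "\<And>n. n0 \<le> n \<Longrightarrow> norm (f n y - 0) < r/2"
        using LIMSEQ_D[OF lim[OF y], of "r/2"] by auto
      have "norm (F n y - 0) < r" if "n0 \<le> n" for n
      proof -
        have "f (n + k) y \<le> r/2" for k using n0[of "n + k"] that by simp
        then have "F n y \<le> r/2" by (rule F_le)
        then show ?thesis using L1pos_nonneg[OF F_L1pos y, of n] \<open>0 < r\<close> by simp
      qed
      then show "\<exists>no. \<forall>n\<ge>no. norm (F n y - 0) < r" by blast
    qed
  qed
  then obtain n where n: "R (F n) < ennreal \<epsilon>" by blast
  have "R (f n) \<le> R (F n)" using le_F[of _ n 0] by (intro R_mono) simp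
  with n show ?thesis by (meson le_less_trans)
qed

end

section \<open>Measurable functions and the essential integral\<close>

context radon_space begin

text \<open>The extension \<open>F\<close> of \<open>f\<close> by zero is upper semicontinuous. It
  is approximated from above by some \<open>h\<close> of \<open>Kpos Y\<close> whose measure is
  close to the upper integral of \<open>F\<close>; that closeness must then be turned into smallness
  of the integral of h - F, although additivity is not yet known for \<open>F\<close>.\<close>

lemma continuous_on_compact_L1pos:
  fixes f :: "'y \<Rightarrow> real"
  assumes C: "compactin Y C" and f: "continuous_map (subtopology Y C) euclideanreal f"
    and nonneg: "\<And>y. y \<in> C \<Longrightarrow> 0 \<le> f y"
  shows "(\<lambda>y. f y * indicator C y) \<in> L1pos"
proof -
  define F where "F = (\<lambda>y. f y * indicator C y)"
  have F0: "0 \<le> F y" and FC: "y \<in> C \<Longrightarrow> F y = f y" and FnC: "y \<notin> C \<Longrightarrow> F y = 0" for y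
    using nonneg by (auto simp: F_def indicator_def)
  have CY: "C \<subseteq> topspace Y" using C by (rule compactin_subset_topspace)
  obtain u where u: "u \<in> Kpos Y" "\<And>y. y \<in> C \<Longrightarrow> 1 \<le> u y" using cutoff_function[OF C] by blast
  have u0: "0 \<le> u y" for y by (rule Kpos_nonneg[OF u(1)])
  obtain r where r: "A u = ennreal r" "0 \<le> r" using abs_measure_finite[OF u(1)] by (cases "A u") auto
  have "compact (f ` C)"
    using image_compactin[of "subtopology Y C" C euclideanreal f] C f by simp
  then obtain b where b: "\<And>y. y \<in> C \<Longrightarrow> \<bar>f y\<bar> \<le> b"
    by (meson bounded_real compact_imp_bounded image_eqI)
  have "F y \<le> max b 0 * u y" for y
  proof (cases "y \<in> C")
    case True
    have "f y \<le> max b 0" using b[OF True] by simp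
    also have "\<dots> \<le> max b 0 * u y" using u(2)[OF True] mult_left_mono[of 1 "u y" "max b 0"] by simp
    finally show ?thesis using FC True by simp
  next
    case False then show ?thesis using FnC u0 by simp
  qed
  then have "N (\<lambda>y. ennreal (F y)) \<le> N (\<lambda>y. ennreal (max b 0 * u y))"
    by (intro upper_integral_mono ennreal_leI)
  also have "\<dots> < \<infinity>"
    using upper_integral_Kpos[OF Kpos_scale[of "max b 0" u Y]] abs_measure_finite[OF Kpos_scale[of "max b 0" u Y]] u by simp
  finally have fin: "N (\<lambda>y. ennreal (F y)) < \<infinity>" .
  have "F \<in> L1pos"
  proof (rule L1posI[OF F0])
    fix \<epsilon> :: real assume \<epsilon>: "0 < \<epsilon>"
    define e where "e = \<epsilon>/3"
    have e: "0 < e" "ennreal e + ennreal e < ennreal \<epsilon>"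
      using \<epsilon> by (auto simp: e_def ennreal_less_iff simp flip: ennreal_plus)
    obtain g where g: "lsc_on Y g" "\<And>y. y \<in> topspace Y \<Longrightarrow> ennreal (F y) \<le> g y"
        "U g < N (\<lambda>y. ennreal (F y)) + ennreal e"
      using upper_integral_approx[OF fin e(1)] by blast
    define \<delta> where "\<delta> = e / (r + 1)"
    have \<delta>: "0 < \<delta>" "\<delta> * r \<le> e" using e r by (auto simp: \<delta>_def field_simps)
    define D where "D = {k \<in> Kpos Y. \<forall>z\<in>topspace Y. ennreal (k z) \<le> g z}"
    have "\<exists>k\<in>D. \<forall>y\<in>C. f y < k y + \<delta>"
    proof (rule directed_dominates[OF C f])
      show "D \<subseteq> Kpos Y" "D \<noteq> {}" using Kpos_zero[of Y] by (auto simp: D_def)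
      show "\<exists>m\<in>D. \<forall>y. k y \<le> m y \<and> l y \<le> m y" if "k \<in> D" "l \<in> D" for k l
        using that Kpos_max[of k Y l]
        by (intro bexI[of _ "\<lambda>y. max (k y) (l y)"]) (auto simp: D_def max_def)
      fix y assume y: "y \<in> C"
      then have yY: "y \<in> topspace Y" using CY by blast
      \<comment> \<open>Half of \<delta> leaves room on both sides: a positive \<open>a\<close> is
        strictly below f(y), and a + \<delta> is strictly above it.\<close>
      define a where "a = max 0 (f y - \<delta>/2)"
      have "a = 0 \<or> ennreal a < g y"
      proof (cases "a = 0")
        case False
        then have "0 \<le> a" "a < f y" using \<delta> by (auto simp: a_def max_def split: if_splits)
        then have "ennreal a < ennreal (F y)" using FC[OF y] by (simp add: ennreal_less_iff)
        also have "\<dots> \<le> g y" by (rule g(2)[OF yY])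
        finally show ?thesis by simp
      qed simp
      moreover have "0 \<le> a" by (simp add: a_def)
      ultimately obtain k where "k \<in> Kpos Y" "k y = a" "\<And>z. z \<in> topspace Y \<Longrightarrow> ennreal (k z) \<le> g z"
        using lsc_approx[OF g(1) yY] by blast
      then show "\<exists>k\<in>D. f y < k y + \<delta>" using \<delta> by (intro bexI[of _ k]) (auto simp: D_def a_def)
    qed
    then obtain k where k: "k \<in> Kpos Y" "\<And>z. z \<in> topspace Y \<Longrightarrow> ennreal (k z) \<le> g z"
        "\<And>y. y \<in> C \<Longrightarrow> f y < k y + \<delta>" unfolding D_def by blast
    define h where "h = (\<lambda>y. k y + \<delta> * u y)"
    have h: "h \<in> Kpos Y" unfolding h_def using k u \<delta> by (intro Kpos_add Kpos_scale) auto
    have Fh: "F y \<le> h y" for y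
    proof (cases "y \<in> C")
      case True
      have "\<delta> * 1 \<le> \<delta> * u y" using \<delta> u(2)[OF True] by (intro mult_left_mono) auto
      then show ?thesis using k(3)[OF True] FC[OF True] by (simp add: h_def)
    next
      case False then show ?thesis using FnC Kpos_nonneg[OF h] by simp
    qed
    have "A h \<le> A k + A (\<lambda>y. \<delta> * u y)"
      unfolding h_def using k u \<delta> by (intro abs_measure_add_le Kpos_scale) auto
    also have "\<dots> \<le> U g + ennreal e"
    proof (rule add_mono)
      show "A k \<le> U g" using k by (intro upper_integral_lsc_ge)
      have "A (\<lambda>y. \<delta> * u y) \<le> ennreal \<delta> * A u" using \<delta> by (intro abs_measure_scale_le)
      also have "\<dots> \<le> ennreal e" using \<delta> r by (simp add: ennreal_leI flip: ennreal_mult)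
      finally show "A (\<lambda>y. \<delta> * u y) \<le> ennreal e" .
    qed
    also have "\<dots> \<le> N (\<lambda>y. ennreal (F y)) + ennreal e + ennreal e"
      using g(3) by (intro add_right_mono) simp
    finally have Ah: "A h \<le> N (\<lambda>y. ennreal (F y)) + (ennreal e + ennreal e)" by (simp add: ac_simps)
    \<comment> \<open>The function is h - f on \<open>C\<close> and \<open>h\<close> elsewhere. The
      set where it exceeds c is the set where \<open>h\<close> exceeds c, minus the closed part of
      \<open>C\<close> where h - f \<le> c; since f \<ge> 0 on \<open>C\<close>, no point is
      lost.\<close>
    define w where "w y = ennreal (h y - F y)" for y
    have lsc: "lsc_on Y w"
      unfolding lsc_on_def
    proof
      fix a :: ennreal
      show "openin Y {y \<in> topspace Y. a < w y}"
      proof (cases a)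
        case (real c)
        let ?S = "{y \<in> topspace (subtopology Y C). h y - f y \<in> {..c}}"
        have "closedin (subtopology Y C) ?S"
          by (rule closedin_continuous_map_preimage[OF continuous_map_diff[OF continuous_map_from_subtopology[OF Kpos_cont[OF h]] f]]) auto
        moreover have "closedin Y C" using compactin_imp_closedin[OF Hausdorff C] .
        ultimately have "closedin Y ?S" using closedin_trans_full by blast
        moreover have "openin Y {y \<in> topspace Y. h y \<in> {c<..}}"
          using Kpos_cont[OF h] by (rule openin_continuous_map_preimage) auto
        ultimately have "openin Y ({y \<in> topspace Y. h y \<in> {c<..}} - ?S)" by (rule openin_diff[rotated])
        moreover have "{y \<in> topspace Y. h y \<in> {c<..}} - ?S = {y \<in> topspace Y. a < w y}"
        proof (rule set_eqI)
          fix y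
          show "y \<in> {y \<in> topspace Y. h y \<in> {c<..}} - ?S \<longleftrightarrow> y \<in> {y \<in> topspace Y. a < w y}"
            by (cases "y \<in> C") (use real CY nonneg[of y] FC[of y] FnC[of y] in \<open>auto simp: w_def ennreal_less_iff\<close>)
        qed
        ultimately show ?thesis by simp
      qed simp
    qed
    \<comment> \<open>For k' below h - F, the function \<open>F\<close> lies below h - k', so
      superadditivity gives A(k') + N(F) \<le> A(h) \<le> N(F) + 2e. Finiteness of N(F) permits its
      cancellation.\<close>
    have "U w \<le> ennreal e + ennreal e"
      unfolding upper_integral_lsc_def
    proof (rule SUP_least)
      fix k' assume "k' \<in> {k' \<in> Kpos Y. \<forall>y\<in>topspace Y. ennreal (k' y) \<le> w y}"
      then have k': "k' \<in> Kpos Y" and k'w: "\<And>y. y \<in> topspace Y \<Longrightarrow> ennreal (k' y) \<le> w y" by auto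
      have k'le: "k' y \<le> h y - F y" if "y \<in> topspace Y" for y
        using k'w[OF that] Fh[of y] by (simp add: w_def)
      let ?m = "\<lambda>y. max 0 (h y - k' y)"
      have m: "?m \<in> Kpos Y" using h k' by (rule Kpos_diff)
      have "N (\<lambda>y. ennreal (F y)) \<le> N (\<lambda>y. ennreal (?m y))"
        using k'le by (intro upper_integral_mono ennreal_leI) force
      then have Nm: "N (\<lambda>y. ennreal (F y)) \<le> A ?m" using upper_integral_Kpos[OF m] by simp
      have "A k' + N (\<lambda>y. ennreal (F y)) \<le> A k' + A ?m" using Nm by (rule add_left_mono)
      also have "\<dots> \<le> A (\<lambda>y. k' y + ?m y)" using k' m by (rule abs_measure_add_ge)
      also have "\<dots> \<le> A h"
      proof (rule abs_measure_mono)
        show "k' y + ?m y \<le> h y" for y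
          using k'le[of y] F0[of y] Kpos_outside[OF k', of y] Kpos_outside[OF h, of y]
          by (cases "y \<in> topspace Y") auto
      qed
      also note Ah
      finally have "N (\<lambda>y. ennreal (F y)) + A k' \<le> N (\<lambda>y. ennreal (F y)) + (ennreal e + ennreal e)"
        by (simp add: ac_simps)
      then show "A k' \<le> ennreal e + ennreal e" using fin by (auto simp: ennreal_add_left_cancel_le)
    qed
    moreover have "R (\<lambda>y. \<bar>F y - h y\<bar>) \<le> U w"
      using Fh by (intro order_trans[OF ess_upper_le_upper] upper_integral_le lsc) (simp add: w_def)
    ultimately have "R (\<lambda>y. \<bar>F y - h y\<bar>) < ennreal \<epsilon>" using e(2) by (meson le_less_trans order_trans)
    with h show "\<exists>k\<in>Kpos Y. R (\<lambda>y. \<bar>F y - k y\<bar>) < ennreal \<epsilon>" by blast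
  qed
  then show ?thesis by (simp add: F_def)
qed

text \<open>On \<open>S\<close> a series of infinitely many copies of the indicator is infinite and
  so dominates any real function; countable subadditivity gives it integral 0.\<close>

lemma null_set_R:
  assumes "N (indicator S) = 0" shows "R (\<lambda>y. f y * indicator S y) = 0"
proof -
  have "ennreal (f y * indicator S y) \<le> (\<Sum>i::nat. indicator S y)" for y
  proof (cases "y \<in> S")
    case True
    obtain n :: nat where n: "f y \<le> real n" using real_arch_simple by blast
    have "ennreal (f y) \<le> of_nat n" using n by (metis ennreal_leI ennreal_of_nat_eq_real_of_nat)
    also have "\<dots> = (\<Sum>i<n. 1 :: ennreal)" by simp
    also have "\<dots> \<le> (\<Sum>i::nat. 1)" by (intro sum_le_suminf) auto
    finally show ?thesis using True by simp
  qed simp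
  then have "R (\<lambda>y. f y * indicator S y) \<le> E (\<lambda>y. \<Sum>i::nat. indicator S y)" by (rule ess_upper_mono)
  also have "\<dots> \<le> (\<Sum>i::nat. E (indicator S))" by (rule ess_upper_suminf)
  also have "E (indicator S) = 0" using ess_upper_le_upper[of "indicator S"] assms by simp
  finally show ?thesis by simp
qed

text \<open>On a compact set, \<open>f\<close> is up to a null set the increasing limit of its
  restrictions to finite unions of the pieces \<open>C n\<close>. Globally, finiteness of
  \<open>R f\<close> allows a compact \<open>K\<close> that carries nearly all of the
  integral.\<close>

theorem measurable_L1pos:
  fixes f :: "'y \<Rightarrow> real"
  assumes nonneg: "\<And>y. y \<in> topspace Y \<Longrightarrow> 0 \<le> f y" and fin: "R f < \<infinity>"
    and meas: "\<And>K. compactin Y K \<Longrightarrow> \<exists>S C. S \<subseteq> K \<and> N (indicator S) = 0 \<and>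
      (\<forall>n::nat. compactin Y (C n)) \<and> disjoint_family C \<and> K - S = (\<Union>n. C n) \<and>
      (\<forall>n. continuous_map (subtopology Y (C n)) euclideanreal f)"
  shows "f \<in> L1pos"
proof -
  have f_le: "R (\<lambda>y. f y * indicator S y) \<le> R f" for S
    using nonneg by (intro R_mono) (auto simp: indicator_def)
  have restr: "(\<lambda>y. f y * indicator K y) \<in> L1pos" if K: "compactin Y K" for K
  proof -
    obtain S C where S: "S \<subseteq> K" "N (indicator S) = 0" and C: "\<And>n::nat. compactin Y (C n)" "disjoint_family C"
      and KS: "K - S = (\<Union>n. C n)" and cont: "\<And>n. continuous_map (subtopology Y (C n)) euclideanreal f"
      using meas[OF K] by blast
    define g where "g y = f y * indicator (K - S) y" for y
    have d: "(\<lambda>y. f y * indicator (C n) y) \<in> L1pos" for n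
      using nonneg compactin_subset_topspace[OF C(1)[of n]] by (intro continuous_on_compact_L1pos C cont) auto
    have g: "g \<in> L1pos"
    proof (rule L1pos_monotone_limit)
      show "(\<lambda>y. \<Sum>i<n. f y * indicator (C i) y) \<in> L1pos" for n
        using L1pos_sum[of "\<lambda>i y. f y * indicator (C i) y" n, OF d] by simp
      fix y assume y: "y \<in> topspace Y"
      show "(\<Sum>i<n. f y * indicator (C i) y) \<le> (\<Sum>i<Suc n. f y * indicator (C i) y)" for n
        using nonneg[OF y] by (simp add: indicator_def)
      have "(\<lambda>i. indicator (C i) y :: real) sums indicator (\<Union>i. C i) y"
        using C(2) by (intro indicator_sums) (auto simp: disjoint_family_on_def)
      from sums_mult[OF this, of "f y"]
      show "(\<lambda>n. \<Sum>i<n. f y * indicator (C i) y) \<longlonglongrightarrow> g y"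
        unfolding sums_def g_def KS .
    next
      show "R g < \<infinity>" unfolding g_def using f_le[of "K - S"] fin by (meson le_less_trans)
    qed
    show ?thesis
    proof (rule L1pos_closed)
      show "0 \<le> f y * indicator K y" if "y \<in> topspace Y" for y using nonneg[OF that] by simp
      fix \<epsilon> :: real assume \<epsilon>: "0 < \<epsilon>"
      have "R (\<lambda>y. \<bar>f y * indicator K y - g y\<bar>) \<le> R (\<lambda>y. f y * indicator S y)"
        using nonneg S(1) by (intro R_mono) (auto simp: g_def indicator_def)
      also have "\<dots> < ennreal \<epsilon>" using null_set_R[OF S(2)] \<epsilon> by simp
      finally show "\<exists>g\<in>L1pos. R (\<lambda>y. \<bar>f y * indicator K y - g y\<bar>) < ennreal \<epsilon>" using g by blast
    qed
  qed
  show ?thesis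
  proof (rule L1pos_closed[OF nonneg])
    fix \<epsilon>' :: real assume \<epsilon>': "0 < \<epsilon>'"
    define \<epsilon> where "\<epsilon> = \<epsilon>'/2"
    have \<epsilon>: "0 < \<epsilon>" "ennreal \<epsilon> < ennreal \<epsilon>'" using \<epsilon>' by (auto simp: \<epsilon>_def ennreal_less_iff)
    \<comment> \<open>The essential upper integral is a supremum over compact sets, so one of them
      nearly attains it.\<close>
    have "\<exists>K\<in>{K. compactin Y K}. R f < N (\<lambda>y. ennreal (f y) * indicator K y) + ennreal \<epsilon>"
    proof (rule SUP_approx_ennreal)
      show "R f = (SUP K\<in>{K. compactin Y K}. N (\<lambda>y. ennreal (f y) * indicator K y))"
        by (simp add: ess_upper_integral_def)
    qed (use \<epsilon> fin in auto)
    then obtain K where K: "compactin Y K" "R f < N (\<lambda>y. ennreal (f y) * indicator K y) + ennreal \<epsilon>" by blast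
    let ?g = "\<lambda>y. f y * indicator K y"
    have Rg: "R f \<le> R ?g + ennreal \<epsilon>"
    proof -
      have "N (\<lambda>y. ennreal (f y) * indicator K y) = N (\<lambda>y. ennreal (?g y) * indicator K y)"
        by (intro arg_cong[of _ _ N]) (auto simp: indicator_def)
      also have "\<dots> \<le> R ?g" by (rule ess_upper_ge[OF K(1)])
      finally have "N (\<lambda>y. ennreal (f y) * indicator K y) + ennreal \<epsilon> \<le> R ?g + ennreal \<epsilon>" by (rule add_right_mono)
      with K(2) show ?thesis by (meson less_imp_le less_le_trans)
    qed
    have "R (\<lambda>y. \<bar>f y - ?g y\<bar>) \<le> ennreal \<epsilon>"
    proof (rule ess_upper_leI)
      fix K' assume K': "compactin Y K'"
      \<comment> \<open>This is \<open>f\<close> on the part of K' outside \<open>K\<close>. By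
        additivity on K \<union> K' its integral fits into what \<open>K\<close> has left over,
        uniformly in K'.\<close>
      let ?v = "\<lambda>y. f y * indicator (K \<union> K') y - ?g y"
      have v: "?v \<in> L1pos"
        using nonneg by (intro L1pos_diff restr compactin_Un K K') (auto simp: indicator_def)
      have "R (\<lambda>y. ?g y + ?v y) = R ?g + R ?v" by (rule L1pos_additive[OF restr[OF K(1)] v])
      moreover have "R (\<lambda>y. ?g y + ?v y) \<le> R f" using f_le[of "K \<union> K'"] by simp
      ultimately have "R ?g + R ?v \<le> R f" by (simp only:)
      then have "R ?g + R ?v \<le> R ?g + ennreal \<epsilon>" using Rg by (rule order_trans)
      then have "R ?v \<le> ennreal \<epsilon>" using L1pos_finite[OF restr[OF K(1)]] by (auto simp: ennreal_add_left_cancel_le)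
      moreover have "N (\<lambda>y. ennreal \<bar>f y - ?g y\<bar> * indicator K' y) \<le> N (\<lambda>y. ennreal (?v y) * indicator K' y)"
        using nonneg by (intro upper_integral_mono) (auto simp: indicator_def)
      moreover have "\<dots> \<le> R ?v" by (rule ess_upper_ge[OF K'])
      ultimately show "N (\<lambda>y. ennreal \<bar>f y - ?g y\<bar> * indicator K' y) \<le> ennreal \<epsilon>"
        by (meson order_trans)
    qed
    also note \<epsilon>(2)
    finally show "\<exists>g\<in>L1pos. R (\<lambda>y. \<bar>f y - g y\<bar>) < ennreal \<epsilon>'"
      by (rule bexI[OF _ restr[OF K(1)]])
  qed
qed

section \<open>The integral of complex functions\<close>

lemma mu_le_ess_upper: "g \<in> Kspace Y \<Longrightarrow> ennreal (cmod (\<mu> g)) \<le> R (\<lambda>y. cmod (g y))"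
  unfolding ess_upper_Kpos[OF Kspace_norm] by (rule abs_measure_ge) auto

lemma mu_diff_le:
  assumes "g \<in> Kspace Y" "g' \<in> Kspace Y"
  shows "ennreal (cmod (\<mu> g - \<mu> g')) \<le> R (\<lambda>y. cmod (f y - g y)) + R (\<lambda>y. cmod (f' y - g' y)) + R (\<lambda>y. cmod (f y - f' y))"
proof -
  have "ennreal (cmod (\<mu> g - \<mu> g')) \<le> R (\<lambda>y. cmod (g y - g' y))"
    using mu_le_ess_upper[OF Kspace_diff[OF assms]] mu_diff[OF assms] by simp
  also have "\<dots> \<le> R (\<lambda>y. cmod (f y - g y) + cmod (f' y - g' y)) + R (\<lambda>y. cmod (f y - f' y))"
  proof (rule R_le_add)
    fix y
    have "g y - g' y = (f' y - g' y) - (f y - g y) + (f y - f' y)" by simp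
    then show "cmod (g y - g' y) \<le> cmod (f y - g y) + cmod (f' y - g' y) + cmod (f y - f' y)"
      by (metis (no_types, lifting) add.commute add_right_mono norm_triangle_ineq4 norm_triangle_mono order_refl)
  qed auto
  also have "\<dots> \<le> R (\<lambda>y. cmod (f y - g y)) + R (\<lambda>y. cmod (f' y - g' y)) + R (\<lambda>y. cmod (f y - f' y))"
    by (intro add_right_mono R_le_add) auto
  finally show ?thesis .
qed

text \<open>The predicate under the definite description in \<open>ess_integral\<close>, isolated so
  that existence and uniqueness can be proved for it.\<close>

definition has_ess_integral :: "('y \<Rightarrow> complex) \<Rightarrow> complex \<Rightarrow> bool" where
  "has_ess_integral f I \<longleftrightarrow> (\<forall>\<epsilon>>0. \<exists>g\<in>Kspace Y. R (\<lambda>y. cmod (f y - g y)) < ennreal \<epsilon> \<and> cmod (I - \<mu> g) < \<epsilon>)"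

text \<open>Two integrals are compared through approximants in \<open>Kspace Y\<close>, where \<mu>
  is linear; no integral of f - f' has to be formed. The case f = f' is uniqueness.\<close>

lemma has_ess_integral_diff_bound:
  assumes f: "has_ess_integral f I" and f': "has_ess_integral f' I'"
  shows "ennreal (cmod (I - I')) \<le> R (\<lambda>y. cmod (f y - f' y))"
proof (rule ennreal_le_epsilon)
  fix \<epsilon> :: real assume \<epsilon>: "0 < \<epsilon>"
  define e where "e = \<epsilon>/4"
  have e: "0 < e" "ennreal \<epsilon> = ennreal e + ennreal e + (ennreal e + ennreal e)"
    using \<epsilon> by (auto simp: e_def simp flip: ennreal_plus)
  obtain g where g: "g \<in> Kspace Y" "R (\<lambda>y. cmod (f y - g y)) < ennreal e" "cmod (I - \<mu> g) < e"
    using f e(1) unfolding has_ess_integral_def by blast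
  obtain g' where g': "g' \<in> Kspace Y" "R (\<lambda>y. cmod (f' y - g' y)) < ennreal e" "cmod (I' - \<mu> g') < e"
    using f' e(1) unfolding has_ess_integral_def by blast
  have "I - I' = (I - \<mu> g) - (I' - \<mu> g') + (\<mu> g - \<mu> g')" by simp
  then have "cmod (I - I') \<le> cmod (I - \<mu> g) + cmod (I' - \<mu> g') + cmod (\<mu> g - \<mu> g')"
    by (metis (no_types, lifting) add_right_mono norm_triangle_ineq norm_triangle_ineq4 order_trans)
  also have "\<dots> \<le> e + e + cmod (\<mu> g - \<mu> g')" using g g' by simp
  finally have "ennreal (cmod (I - I')) \<le> ennreal e + ennreal e + ennreal (cmod (\<mu> g - \<mu> g'))"
    using e(1) by (simp add: ennreal_leI flip: ennreal_plus)
  also have "\<dots> \<le> ennreal e + ennreal e + (ennreal e + ennreal e + R (\<lambda>y. cmod (f y - f' y)))"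
    by (intro add_left_mono order_trans[OF mu_diff_le[OF g(1) g'(1), of f f']] add_mono order_refl less_imp_le g g')
  finally show "ennreal (cmod (I - I')) \<le> R (\<lambda>y. cmod (f y - f' y)) + ennreal \<epsilon>"
    unfolding e(2) by (simp add: ac_simps)
qed

lemma has_ess_integral_unique:
  assumes "has_ess_integral f I" "has_ess_integral f I'" shows "I = I'"
  using has_ess_integral_diff_bound[OF assms] by (simp add: ess_upper_zero)

text \<open>Approximants with error below 1/(n+1) have a Cauchy sequence of \<mu>-values, whose
  limit is the integral.\<close>

lemma has_ess_integral_exists:
  assumes "ess_integrable Y \<mu> f" shows "\<exists>I. has_ess_integral f I"
proof -
  have "\<exists>g\<in>Kspace Y. R (\<lambda>y. cmod (f y - g y)) < ennreal (1 / Suc n)" for n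
    using assms unfolding ess_integrable_def by simp
  then obtain g where g: "\<And>n. g n \<in> Kspace Y" "\<And>n. R (\<lambda>y. cmod (f y - g n y)) < ennreal (1 / Suc n)" by metis
  have dist: "cmod (\<mu> (g m) - \<mu> (g n)) \<le> 1 / Suc m + 1 / Suc n" for m n
  proof -
    have "ennreal (cmod (\<mu> (g m) - \<mu> (g n))) \<le> R (\<lambda>y. cmod (f y - g m y)) + R (\<lambda>y. cmod (f y - g n y)) + R (\<lambda>y. cmod (f y - f y))"
      by (rule mu_diff_le[OF g(1) g(1)])
    also have "\<dots> \<le> ennreal (1 / Suc m) + ennreal (1 / Suc n) + 0"
      using less_imp_le[OF g(2)] by (intro add_mono) (auto simp: ess_upper_zero)
    also have "\<dots> = ennreal (1 / Suc m + 1 / Suc n)" by (simp flip: ennreal_plus)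
    finally show ?thesis by (subst (asm) ennreal_le_iff) auto
  qed
  have "Cauchy (\<lambda>n. \<mu> (g n))"
  proof (rule CauchyI)
    fix e :: real assume e: "0 < e"
    then obtain M where M: "1 / Suc M < e/2" using nat_approx_posE[of "e/2"] by auto
    have "norm (\<mu> (g m) - \<mu> (g n)) < e" if "M \<le> m" "M \<le> n" for m n
    proof -
      have "1 / Suc m \<le> 1 / Suc M" "1 / Suc n \<le> 1 / Suc M" using that by (auto simp: field_simps)
      then show ?thesis using dist[of m n] M by simp
    qed
    then show "\<exists>M. \<forall>m\<ge>M. \<forall>n\<ge>M. norm (\<mu> (g m) - \<mu> (g n)) < e" by blast
  qed
  then obtain I where I: "(\<lambda>n. \<mu> (g n)) \<longlonglongrightarrow> I" using Cauchy_convergent convergent_def by blast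
  have "has_ess_integral f I"
    unfolding has_ess_integral_def
  proof (intro allI impI)
    fix \<epsilon> :: real assume \<epsilon>: "0 < \<epsilon>"
    obtain M where M: "1 / Suc M < \<epsilon>" using nat_approx_posE[OF \<epsilon>] by auto
    obtain M' where M': "\<And>n. M' \<le> n \<Longrightarrow> norm (\<mu> (g n) - I) < \<epsilon>" using LIMSEQ_D[OF I \<epsilon>] by blast
    define n where "n = max M M'"
    have "1 / Suc n \<le> 1 / Suc M" by (auto simp: field_simps n_def)
    then have "ennreal (1 / Suc n) < ennreal \<epsilon>" using M \<epsilon> by (intro ennreal_lessI) auto
    then have "R (\<lambda>y. cmod (f y - g n y)) < ennreal \<epsilon>" using g(2)[of n] by (rule less_trans[rotated])
    moreover have "cmod (I - \<mu> (g n)) < \<epsilon>" using M'[of n] by (simp add: n_def norm_minus_commute)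
    ultimately show "\<exists>g\<in>Kspace Y. R (\<lambda>y. cmod (f y - g y)) < ennreal \<epsilon> \<and> cmod (I - \<mu> g) < \<epsilon>" using g(1) by blast
  qed
  then show ?thesis by blast
qed

lemma has_ess_integral:
  assumes "ess_integrable Y \<mu> f" shows "has_ess_integral f (ess_integral Y \<mu> f)"
proof -
  obtain I where I: "has_ess_integral f I" using has_ess_integral_exists[OF assms] by blast
  have "ess_integral Y \<mu> f = (THE I. has_ess_integral f I)"
    unfolding ess_integral_def has_ess_integral_def ..
  also have "\<dots> = I" using I has_ess_integral_unique by blast
  finally show ?thesis using I by simp
qed

theorem ess_integral_diff_bound:
  assumes "ess_integrable Y \<mu> f" "ess_integrable Y \<mu> f'"
  shows "ennreal (cmod (ess_integral Y \<mu> f - ess_integral Y \<mu> f')) \<le> R (\<lambda>y. cmod (f y - f' y))"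
  using assms by (intro has_ess_integral_diff_bound has_ess_integral)

theorem ess_integral_bound:
  assumes "ess_integrable Y \<mu> f"
  shows "ennreal (cmod (ess_integral Y \<mu> f)) \<le> R (\<lambda>y. cmod (f y))"
proof -
  have "(\<lambda>y. 0) \<in> Kspace Y" "\<mu> (\<lambda>y. 0) = 0"
    using mu_scale[of "\<lambda>y. 0" 0] Kpos_zero[of Y] by (simp_all add: Kpos_def)
  then have "has_ess_integral (\<lambda>y. 0) 0"
    unfolding has_ess_integral_def by (auto intro!: bexI[of _ "\<lambda>y. 0"] simp: ess_upper_zero)
  from has_ess_integral_diff_bound[OF has_ess_integral[OF assms] this] show ?thesis by simp
qed

end

section \<open>Weak integrals in the stalks of a bundle\<close>

context complex_carrier_space begin

context
  fixes p assumes p: "seminorm_on S add sc p"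
begin

lemma seminorm_nonneg: "a \<in> S \<Longrightarrow> 0 \<le> p a"
  using p by (simp add: seminorm_on_def)

lemma seminorm_diff_commute: "a \<in> S \<Longrightarrow> b \<in> S \<Longrightarrow> p (diff a b) = p (diff b a)"
  using p scale_minus_diff[of a b] unfolding seminorm_on_def
  by (metis add_closed mult_1 norm_minus_cancel norm_one scale_closed)

lemma seminorm_diff_self: "a \<in> S \<Longrightarrow> p (diff a a) = 0"
  using p by (simp add: seminorm_on_def add_minus)

lemma seminorm_diff_triangle:
  "a \<in> S \<Longrightarrow> b \<in> S \<Longrightarrow> c \<in> S \<Longrightarrow> p (diff a c) \<le> p (diff a b) + p (diff b c)"
  using p diff_chain[of a b c] unfolding seminorm_on_def by (metis add_closed scale_closed)

lemma seminorm_diff_le: "a \<in> S \<Longrightarrow> b \<in> S \<Longrightarrow> p (diff a b) \<le> p a + p b"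
  using p unfolding seminorm_on_def
  by (metis mult_1 norm_minus_cancel norm_one scale_closed)

lemma seminorm_abs_diff: "a \<in> S \<Longrightarrow> b \<in> S \<Longrightarrow> \<bar>p a - p b\<bar> \<le> p (diff a b)"
proof -
  assume ab: "a \<in> S" "b \<in> S"
  have "p c \<le> p (diff c d) + p d" if "c \<in> S" "d \<in> S" for c d
    using p that diff_add_cancel[of c d] unfolding seminorm_on_def by (metis add_closed scale_closed)
  from this[OF ab] this[OF ab(2,1)] show ?thesis using seminorm_diff_commute[OF ab] by simp
qed

end

end

locale omega_space_bundle =
  fixes B :: "('x, 'e, 'j) obundle"
  assumes omega: "omega_bundle B"
begin

lemma stalk_space: "x \<in> topspace (base_top B) \<Longrightarrow> complex_carrier_space (stalk B x) (badd B) (bscale B)"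
  and seminorm: "x \<in> topspace (base_top B) \<Longrightarrow> j \<in> bindex B \<Longrightarrow> seminorm_on (stalk B x) (badd B) (bscale B) (bnu B j)"
  and stalk_top_eq: "x \<in> topspace (base_top B) \<Longrightarrow> stalk_top B x =
          topology_generated_by
            {{b \<in> stalk B x. bnu B j (bdiff B b a) < \<epsilon>} | a j \<epsilon>.
               a \<in> stalk B x \<and> j \<in> bindex B \<and> 0 < \<epsilon>}"
  and stalk_Hausdorff: "x \<in> topspace (base_top B) \<Longrightarrow> Hausdorff_space (stalk_top B x)"
  and open_tubes: "openin (tot_top B) = arbitrary union_of (\<lambda>S. S \<in> tubes B)"
  using omega unfolding omega_bundle_def complex_carrier_space_def by blast+

lemma stalk_subset: "stalk B x \<subseteq> topspace (tot_top B)"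
  by (auto simp: stalk_def)

lemma topspace_stalk_top [simp]: "topspace (stalk_top B x) = stalk B x"
  unfolding stalk_top_def using stalk_subset by auto

lemma tube_open: "T \<in> tubes B \<Longrightarrow> openin (tot_top B) T"
  unfolding open_tubes by (simp add: arbitrary_union_of_inc)

lemma open_contains_tube:
  assumes "openin (tot_top B) W" "e \<in> W"
  shows "\<exists>T\<in>tubes B. e \<in> T \<and> T \<subseteq> W"
  using assms unfolding open_tubes by (auto simp: union_of_def)

context
  fixes x assumes x: "x \<in> topspace (base_top B)"
begin

interpretation complex_carrier_space "stalk B x" "badd B" "bscale B"
  by (rule stalk_space[OF x])

lemma bdiff_closed: "a \<in> stalk B x \<Longrightarrow> b \<in> stalk B x \<Longrightarrow> bdiff B a b \<in> stalk B x"
  by (simp add: bdiff_def)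

lemmas nu_nonneg = seminorm_nonneg[OF seminorm[OF x]]
lemmas nu_diff_self = seminorm_diff_self[OF seminorm[OF x], folded bdiff_def]
lemmas nu_diff_triangle = seminorm_diff_triangle[OF seminorm[OF x], folded bdiff_def]
lemmas nu_diff_commute = seminorm_diff_commute[OF seminorm[OF x], folded bdiff_def]
lemmas nu_diff_le = seminorm_diff_le[OF seminorm[OF x], folded bdiff_def]
lemmas nu_abs_diff = seminorm_abs_diff[OF seminorm[OF x], folded bdiff_def]

text \<open>The semiballs of one seminorm generate enough open sets. Metric values let it serve both
  the seminorms and the complex functionals.\<close>

lemma stalk_continuous_if_lipschitz:
  fixes \<psi> :: "'e \<Rightarrow> 'c::metric_space"
  assumes j: "j \<in> bindex B"
    and lip: "\<And>a b. a \<in> stalk B x \<Longrightarrow> b \<in> stalk B x \<Longrightarrow> dist (\<psi> a) (\<psi> b) \<le> bnu B j (bdiff B a b)"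
  shows "continuous_map (stalk_top B x) euclidean \<psi>"
  unfolding continuous_map_def
proof (intro conjI allI impI)
  fix W :: "'c set" assume W: "openin euclidean W"
  show "openin (stalk_top B x) {a \<in> topspace (stalk_top B x). \<psi> a \<in> W}"
  proof (subst openin_subopen, intro ballI)
    fix a assume "a \<in> {a \<in> topspace (stalk_top B x). \<psi> a \<in> W}"
    then have a: "a \<in> stalk B x" "\<psi> a \<in> W" by auto
    obtain e where e: "0 < e" "\<And>b. dist b (\<psi> a) < e \<Longrightarrow> b \<in> W"
      using W a(2) unfolding open_openin[symmetric] open_dist by blast
    let ?T = "{b \<in> stalk B x. bnu B j (bdiff B b a) < e}"
    have "openin (stalk_top B x) ?T"
      unfolding stalk_top_eq[OF x] using a j e by (intro topology_generated_by_Basis) blast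
    moreover have "a \<in> ?T" using a e nu_diff_self[OF j] by simp
    moreover have "?T \<subseteq> {a \<in> topspace (stalk_top B x). \<psi> a \<in> W}"
    proof
      fix b assume b: "b \<in> ?T"
      then have "dist (\<psi> b) (\<psi> a) < e" using lip[of b a] a by simp
      then show "b \<in> {a \<in> topspace (stalk_top B x). \<psi> a \<in> W}" using e(2) b by simp
    qed
    ultimately show "\<exists>T. openin (stalk_top B x) T \<and> a \<in> T \<and> T \<subseteq> {a \<in> topspace (stalk_top B x). \<psi> a \<in> W}" by blast
  qed
qed simp

lemma nu_continuous: "j \<in> bindex B \<Longrightarrow> continuous_map (stalk_top B x) euclideanreal (bnu B j)"
  using nu_abs_diff by (intro stalk_continuous_if_lipschitz) (auto simp: dist_real_def)

lemma norming_functional: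
  assumes j: "j \<in> bindex B" and e: "e \<in> stalk B x"
  obtains \<phi> where "\<phi> \<in> top_dual (stalk_top B x) (badd B) (bscale B)"
    "\<And>a b. a \<in> stalk B x \<Longrightarrow> b \<in> stalk B x \<Longrightarrow> \<phi> (bdiff B a b) = \<phi> a - \<phi> b"
    "\<And>a. a \<in> stalk B x \<Longrightarrow> cmod (\<phi> a) \<le> bnu B j a" "\<phi> e = complex_of_real (bnu B j e)"
proof -
  obtain \<phi> :: "'e \<Rightarrow> complex" where \<phi>: "\<And>a b. a \<in> stalk B x \<Longrightarrow> b \<in> stalk B x \<Longrightarrow> \<phi> (badd B a b) = \<phi> a + \<phi> b"
    "\<And>r a. a \<in> stalk B x \<Longrightarrow> \<phi> (bscale B r a) = r * \<phi> a"
    "\<And>a. a \<in> stalk B x \<Longrightarrow> cmod (\<phi> a) \<le> bnu B j a" "\<phi> e = complex_of_real (bnu B j e)"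
    using complex_Hahn_Banach[OF seminorm[OF x j] e] by blast
  have diff: "\<phi> (bdiff B a b) = \<phi> a - \<phi> b" if "a \<in> stalk B x" "b \<in> stalk B x" for a b
    using that \<phi>(1,2) by (simp add: bdiff_def)
  have "continuous_map (stalk_top B x) euclidean \<phi>"
  proof (rule stalk_continuous_if_lipschitz[OF j])
    fix a b assume "a \<in> stalk B x" "b \<in> stalk B x"
    then show "dist (\<phi> a) (\<phi> b) \<le> bnu B j (bdiff B a b)"
      using diff[of a b] \<phi>(3)[OF bdiff_closed[of a b]] by (simp add: dist_norm)
  qed
  then have "\<phi> \<in> top_dual (stalk_top B x) (badd B) (bscale B)" using \<phi> by (simp add: top_dual_def)
  then show thesis using that diff \<phi>(3,4) by blast
qed

text \<open>If no seminorm tells e' from e, then e' belongs to every open set that contains e,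
  against the Hausdorff property.\<close>

lemma stalk_separated:
  assumes "e \<in> stalk B x" "e' \<in> stalk B x" "\<And>j. j \<in> bindex B \<Longrightarrow> bnu B j (bdiff B e e') = 0"
  shows "e = e'"
proof (rule ccontr)
  assume "e \<noteq> e'"
  then obtain U V where U: "openin (stalk_top B x) U" "e \<in> U" "e' \<in> V" "disjnt U V"
    using stalk_Hausdorff[OF x] assms(1,2) unfolding Hausdorff_space_def topspace_stalk_top by blast
  \<comment> \<open>Induction over the generation of the topology: semiballs are handled by the
    triangle inequality, and finite intersections and unions preserve the property.\<close>
  have "e' \<in> W"
    if "generate_topology_on {{b \<in> stalk B x. bnu B j (bdiff B b a) < \<epsilon>} | a j \<epsilon>.
          a \<in> stalk B x \<and> j \<in> bindex B \<and> 0 < \<epsilon>} W" "e \<in> W" for W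
    using that
  proof (induction rule: generate_topology_on.induct)
    case (Basis s)
    then obtain a j \<epsilon> where s: "s = {b \<in> stalk B x. bnu B j (bdiff B b a) < \<epsilon>}" "a \<in> stalk B x" "j \<in> bindex B"
      by blast
    have "bnu B j (bdiff B e' a) \<le> bnu B j (bdiff B e' e) + bnu B j (bdiff B e a)"
      using s assms by (intro nu_diff_triangle)
    then show ?case using Basis(2) s assms nu_diff_commute[OF s(3), of e e'] by simp
  qed auto
  then have "e' \<in> U" using U(1,2) unfolding stalk_top_eq[OF x] openin_topology_generated_by_iff by blast
  with U show False by (auto simp: disjnt_def)
qed

end

end

lemma Meas_seminorm:
  assumes "omega_space_bundle B" "z \<in> topspace (base_top B)" "j \<in> bindex B" "f \<in> Meas Y \<mu> (stalk_top B z)" "compactin Y K"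
  shows "\<exists>S C. S \<subseteq> K \<and> upper_integral Y \<mu> (indicator S) = 0 \<and>
      (\<forall>n::nat. compactin Y (C n)) \<and> disjoint_family C \<and> K - S = (\<Union>n. C n) \<and>
      (\<forall>n. continuous_map (subtopology Y (C n)) euclideanreal (\<lambda>s. bnu B j (f s)))"
proof -
  obtain S C where SC: "S \<subseteq> K" "upper_integral Y \<mu> (indicator S) = 0"
      "\<forall>n::nat. compactin Y (C n)" "disjoint_family C" "K - S = (\<Union>n. C n)"
      and cont: "\<And>n. continuous_map (subtopology Y (C n)) (stalk_top B z) f"
    using assms(4,5) unfolding Meas_def by blast
  have "continuous_map (subtopology Y (C n)) euclideanreal (\<lambda>s. bnu B j (f s))" for n
    using continuous_map_compose[OF cont omega_space_bundle.nu_continuous[OF assms(1-3)]] by (simp add: comp_def)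
  with SC show ?thesis by blast
qed

text \<open>Finite intersections make the basis decreasing, so that points chosen one per stage
  eventually enter every neighbourhood.\<close>

lemma nested_nhds_basis:
  assumes "countable_nhds_basis_at X x" "x \<in> topspace X"
  obtains W :: "nat \<Rightarrow> 'x set" where "\<And>n. openin X (W n)" "\<And>n. x \<in> W n" "\<And>m n. m \<le> n \<Longrightarrow> W n \<subseteq> W m"
    "\<And>U. openin X U \<Longrightarrow> x \<in> U \<Longrightarrow> \<exists>n. W n \<subseteq> U"
proof -
  obtain \<B> where cB: "countable \<B>"
      and nB: "\<forall>V\<in>\<B>. V \<subseteq> topspace X \<and> (\<exists>W. openin X W \<and> x \<in> W \<and> W \<subseteq> V)"
      and bB: "\<forall>U. openin X U \<and> x \<in> U \<longrightarrow> (\<exists>V\<in>\<B>. V \<subseteq> U)"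
    using assms(1) unfolding countable_nhds_basis_at_def by (elim exE conjE)
  have B: "countable \<B>" "V \<in> \<B> \<Longrightarrow> \<exists>W. openin X W \<and> x \<in> W \<and> W \<subseteq> V"
      "openin X U \<Longrightarrow> x \<in> U \<Longrightarrow> \<exists>V\<in>\<B>. V \<subseteq> U" for U V
    using cB nB bB by simp_all
  have ne: "\<B> \<noteq> {}" using B(3)[of "topspace X"] assms(2) by auto
  have "\<exists>W. openin X W \<and> x \<in> W \<and> W \<subseteq> from_nat_into \<B> n" for n using B(2)[OF from_nat_into[OF ne]] .
  then obtain V where V: "\<And>n. openin X (V n)" "\<And>n. x \<in> V n" "\<And>n. V n \<subseteq> from_nat_into \<B> n" by metis
  show thesis
  proof (rule that[of "\<lambda>n. \<Inter>i\<le>n. V i"])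
    show "openin X (\<Inter>i\<le>n. V i)" for n using V(1) by (intro openin_INT2) auto
    show "x \<in> (\<Inter>i\<le>n. V i)" for n using V(2) by auto
    show "(\<Inter>i\<le>n. V i) \<subseteq> (\<Inter>i\<le>m. V i)" if "m \<le> n" for m n using that by force
    fix U assume "openin X U" "x \<in> U"
    then obtain Q where Q: "Q \<in> \<B>" "Q \<subseteq> U" using B(3) by blast
    obtain n where "from_nat_into \<B> n = Q" using from_nat_into_surj[OF B(1) Q(1)] by blast
    then show "\<exists>n. (\<Inter>i\<le>n. V i) \<subseteq> U" using V(3)[of n] Q(2) by (intro exI[of _ n]) auto
  qed
qed

locale radon_bundle = radon_space Y \<mu> + omega_space_bundle V
  for Y :: "'y topology" and \<mu> :: "('y \<Rightarrow> complex) \<Rightarrow> complex" and V :: "('x, 'e, 'j) obundle"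
begin

abbreviation L1_at :: "'x \<Rightarrow> ('y \<Rightarrow> 'e) set" where
  "L1_at z \<equiv> L1 Y \<mu> (stalk_top V z) (badd V) (bscale V)"

abbreviation wint :: "'x \<Rightarrow> ('y \<Rightarrow> 'e) \<Rightarrow> 'e" where
  "wint z \<equiv> weak_integral Y \<mu> (stalk_top V z) (badd V) (bscale V)"

context
  fixes z assumes z: "z \<in> topspace (base_top V)"
begin

text \<open>A norming functional of e - e' takes the same value at e and e', so every seminorm of
  the difference vanishes. This is what gives the definite description of the weak integral its
  meaning.\<close>

lemma weak_integral_unique:
  assumes "is_weak_integral Y \<mu> (stalk_top V z) (badd V) (bscale V) f e"
    "is_weak_integral Y \<mu> (stalk_top V z) (badd V) (bscale V) f e'"
  shows "e = e'"
proof (rule stalk_separated[OF z])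
  show e: "e \<in> stalk V z" "e' \<in> stalk V z" using assms by (auto simp: is_weak_integral_def)
  fix j assume j: "j \<in> bindex V"
  obtain \<phi> where \<phi>: "\<phi> \<in> top_dual (stalk_top V z) (badd V) (bscale V)"
    "\<And>a b. a \<in> stalk V z \<Longrightarrow> b \<in> stalk V z \<Longrightarrow> \<phi> (bdiff V a b) = \<phi> a - \<phi> b"
    "\<phi> (bdiff V e e') = complex_of_real (bnu V j (bdiff V e e'))"
    using norming_functional[OF z j bdiff_closed[OF z e]] by metis
  have "\<phi> e = ess_integral Y \<mu> (\<lambda>s. \<phi> (f s))" "\<phi> e' = ess_integral Y \<mu> (\<lambda>s. \<phi> (f s))"
    using assms \<phi>(1) unfolding is_weak_integral_def by blast+
  then have "\<phi> e = \<phi> e'" by simp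
  then show "bnu V j (bdiff V e e') = 0" using \<phi>(2)[OF e] \<phi>(3) by simp
qed

lemma weak_integral:
  assumes "f \<in> L1_at z" shows "is_weak_integral Y \<mu> (stalk_top V z) (badd V) (bscale V) f (wint z f)"
proof -
  obtain e where e: "is_weak_integral Y \<mu> (stalk_top V z) (badd V) (bscale V) f e"
    using assms by (auto simp: L1_def)
  then show ?thesis unfolding weak_integral_def by (rule theI) (rule weak_integral_unique[OF _ e])
qed

lemma weak_integral_stalk: "f \<in> L1_at z \<Longrightarrow> wint z f \<in> stalk V z"
  using weak_integral[of f] by (simp add: is_weak_integral_def)

lemma L1_stalk: "f \<in> L1_at z \<Longrightarrow> s \<in> topspace Y \<Longrightarrow> f s \<in> stalk V z"
  by (auto simp: L1_def)

lemma weak_integral_bound: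
  assumes f: "f \<in> L1_at z" and j: "j \<in> bindex V"
  shows "ennreal (bnu V j (wint z f)) \<le> R (\<lambda>s. bnu V j (f s))"
proof -
  have W: "wint z f \<in> stalk V z" by (rule weak_integral_stalk[OF f])
  obtain \<phi> where \<phi>: "\<phi> \<in> top_dual (stalk_top V z) (badd V) (bscale V)"
    "\<And>a. a \<in> stalk V z \<Longrightarrow> cmod (\<phi> a) \<le> bnu V j a" "\<phi> (wint z f) = complex_of_real (bnu V j (wint z f))"
    using norming_functional[OF z j W] by metis
  have "bnu V j (wint z f) = cmod (\<phi> (wint z f))" using \<phi>(3) nu_nonneg[OF z j W] by simp
  also have "\<phi> (wint z f) = ess_integral Y \<mu> (\<lambda>s. \<phi> (f s))"
    using weak_integral[OF f] \<phi>(1) by (simp add: is_weak_integral_def)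
  finally have "ennreal (bnu V j (wint z f)) \<le> R (\<lambda>s. cmod (\<phi> (f s)))"
    using ess_integral_bound[of "\<lambda>s. \<phi> (f s)"] f \<phi>(1) by (simp add: L1_def)
  also have "\<dots> \<le> R (\<lambda>s. bnu V j (f s))" using L1_stalk[OF f] \<phi>(2) by (intro R_mono) simp
  finally show ?thesis .
qed

text \<open>One functional that norms the difference of the two integrals turns the claim into
  \<open>ess_integral_diff_bound\<close>, so linearity of the weak integral is not invoked.\<close>

lemma weak_integral_diff_bound:
  assumes f: "f \<in> L1_at z" and g: "g \<in> L1_at z" and j: "j \<in> bindex V"
  shows "ennreal (bnu V j (bdiff V (wint z f) (wint z g))) \<le> R (\<lambda>s. bnu V j (bdiff V (f s) (g s)))"
proof -
  have W: "wint z f \<in> stalk V z" "wint z g \<in> stalk V z" using f g weak_integral_stalk by auto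
  obtain \<phi> where \<phi>: "\<phi> \<in> top_dual (stalk_top V z) (badd V) (bscale V)"
    "\<And>a b. a \<in> stalk V z \<Longrightarrow> b \<in> stalk V z \<Longrightarrow> \<phi> (bdiff V a b) = \<phi> a - \<phi> b"
    "\<And>a. a \<in> stalk V z \<Longrightarrow> cmod (\<phi> a) \<le> bnu V j a"
    "\<phi> (bdiff V (wint z f) (wint z g)) = complex_of_real (bnu V j (bdiff V (wint z f) (wint z g)))"
    using norming_functional[OF z j bdiff_closed[OF z W]] by metis
  have "bnu V j (bdiff V (wint z f) (wint z g)) = cmod (\<phi> (bdiff V (wint z f) (wint z g)))"
    unfolding \<phi>(4) using nu_nonneg[OF z j bdiff_closed[OF z W]] by simp
  also have "\<phi> (bdiff V (wint z f) (wint z g)) = \<phi> (wint z f) - \<phi> (wint z g)" by (rule \<phi>(2)[OF W])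
  also have "\<phi> (wint z f) = ess_integral Y \<mu> (\<lambda>s. \<phi> (f s))"
    using weak_integral[OF f] \<phi>(1) by (simp add: is_weak_integral_def)
  also have "\<phi> (wint z g) = ess_integral Y \<mu> (\<lambda>s. \<phi> (g s))"
    using weak_integral[OF g] \<phi>(1) by (simp add: is_weak_integral_def)
  finally have "ennreal (bnu V j (bdiff V (wint z f) (wint z g))) \<le> R (\<lambda>s. cmod (\<phi> (f s) - \<phi> (g s)))"
    using ess_integral_diff_bound[of "\<lambda>s. \<phi> (f s)" "\<lambda>s. \<phi> (g s)"] f g \<phi>(1) by (simp add: L1_def)
  also have "\<dots> \<le> R (\<lambda>s. bnu V j (bdiff V (f s) (g s)))"
  proof (rule R_mono)
    fix s assume "s \<in> topspace Y"
    then have "f s \<in> stalk V z" "g s \<in> stalk V z" using L1_stalk f g by auto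
    then show "cmod (\<phi> (f s) - \<phi> (g s)) \<le> bnu V j (bdiff V (f s) (g s))"
      using \<phi>(2,3) bdiff_closed[OF z] by metis
  qed
  finally show ?thesis .
qed

end

end

section \<open>Continuity of the integrated section\<close>

lemma Gamma_stalk: "\<sigma> \<in> Gamma_on B U \<Longrightarrow> z \<in> U \<Longrightarrow> \<sigma> z \<in> stalk B z"
  and Gamma_at_stalk: "\<sigma> \<in> Gamma_at_on B U x \<Longrightarrow> z \<in> U \<Longrightarrow> \<sigma> z \<in> stalk B z"
  by (auto simp: Gamma_on_def Gamma_at_on_def bounded_sections_def)

text \<open>A basic neighbourhood of the common value is a tube around some local section \<tau>
  unrelated to \<rho>. Continuity of \<rho> keeps \<rho>(z) in a narrower tube around \<tau>, and
  closeness of \<sigma> to \<rho> covers the remaining width.\<close>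

lemma (in omega_space_bundle) section_continuous_at:
  assumes \<sigma>: "\<sigma> \<in> (\<Pi> z\<in>topspace (base_top B). stalk B z)" and \<rho>: "\<rho> \<in> Gamma B"
    and x: "x \<in> topspace (base_top B)" and eq: "\<sigma> x = \<rho> x"
    and near: "\<And>j \<epsilon>. j \<in> bindex B \<Longrightarrow> 0 < \<epsilon> \<Longrightarrow>
      \<exists>W. openin (base_top B) W \<and> x \<in> W \<and> (\<forall>z\<in>W. bnu B j (bdiff B (\<sigma> z) (\<rho> z)) < \<epsilon>)"
  shows "topcontinuous_at (base_top B) (tot_top B) \<sigma> x"
  unfolding topcontinuous_at_def
proof (intro conjI allI impI)
  show "x \<in> topspace (base_top B)" by (rule x)
  show "\<sigma> \<in> topspace (base_top B) \<rightarrow> topspace (tot_top B)" using \<sigma> stalk_subset by blast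
  have \<rho>_stalk: "\<rho> z \<in> stalk B z" if "z \<in> topspace (base_top B)" for z
    by (rule Gamma_stalk[OF \<rho> that])
  have \<rho>_cont: "continuous_map (base_top B) (tot_top B) \<rho>"
    using \<rho> by (simp add: Gamma_on_def)
  fix O' assume "openin (tot_top B) O' \<and> \<sigma> x \<in> O'"
  then obtain T where T: "T \<in> tubes B" "\<rho> x \<in> T" "T \<subseteq> O'" using open_contains_tube eq by metis
  then obtain U \<tau> j \<epsilon> where U: "T = tube B U \<tau> j \<epsilon>" "openin (base_top B) U" "\<tau> \<in> Gamma_on B U" "j \<in> bindex B"
    unfolding tubes_def by blast
  have proj: "bproj B e = z" if "e \<in> stalk B z" for e z using that by (simp add: stalk_def)
  have "x \<in> U" "bnu B j (bdiff B (\<rho> x) (\<tau> x)) < \<epsilon>"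
    using T(2) U(1) proj[OF \<rho>_stalk[OF x]] by (auto simp: tube_def)
  define p where "p = bnu B j (bdiff B (\<rho> x) (\<tau> x))"
  have \<tau>_stalk: "\<tau> z \<in> stalk B z" if "z \<in> U" for z
    by (rule Gamma_stalk[OF U(3) that])
  have p: "0 \<le> p" "p < \<epsilon>"
    unfolding p_def using nu_nonneg[OF x U(4) bdiff_closed[OF x \<rho>_stalk[OF x] \<tau>_stalk[OF \<open>x \<in> U\<close>]]]
      \<open>bnu B j (bdiff B (\<rho> x) (\<tau> x)) < \<epsilon>\<close> by auto
  \<comment> \<open>Halfway between the distance of \<rho>(x) from \<tau>(x) and the radius:
    \<rho>(x) stays inside the narrower tube and \<epsilon> - \<epsilon>' is left for
    \<sigma>.\<close>
  define \<epsilon>' where "\<epsilon>' = (p + \<epsilon>) / 2"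
  have \<epsilon>': "p < \<epsilon>'" "\<epsilon>' < \<epsilon>" "0 < \<epsilon>'" using p by (auto simp: \<epsilon>'_def)
  have "tube B U \<tau> j \<epsilon>' \<in> tubes B" unfolding tubes_def using U \<epsilon>' by blast
  then have "openin (base_top B) {z \<in> topspace (base_top B). \<rho> z \<in> tube B U \<tau> j \<epsilon>'}"
    by (intro openin_continuous_map_preimage[OF \<rho>_cont] tube_open)
  moreover obtain W where W: "openin (base_top B) W" "x \<in> W" "\<And>z. z \<in> W \<Longrightarrow> bnu B j (bdiff B (\<sigma> z) (\<rho> z)) < \<epsilon> - \<epsilon>'"
    using near[OF U(4), of "\<epsilon> - \<epsilon>'"] \<epsilon>' by auto
  ultimately have "openin (base_top B) ({z \<in> topspace (base_top B). \<rho> z \<in> tube B U \<tau> j \<epsilon>'} \<inter> W)" by blast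
  moreover have "\<rho> x \<in> tube B U \<tau> j \<epsilon>'"
    using \<rho>_stalk[OF x] stalk_subset proj[OF \<rho>_stalk[OF x]] \<open>x \<in> U\<close> \<epsilon>' by (auto simp: tube_def p_def)
  moreover have "\<sigma> z \<in> O'" if z: "z \<in> topspace (base_top B)" "\<rho> z \<in> tube B U \<tau> j \<epsilon>'" "z \<in> W" for z
  proof -
    have zU: "z \<in> U" and lt: "bnu B j (bdiff B (\<rho> z) (\<tau> z)) < \<epsilon>'"
      using z(2) proj[OF \<rho>_stalk[OF z(1)]] by (auto simp: tube_def)
    have \<sigma>z: "\<sigma> z \<in> stalk B z" using \<sigma> z(1) by blast
    have "bnu B j (bdiff B (\<sigma> z) (\<tau> z)) \<le> bnu B j (bdiff B (\<sigma> z) (\<rho> z)) + bnu B j (bdiff B (\<rho> z) (\<tau> z))"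
      by (rule nu_diff_triangle[OF z(1) U(4) \<sigma>z \<rho>_stalk[OF z(1)] \<tau>_stalk[OF zU]])
    then have "bnu B j (bdiff B (\<sigma> z) (\<tau> z)) < \<epsilon>" using lt W(3)[OF z(3)] by simp
    then have "\<sigma> z \<in> T" using U(1) zU proj[OF \<sigma>z] \<sigma>z stalk_subset by (auto simp: tube_def)
    then show ?thesis using T(3) by blast
  qed
  ultimately show "\<exists>U. openin (base_top B) U \<and> x \<in> U \<and> (\<forall>y\<in>U. \<sigma> y \<in> O')"
    using x W(2) by (intro exI[of _ "{z \<in> topspace (base_top B). \<rho> z \<in> tube B U \<tau> j \<epsilon>'} \<inter> W"]) auto
qed

locale mu_related_bundles = radon_bundle Y \<mu> V
  for Y :: "'y topology" and \<mu> :: "('y \<Rightarrow> complex) \<Rightarrow> complex" and V :: "('x, 'e, 'j) obundle" +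
  fixes Z :: "('x, 'y \<Rightarrow> 'e, ('y \<times> 'j) set) obundle"
  assumes related: "mu_related Y \<mu> V Z"
begin

sublocale Z: omega_space_bundle Z
  using related by unfold_locales (simp add: mu_related_def)

abbreviation X :: "'x set" where "X \<equiv> topspace (base_top V)"

lemma base_eq: "base_top Z = base_top V"
  and bindex_Z: "bindex Z = {Q. finite Q \<and> Q \<subseteq> topspace Y \<times> bindex V}"
  and bnu_Z: "Q \<in> bindex Z \<Longrightarrow> f \<in> topspace (tot_top Z) \<Longrightarrow> bnu Z Q f = Max (insert 0 ((\<lambda>(s, j). bnu V j (f s)) ` Q))"
  using related by (simp_all add: mu_related_def)

lemma Gamma_ui: "F \<in> Gamma Z \<Longrightarrow> F \<in> ui V Y \<mu> (bounded_sections Z X)"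
  using related by (auto simp: mu_related_def)

lemma I_mu_Gamma: "F \<in> Gamma Z \<Longrightarrow> I_mu V Y \<mu> F \<in> Gamma V"
  using related by (auto simp: mu_related_def)

lemma stalk_Meas: "z \<in> X \<Longrightarrow> f \<in> stalk Z z \<Longrightarrow> f \<in> Meas Y \<mu> (stalk_top V z)"
  and stalk_L1: "z \<in> X \<Longrightarrow> f \<in> stalk Z z \<Longrightarrow> f \<in> L1_at z"
  and badd_Z: "z \<in> X \<Longrightarrow> f \<in> stalk Z z \<Longrightarrow> g \<in> stalk Z z \<Longrightarrow> badd Z f g = (\<lambda>s\<in>topspace Y. badd V (f s) (g s))"
  and bscale_Z: "z \<in> X \<Longrightarrow> f \<in> stalk Z z \<Longrightarrow> bscale Z r f = (\<lambda>s\<in>topspace Y. bscale V r (f s))"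
  using related unfolding mu_related_def by (simp_all add: subset_iff)

lemma bdiff_Z:
  assumes "z \<in> X" "f \<in> stalk Z z" "g \<in> stalk Z z" "s \<in> topspace Y"
  shows "bdiff Z f g s = bdiff V (f s) (g s)"
proof -
  interpret S: complex_carrier_space "stalk Z z" "badd Z" "bscale Z"
    by (rule Z.stalk_space) (simp add: base_eq assms(1))
  show ?thesis
    using badd_Z[OF assms(1,2) S.scale_closed[OF assms(3)]] bscale_Z[OF assms(1,3)] assms(4)
    by (simp add: bdiff_def)
qed

lemma pointwise_near:
  assumes x: "x \<in> X" and H: "H \<in> Gamma_at Z x" and F: "F \<in> Gamma Z" and eq: "H x = F x"
    and s: "s \<in> topspace Y" and j: "j \<in> bindex V" and \<epsilon>: "0 < \<epsilon>"
  shows "\<exists>W. openin (base_top V) W \<and> x \<in> W \<and> (\<forall>z\<in>W. bnu V j (bdiff V (H z s) (F z s)) < \<epsilon>)"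
proof -
  let ?Q = "{(s, j)}"
  have Q: "?Q \<in> bindex Z" using s j by (simp add: bindex_Z)
  have HS: "H z \<in> stalk Z z" if "z \<in> X" for z
    using Gamma_at_stalk[OF H] that by (simp add: base_eq)
  have FS: "F z \<in> stalk Z z" if "z \<in> X" for z
    using Gamma_stalk[OF F] that by (simp add: base_eq)
  have proj: "bproj Z e = z" if "e \<in> stalk Z z" for e z using that by (simp add: stalk_def)
  let ?T = "tube Z X F ?Q \<epsilon>"
  have "?T \<in> tubes Z" unfolding tubes_def using F Q \<epsilon> base_eq by (auto intro!: exI)
  then have T: "openin (tot_top Z) ?T" by (rule Z.tube_open)
  have xZ: "x \<in> topspace (base_top Z)" using x base_eq by simp
  have "H x \<in> ?T"
    using HS[OF x] Z.stalk_subset proj[OF HS[OF x]] x Z.nu_diff_self[OF xZ Q HS[OF x]] eq \<epsilon>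
    by (auto simp: tube_def)
  moreover have "topcontinuous_at (base_top V) (tot_top Z) H x"
    using H by (simp add: Gamma_at_on_def base_eq)
  ultimately have "\<exists>W. openin (base_top V) W \<and> x \<in> W \<and> (\<forall>z\<in>W. H z \<in> ?T)"
    using T by (simp add: topcontinuous_at_def)
  then obtain W where W: "openin (base_top V) W" "x \<in> W" "\<And>z. z \<in> W \<Longrightarrow> H z \<in> ?T" by blast
  have "bnu V j (bdiff V (H z s) (F z s)) < \<epsilon>" if z: "z \<in> W" for z
  proof -
    have zX: "z \<in> X" using W(1) z openin_subset by blast
    let ?g = "bdiff Z (H z) (F z)"
    have g: "?g \<in> stalk Z z" using Z.bdiff_closed[OF _ HS FS] zX base_eq by simp
    have "bnu Z ?Q ?g < \<epsilon>" using W(3)[OF z] proj[OF HS[OF zX]] by (simp add: tube_def)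
    moreover have "bnu Z ?Q ?g = Max {0, bnu V j (?g s)}"
      using bnu_Z[OF Q] g Z.stalk_subset by auto
    ultimately have "bnu V j (?g s) < \<epsilon>" by simp
    then show ?thesis using bdiff_Z[OF zX HS[OF zX] FS[OF zX] s] by simp
  qed
  with W show ?thesis by blast
qed

text \<open>If the claim fails, each set of a nested basis contains a point where the integrals
  differ by at least \<epsilon>, and it is enough to refute this at a single one of these points.
  The set \<open>UNIV\<close> in the hypothesis on \<open>H\<close> keeps only the integrability
  condition of \<open>ui\<close>.\<close>

theorem integral_near:
  assumes x: "x \<in> X" and basis: "countable_nhds_basis_at (base_top V) x"
    and H: "H \<in> Gamma_at Z x" and Hui: "H \<in> ui V Y \<mu> UNIV" and F: "F \<in> Gamma Z" and eq: "H x = F x"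
    and j: "j \<in> bindex V" and \<epsilon>: "0 < \<epsilon>"
  shows "\<exists>W. openin (base_top V) W \<and> x \<in> W \<and> (\<forall>z\<in>W. bnu V j (bdiff V (I_mu V Y \<mu> H z) (I_mu V Y \<mu> F z)) < \<epsilon>)"
proof (rule ccontr)
  assume contra: "\<not> ?thesis"
  obtain W where W: "\<And>n. openin (base_top V) (W n)" "\<And>n. x \<in> W n" "\<And>m n. m \<le> n \<Longrightarrow> W n \<subseteq> W m"
    "\<And>U. openin (base_top V) U \<Longrightarrow> x \<in> U \<Longrightarrow> \<exists>n::nat. W n \<subseteq> U"
    using nested_nhds_basis[OF basis x] by metis
  have "\<exists>z\<in>W n. \<epsilon> \<le> bnu V j (bdiff V (I_mu V Y \<mu> H z) (I_mu V Y \<mu> F z))" for n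
    using contra W(1,2) by (meson not_less)
  then obtain z where zW: "\<And>n. z n \<in> W n"
      and far: "\<And>n. \<epsilon> \<le> bnu V j (bdiff V (I_mu V Y \<mu> H (z n)) (I_mu V Y \<mu> F (z n)))" by metis
  have zX: "z n \<in> X" for n using zW W(1) openin_subset by blast
  have HS: "H y \<in> stalk Z y" if "y \<in> X" for y
    using Gamma_at_stalk[OF H] that by (simp add: base_eq)
  have FS: "F y \<in> stalk Z y" if "y \<in> X" for y
    using Gamma_stalk[OF F] that by (simp add: base_eq)
  \<comment> \<open>Forming the difference in \<open>Z\<close> places it in a stalk of
    \<open>Z\<close>, whose elements are measurable maps; no closure of \<open>Meas\<close> under
    differences has to be proved.\<close>
  define g where "g n = bdiff Z (H (z n)) (F (z n))" for n
  have g: "g n \<in> stalk Z (z n)" for n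
    unfolding g_def using Z.bdiff_closed[OF _ HS FS] zX base_eq by simp
  have g_eq: "g n s = bdiff V (H (z n) s) (F (z n) s)" if "s \<in> topspace Y" for n s
    unfolding g_def by (rule bdiff_Z[OF zX HS[OF zX] FS[OF zX] that])
  define f where "f n s = bnu V j (g n s)" for n s
  define GH where "GH = (\<lambda>s. SUP y\<in>X. ennreal (bnu V j (H y s)))"
  define GF where "GF = (\<lambda>s. SUP y\<in>X. ennreal (bnu V j (F y s)))"
  have "E GH < \<infinity>" using Hui j by (simp add: ui_def GH_def)
  moreover have "E GF < \<infinity>" using Gamma_ui[OF F] j by (simp add: ui_def GF_def)
  ultimately have fin: "E (\<lambda>s. GH s + GF s) < \<infinity>"
    using ess_upper_add[of GH GF] by (auto simp: less_top[symmetric] top_unique ennreal_add_eq_top)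
  have stV: "f s \<in> stalk V y" if "y \<in> X" "f \<in> stalk Z y" "s \<in> topspace Y" for f y s
    using L1_stalk[OF that(1) stalk_L1[OF that(1,2)] that(3)] .
  have f0: "0 \<le> f n s" if "s \<in> topspace Y" for n s
    unfolding f_def by (rule nu_nonneg[OF zX j stV[OF zX g that]])
  have f_le: "ennreal (f n s) \<le> GH s + GF s" if s: "s \<in> topspace Y" for n s
  proof -
    have st: "H (z n) s \<in> stalk V (z n)" "F (z n) s \<in> stalk V (z n)"
      using stV[OF zX HS[OF zX] s] stV[OF zX FS[OF zX] s] .
    have "f n s \<le> bnu V j (H (z n) s) + bnu V j (F (z n) s)"
      unfolding f_def g_eq[OF s] by (rule nu_diff_le[OF zX j st])
    then have "ennreal (f n s) \<le> ennreal (bnu V j (H (z n) s)) + ennreal (bnu V j (F (z n) s))"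
      using nu_nonneg[OF zX j st(1)] nu_nonneg[OF zX j st(2)] by (simp add: ennreal_leI flip: ennreal_plus)
    also have "\<dots> \<le> GH s + GF s" unfolding GH_def GF_def using zX by (intro add_mono SUP_upper)
    finally show ?thesis .
  qed
  have f_L1pos: "f n \<in> L1pos" for n
  proof (rule measurable_L1pos[OF f0])
    show "R (f n) < \<infinity>" using ess_upper_mono[OF f_le] fin by (meson le_less_trans)
    show "\<exists>S C. S \<subseteq> K \<and> N (indicator S) = 0 \<and> (\<forall>n::nat. compactin Y (C n)) \<and> disjoint_family C \<and>
        K - S = (\<Union>n. C n) \<and> (\<forall>m. continuous_map (subtopology Y (C m)) euclideanreal (f n))"
      if "compactin Y K" for K
      unfolding f_def
      by (rule Meas_seminorm[OF omega_space_bundle_axioms zX j stalk_Meas[OF zX g] that])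
  qed
  have f_lim: "(\<lambda>n. f n s) \<longlonglongrightarrow> 0" if s: "s \<in> topspace Y" for s
  proof (rule LIMSEQ_I)
    fix r :: real assume "0 < r"
    from pointwise_near[OF x H F eq s j this]
    obtain U where U: "openin (base_top V) U" "x \<in> U" "\<forall>y\<in>U. bnu V j (bdiff V (H y s) (F y s)) < r"
      by (elim exE conjE)
    obtain n0 where n0: "W n0 \<subseteq> U" using W(4)[OF U(1,2)] by blast
    have "norm (f n s - 0) < r" if "n0 \<le> n" for n
    proof -
      have "z n \<in> U" using zW W(3)[OF that] n0 by blast
      then show ?thesis using bspec[OF U(3)] f0[OF s, of n] g_eq[OF s, of n] by (simp add: f_def)
    qed
    then show "\<exists>n0. \<forall>n\<ge>n0. norm (f n s - 0) < r" by blast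
  qed
  obtain n where n: "R (f n) < ennreal \<epsilon>"
    using L1pos_dominated_null_sequence[OF f_L1pos f_lim f_le fin \<epsilon>] by blast
  have "ennreal \<epsilon> \<le> ennreal (bnu V j (bdiff V (I_mu V Y \<mu> H (z n)) (I_mu V Y \<mu> F (z n))))"
    using far by (rule ennreal_leI)
  also have "\<dots> \<le> R (\<lambda>s. bnu V j (bdiff V (H (z n) s) (F (z n) s)))"
    using weak_integral_diff_bound[OF zX stalk_L1[OF zX HS[OF zX]] stalk_L1[OF zX FS[OF zX]] j] zX
    by (simp add: I_mu_def)
  also have "\<dots> = R (f n)"
    using g_eq by (intro antisym R_mono) (simp_all add: f_def)
  finally show False using n by simp
qed

theorem I_mu_diamond:
  assumes x: "x \<in> X" and basis: "countable_nhds_basis_at (base_top V) x"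
    and H: "H \<in> ui V Y \<mu> (Gamma_diamond Z x)"
  shows "I_mu V Y \<mu> H \<in> Gamma_diamond V x"
proof -
  have Hat: "H \<in> Gamma_at Z x" and Hui: "H \<in> ui V Y \<mu> UNIV"
    using H by (auto simp: ui_def Gamma_diamond_def)
  obtain F where F: "F \<in> Gamma Z" "H x = F x" using H by (auto simp: ui_def Gamma_diamond_def)
  have HL1: "H z \<in> L1_at z" if "z \<in> X" for z
    using Gamma_at_stalk[OF Hat] that by (intro stalk_L1) (simp_all add: base_eq)
  have IH: "I_mu V Y \<mu> H \<in> (\<Pi>\<^sub>E z\<in>X. stalk V z)"
    using HL1 weak_integral_stalk by (auto simp: I_mu_def)
  have "bdd_above ((\<lambda>z. bnu V j (I_mu V Y \<mu> H z)) ` X)" if j: "j \<in> bindex V" for j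
  proof -
    \<comment> \<open>Boundedness of the integrated section: the essential upper integral of the
      supremum over the base bounds the seminorm of the integral at every point at once.\<close>
    define c where "c = E (\<lambda>s. SUP z\<in>X. ennreal (bnu V j (H z s)))"
    have "c < \<infinity>" using Hui j by (simp add: ui_def c_def)
    then obtain r where r: "c = ennreal r" "0 \<le> r" by (cases c) auto
    have "bnu V j (I_mu V Y \<mu> H z) \<le> r" if z: "z \<in> X" for z
    proof -
      have "ennreal (bnu V j (I_mu V Y \<mu> H z)) \<le> R (\<lambda>s. bnu V j (H z s))"
        using weak_integral_bound[OF z HL1[OF z] j] z by (simp add: I_mu_def)
      also have "\<dots> \<le> c" unfolding c_def using z by (intro ess_upper_mono SUP_upper)
      finally show ?thesis using r by simp
    qed
    then show ?thesis by (intro bdd_aboveI2)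
  qed
  with IH have bounded: "I_mu V Y \<mu> H \<in> bounded_sections V X" by (simp add: bounded_sections_def)
  have eq: "I_mu V Y \<mu> H x = I_mu V Y \<mu> F x" using F(2) by (simp add: I_mu_def)
  have "topcontinuous_at (base_top V) (tot_top V) (I_mu V Y \<mu> H) x"
  proof (rule section_continuous_at[where \<sigma> = "I_mu V Y \<mu> H" and \<rho> = "I_mu V Y \<mu> F", OF _ I_mu_Gamma[OF F(1)] x eq])
    show "I_mu V Y \<mu> H \<in> (\<Pi> z\<in>X. stalk V z)" using IH by blast
    show "\<exists>W. openin (base_top V) W \<and> x \<in> W \<and> (\<forall>z\<in>W. bnu V j (bdiff V (I_mu V Y \<mu> H z) (I_mu V Y \<mu> F z)) < \<epsilon>)"
      if "j \<in> bindex V" "0 < \<epsilon>" for j \<epsilon>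
      by (rule integral_near[OF x basis Hat Hui F that])
  qed
  with bounded have "I_mu V Y \<mu> H \<in> Gamma_at V x" by (simp add: Gamma_at_on_def)
  with eq I_mu_Gamma[OF F(1)] show ?thesis by (auto simp: Gamma_diamond_def)
qed

end

theorem theorem3p3p6:
  fixes V :: "('x, 'e, 'j) obundle"
    and Z :: "('x, 'y \<Rightarrow> 'e, ('y \<times> 'j) set) obundle"
    and Y :: "'y topology"
    and \<mu> :: "('y \<Rightarrow> complex) \<Rightarrow> complex"
    and x :: 'x
  assumes "omega_bundle V"
    and "locally_compact_space Y" and "Hausdorff_space Y"
    and "radon_measure Y \<mu>"
    and "mu_related Y \<mu> V Z"
    and "x \<in> topspace (base_top V)"
    and "countable_nhds_basis_at (base_top V) x"
  shows "I_mu V Y \<mu> ` ui V Y \<mu> (Gamma_diamond Z x) \<subseteq> Gamma_diamond V x"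
proof -
  interpret mu_related_bundles Y \<mu> V Z
    using assms by unfold_locales
  show ?thesis using I_mu_diamond[OF assms(6,7)] by blast
qed

end
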